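(* Let $G$ and $G'$ be graded nilpotent Lie groups of step $r$, equipped with their left-invariant Carnot manifold structures, and let $\phi:G\to G'$ be a (smooth) Carnot manifold map. Then the Pansu derivative $D\phi(a)$ exists at every $a\in G$, and $$D\phi(a)=\Lambda_{\phi(a)}\circ\hat\phi'(a)\circ\Lambda_a^{-1}\qquad\text{for all }a\in G,$$ where $\hat\phi'(a)$ is the Carnot differential of $\phi$ at $a$. Thus, under the identifications $\Lambda_a:GG(a)\to G$ and $\Lambda_{\phi(a)}:GG'(\phi(a))\to G'$, the Pansu derivative agrees with the Carnot differential $\hat\phi'$ at every point.
   Context: A step $r$ graded nilpotent Lie algebra is a real Lie algebra with a grading $\mathfrak g=\mathfrak g_1\oplus\cdots\oplus\mathfrak g_r$ such that $[\mathfrak g_w,\mathfrak g_{w'}]\subset\mathfrak g_{w+w'}$ if $w+w'\le r$ and $[\mathfrak g_w,\mathfrak g_{w'}]=\{0\}$ if $w+w'>r$. A step $r$ graded nilpotent Lie group $G$ is a connected simply connected nilpotent Lie group (unit $e$) whose Lie algebra $\mathfrak g=T_eG$ is a step $r$ graded nilpotent Lie algebra. The exponential map $\exp:\mathfrak g\to G$ is a diffeomorphism. The dilations $\delta_t$ ($t\in\mathbb R\setminus0$) of $\mathfrak g$, $\delta_t(\xi_1+\cdots+\xi_r)=t\xi_1+\cdots+t^r\xi_r$ ($\xi_w\in\mathfrak g_w$), are Lie algebra automorphisms and lift via $\exp$ to group automorphisms $\delta_t$ of $G$. Left-invariant Carnot structure: for $a\in G$ let $\lambda_a:G\to G$ be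 left multiplication by $a$. Let $E_w\subset TG$ be the subbundle obtained by left-translating $\mathfrak g_w$, so $TG=E_1\oplus\cdots\oplus E_r$, and set $H_w=E_1\oplus\cdots\oplus E_w$. Then $H=(H_1,\ldots,H_r)$ satisfies $[H_w,H_{w'}]\subset H_{w+w'}$ for $w+w'\le r$ (on sections). The same is done for $G'$ with filtration $H'$. A Carnot manifold map $\phi:G\to G'$ is a smooth map with $\phi'(x)(H_w(x))\subset H'_w(\phi(x))$ for all $x\in G$ and $w=1,\ldots,r$. Tangent groups: with $H_0=\{0\}$, $\mathfrak g_wG(a)=H_w(a)/H_{w-1}(a)\simeq E_w(a)$ and $\mathfrak gG(a)=\bigoplus_w\mathfrak g_wG(a)\simeq TG(a)$, via the grading $TG(a)=\bigoplus_wE_w(a)$. The tangent group $GG(a)$ has underlying set $\mathfrak gG(a)$, with group law the Baker-Campbell-Hausdorff product for the Lie bracket induced on $\mathfrak gG(a)$ by brackets of sections of the $H_w$ (class of $[X,Y](a)$ in $\mathfrak g_{w+w'}G(a)$ for $X$, $Y$ sections of $H_w$, $H_{w'}$; zero if $w+w'>r$). Define $\Lambda_a=\exp\circ\lambda_a'(e)^{-1}:GG(a)=\mathfrak gG(a)\simeq TG(a)\to G$ (a group isomorphism), and similarly $\Lambda_{a'}:GG'(a')\to G'$ for $a'\in G'$. Carnot differential: $\hat\phi'(a):GG(a)\to GG'(\phi(a))$ is the direct sum over $w=1,\ldots,r$ of the linear maps $\mathfrak g_wG(a)\to\mathfrak g_wG'(\phi(a))$ induced by the differential $\phi'(a)$.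 Pansu derivative: the Pansu derivative of a map $\phi:G\to G'$ at $a\in G$ is the map $D\phi(a):G\to G'$ given by $D\phi(a)x=\lim_{t\to0}\delta_t^{-1}\big[\phi(a)^{-1}\cdot\phi(a\cdot\delta_t(x))\big]$, $x\in G$, provided the limit exists (for every $x\in G$). *)

theory Defs
  imports
    "HOL-Analysis.Analysis"
    "HOL-Algebra.Generated_Groups"
    "HOL-Library.Function_Algebras"
    "HOL-Library.Set_Algebras"
begin

section \<open>Smooth manifolds\<close>

primrec k_smooth_on :: "nat \<Rightarrow> 'a::real_normed_vector set \<Rightarrow> ('a \<Rightarrow> 'b::real_normed_vector) \<Rightarrow> bool"
  where
    "k_smooth_on 0 S f \<longleftrightarrow> continuous_on S f"
  | "k_smooth_on (Suc k) S f \<longleftrightarrow>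
       (\<forall>x\<in>S. f differentiable (at x)) \<and> (\<forall>v. k_smooth_on k S (\<lambda>x. frechet_derivative f (at x) v))"

definition smooth_on :: "'a::real_normed_vector set \<Rightarrow> ('a \<Rightarrow> 'b::real_normed_vector) \<Rightarrow> bool"
  where "smooth_on S f \<longleftrightarrow> (\<forall>k. k_smooth_on k S f)"

text \<open>A manifold is a type (of points) together with an atlas; a chart is a pair of its domain and
  its coordinate map, whose values off the domain are irrelevant.\<close>

type_synonym ('m, 'e) atlas = "('m set \<times> ('m \<Rightarrow> 'e)) set"

definition smooth_atlas :: "('m::topological_space, 'e::euclidean_space) atlas \<Rightarrow> bool"
  where "smooth_atlas A \<longleftrightarrow>
    (\<Union>(U, \<psi>)\<in>A. U) = UNIV \<and>
    (\<forall>(U, \<psi>)\<in>A. open U \<and> open (\<psi> ` U) \<and> homeomorphism U (\<psi> ` U) \<psi> (inv_into U \<psi>)) \<and>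
    (\<forall>(U, \<psi>)\<in>A. \<forall>(V, \<theta>)\<in>A. smooth_on (\<psi> ` (U \<inter> V)) (\<theta> \<circ> inv_into U \<psi>))"

definition smooth_map ::
    "('m::topological_space, 'e::euclidean_space) atlas \<Rightarrow>
     ('n::topological_space, 'f::euclidean_space) atlas \<Rightarrow> ('m \<Rightarrow> 'n) \<Rightarrow> bool"
  where "smooth_map A B \<phi> \<longleftrightarrow>
    continuous_on UNIV \<phi> \<and>
    (\<forall>(U, \<psi>)\<in>A. \<forall>(V, \<theta>)\<in>B. smooth_on (\<psi> ` (U \<inter> \<phi> -` V)) (\<theta> \<circ> \<phi> \<circ> inv_into U \<psi>))"

definition diffeomorphism ::
    "('m::topological_space, 'e::euclidean_space) atlas \<Rightarrow>
     ('n::topological_space, 'f::euclidean_space) atlas \<Rightarrow> ('m \<Rightarrow> 'n) \<Rightarrow> bool"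
  where "diffeomorphism A B \<phi> \<longleftrightarrow> bij \<phi> \<and> smooth_map A B \<phi> \<and> smooth_map B A (inv_into UNIV \<phi>)"

definition euclid_atlas :: "('e::euclidean_space, 'e) atlas"
  where "euclid_atlas = {(UNIV, \<lambda>x. x)}"

definition prod_atlas :: "('m, 'e) atlas \<Rightarrow> ('n, 'f) atlas \<Rightarrow> ('m \<times> 'n, 'e \<times> 'f) atlas"
  where "prod_atlas A B = {(U \<times> V, map_prod \<psi> \<theta>) | U \<psi> V \<theta>. (U, \<psi>) \<in> A \<and> (V, \<theta>) \<in> B}"

definition smooth_functions :: "('m::topological_space, 'e::euclidean_space) atlas \<Rightarrow> ('m \<Rightarrow> real) set"
  where "smooth_functions A = {f. smooth_map A euclid_atlas f}"


section \<open>Tangent vectors and vector fields\<close>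

text \<open>A tangent vector is the velocity of a smooth curve, regarded as an operator on smooth
  real functions. Operators are set to \<open>0\<close> outside the smooth functions, so that two of them are
  equal iff they agree on all smooth functions. The linear structure is pointwise.\<close>

instantiation "fun" :: (type, real_vector) real_vector
begin

definition scaleR_fun_def: "scaleR c f = (\<lambda>x. c *\<^sub>R f x)"

instance
  by standard (simp_all add: scaleR_fun_def fun_eq_iff scaleR_add_right scaleR_add_left)

end

type_synonym 'm tangent = "('m \<Rightarrow> real) \<Rightarrow> real"

definition velocity ::
    "('m::topological_space, 'e::euclidean_space) atlas \<Rightarrow> (real \<Rightarrow> 'm) \<Rightarrow> real \<Rightarrow> 'm tangent"
  where "velocity A \<gamma> t = (\<lambda>f. if f \<in> smooth_functions A then deriv (f \<circ> \<gamma>) t else 0)"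

definition tangent_space ::
    "('m::topological_space, 'e::euclidean_space) atlas \<Rightarrow> 'm \<Rightarrow> 'm tangent set"
  where "tangent_space A p = {velocity A \<gamma> 0 | \<gamma>. smooth_map euclid_atlas A \<gamma> \<and> \<gamma> 0 = p}"

text \<open>The differential of \<open>\<phi>\<close> into a manifold with atlas \<open>B\<close>; the base point of \<open>v\<close> need not be
  named, because the operator \<open>v\<close> already carries it.\<close>

definition differential ::
    "('n::topological_space, 'f::euclidean_space) atlas \<Rightarrow> ('m \<Rightarrow> 'n) \<Rightarrow> 'm tangent \<Rightarrow> 'n tangent"
  where "differential B \<phi> v = (\<lambda>f. if f \<in> smooth_functions B then v (f \<circ> \<phi>) else 0)"

definition smooth_vector_field ::
    "('m::topological_space, 'e::euclidean_space) atlas \<Rightarrow> ('m \<Rightarrow> 'm tangent) \<Rightarrow> bool"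
  where "smooth_vector_field A X \<longleftrightarrow>
    (\<forall>p. X p \<in> tangent_space A p) \<and>
    (\<forall>f\<in>smooth_functions A. (\<lambda>p. X p f) \<in> smooth_functions A)"

definition vf_bracket ::
    "('m::topological_space, 'e::euclidean_space) atlas \<Rightarrow>
     ('m \<Rightarrow> 'm tangent) \<Rightarrow> ('m \<Rightarrow> 'm tangent) \<Rightarrow> 'm \<Rightarrow> 'm tangent"
  where "vf_bracket A X Y p =
    (\<lambda>f. if f \<in> smooth_functions A then X p (\<lambda>q. Y q f) - Y p (\<lambda>q. X q f) else 0)"


section \<open>Lie groups\<close>

record ('a, 'e) smooth_group = "'a monoid" +
  charts :: "('a, 'e) atlas"

definition lie_group ::
    "('a::{t2_space,second_countable_topology}, 'e::euclidean_space, 'z) smooth_group_scheme \<Rightarrow> bool"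
  where "lie_group G \<longleftrightarrow>
    group G \<and> carrier G = UNIV \<and> smooth_atlas (charts G) \<and>
    smooth_map (prod_atlas (charts G) (charts G)) (charts G) (\<lambda>(x, y). x \<otimes>\<^bsub>G\<^esub> y) \<and>
    smooth_map (charts G) (charts G) (\<lambda>x. inv\<^bsub>G\<^esub> x)"

definition left_mult :: "('a, 'z) monoid_scheme \<Rightarrow> 'a \<Rightarrow> 'a \<Rightarrow> 'a"
  where "left_mult G a x = a \<otimes>\<^bsub>G\<^esub> x"

definition lie_algebra ::
    "('a::topological_space, 'e::euclidean_space, 'z) smooth_group_scheme \<Rightarrow> 'a tangent set"
  where "lie_algebra G = tangent_space (charts G) \<one>\<^bsub>G\<^esub>"

definition left_invariant_field ::
    "('a::topological_space, 'e::euclidean_space, 'z) smooth_group_scheme \<Rightarrow> 'a tangent \<Rightarrow> 'a \<Rightarrow> 'a tangent"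
  where "left_invariant_field G \<xi> a = differential (charts G) (left_mult G a) \<xi>"

definition lie_bracket ::
    "('a::topological_space, 'e::euclidean_space, 'z) smooth_group_scheme \<Rightarrow>
     'a tangent \<Rightarrow> 'a tangent \<Rightarrow> 'a tangent"
  where "lie_bracket G \<xi> \<eta> =
    vf_bracket (charts G) (left_invariant_field G \<xi>) (left_invariant_field G \<eta>) \<one>\<^bsub>G\<^esub>"

definition one_parameter_subgroup ::
    "('a::topological_space, 'e::euclidean_space, 'z) smooth_group_scheme \<Rightarrow> (real \<Rightarrow> 'a) \<Rightarrow> bool"
  where "one_parameter_subgroup G \<gamma> \<longleftrightarrow>
    smooth_map euclid_atlas (charts G) \<gamma> \<and> (\<forall>s t. \<gamma> (s + t) = \<gamma> s \<otimes>\<^bsub>G\<^esub> \<gamma> t)"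

definition lie_exp ::
    "('a::topological_space, 'e::euclidean_space, 'z) smooth_group_scheme \<Rightarrow> 'a tangent \<Rightarrow> 'a"
  where "lie_exp G \<xi> =
    (THE g. \<exists>\<gamma>. one_parameter_subgroup G \<gamma> \<and> velocity (charts G) \<gamma> 0 = \<xi> \<and> \<gamma> 1 = g)"

text \<open>The smooth structure of the vector space \<open>lie_algebra G\<close> is the one transported by any linear
  isomorphism \<open>\<beta>\<close> from the model space of the charts.\<close>

definition exp_diffeomorphism ::
    "('a::topological_space, 'e::euclidean_space, 'z) smooth_group_scheme \<Rightarrow> bool"
  where "exp_diffeomorphism G \<longleftrightarrow>
    (\<exists>\<beta> :: 'e \<Rightarrow> 'a tangent. linear \<beta> \<and> bij_betw \<beta> UNIV (lie_algebra G) \<and>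
      diffeomorphism euclid_atlas (charts G) (lie_exp G \<circ> \<beta>))"

primrec lower_central :: "('a, 'z) monoid_scheme \<Rightarrow> nat \<Rightarrow> 'a set"
  where
    "lower_central G 0 = carrier G"
  | "lower_central G (Suc n) =
       generate G {x \<otimes>\<^bsub>G\<^esub> y \<otimes>\<^bsub>G\<^esub> inv\<^bsub>G\<^esub> x \<otimes>\<^bsub>G\<^esub> inv\<^bsub>G\<^esub> y | x y.
         x \<in> carrier G \<and> y \<in> lower_central G n}"

definition nilpotent_group :: "('a, 'z) monoid_scheme \<Rightarrow> bool"
  where "nilpotent_group G \<longleftrightarrow> group G \<and> (\<exists>n. lower_central G n = {\<one>\<^bsub>G\<^esub>})"


section \<open>Graded nilpotent Lie groups\<close>

definition direct_sum :: "nat \<Rightarrow> (nat \<Rightarrow> 'v::real_vector set) \<Rightarrow> 'v set \<Rightarrow> bool"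
  where "direct_sum r V T \<longleftrightarrow>
    (\<forall>w\<in>{1..r}. subspace (V w)) \<and>
    bij_betw (\<lambda>\<xi>. \<Sum>w=1..r. \<xi> w) (\<Pi>\<^sub>E w\<in>{1..r}. V w) T"

definition component :: "nat \<Rightarrow> (nat \<Rightarrow> 'v::real_vector set) \<Rightarrow> nat \<Rightarrow> 'v \<Rightarrow> 'v"
  where "component r V w v = inv_into (\<Pi>\<^sub>E w\<in>{1..r}. V w) (\<lambda>\<xi>. \<Sum>w=1..r. \<xi> w) v w"

record ('a, 'e) graded_group = "('a, 'e) smooth_group" +
  layer :: "nat \<Rightarrow> 'a tangent set"

definition graded_lie_algebra ::
    "nat \<Rightarrow> ('a::topological_space, 'e::euclidean_space) graded_group \<Rightarrow> bool"
  where "graded_lie_algebra r G \<longleftrightarrow>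
    direct_sum r (layer G) (lie_algebra G) \<and>
    (\<forall>w\<in>{1..r}. \<forall>w'\<in>{1..r}. \<forall>\<xi>\<in>layer G w. \<forall>\<eta>\<in>layer G w'.
      (w + w' \<le> r \<longrightarrow> lie_bracket G \<xi> \<eta> \<in> layer G (w + w')) \<and>
      (w + w' > r \<longrightarrow> lie_bracket G \<xi> \<eta> = 0))"

text \<open>That the exponential map of a connected simply connected nilpotent Lie group is a
  diffeomorphism is a standard theorem, which is not available in the libraries; it is recorded here
  as part of the notion and excludes no such group.\<close>

definition graded_nilpotent_lie_group ::
    "nat \<Rightarrow> ('a::{t2_space,second_countable_topology}, 'e::euclidean_space) graded_group \<Rightarrow> bool"
  where "graded_nilpotent_lie_group r G \<longleftrightarrow>
    lie_group G \<and> connected (UNIV :: 'a set) \<and> simply_connected (UNIV :: 'a set) \<and>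
    nilpotent_group G \<and> graded_lie_algebra r G \<and> exp_diffeomorphism G"

definition algebra_dilation ::
    "nat \<Rightarrow> ('a::topological_space, 'e::euclidean_space) graded_group \<Rightarrow> real \<Rightarrow> 'a tangent \<Rightarrow> 'a tangent"
  where "algebra_dilation r G t \<xi> = (\<Sum>w=1..r. t ^ w *\<^sub>R component r (layer G) w \<xi>)"

definition dilation ::
    "nat \<Rightarrow> ('a::topological_space, 'e::euclidean_space) graded_group \<Rightarrow> real \<Rightarrow> 'a \<Rightarrow> 'a"
  where "dilation r G t x =
    lie_exp G (algebra_dilation r G t (inv_into (lie_algebra G) (lie_exp G) x))"


section \<open>Carnot structure and tangent groups\<close>

definition carnot_layer ::
    "('a::topological_space, 'e::euclidean_space) graded_group \<Rightarrow> nat \<Rightarrow> 'a \<Rightarrow> 'a tangent set"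
  where "carnot_layer G w a = differential (charts G) (left_mult G a) ` layer G w"

text \<open>The sum is a sum of sets of vectors; in particular \<open>filtration G 0 a = {0}\<close>.\<close>

definition filtration ::
    "('a::topological_space, 'e::euclidean_space) graded_group \<Rightarrow> nat \<Rightarrow> 'a \<Rightarrow> 'a tangent set"
  where "filtration G w a = (\<Sum>i=1..w. carnot_layer G i a)"

definition filtration_sections ::
    "('a::topological_space, 'e::euclidean_space) graded_group \<Rightarrow> nat \<Rightarrow> ('a \<Rightarrow> 'a tangent) set"
  where "filtration_sections G w =
    {X. smooth_vector_field (charts G) X \<and> (\<forall>p. X p \<in> filtration G w p)}"

definition carnot_map ::
    "nat \<Rightarrow> ('a::topological_space, 'e::euclidean_space) graded_group \<Rightarrow>
     ('b::topological_space, 'f::euclidean_space) graded_group \<Rightarrow> ('a \<Rightarrow> 'b) \<Rightarrow> bool"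
  where "carnot_map r G G' \<phi> \<longleftrightarrow>
    smooth_map (charts G) (charts G') \<phi> \<and>
    (\<forall>x. \<forall>w\<in>{1..r}. differential (charts G') \<phi> ` filtration G w x \<subseteq> filtration G' w (\<phi> x))"

text \<open>Elements of the quotient \<open>H\<^sub>w(a) / H\<^sub>w\<^sub>-\<^sub>1(a)\<close> are the cosets themselves, and an element of the
  direct sum of these quotients is the family of its components.\<close>

definition gr_class ::
    "('a::topological_space, 'e::euclidean_space) graded_group \<Rightarrow> 'a \<Rightarrow> nat \<Rightarrow> 'a tangent \<Rightarrow> 'a tangent set"
  where "gr_class G a w v = v +o filtration G (w - 1) a"

definition gr_space ::
    "nat \<Rightarrow> ('a::topological_space, 'e::euclidean_space) graded_group \<Rightarrow> 'a \<Rightarrow> (nat \<Rightarrow> 'a tangent set) set"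
  where "gr_space r G a = (\<Pi>\<^sub>E w\<in>{1..r}. gr_class G a w ` filtration G w a)"

text \<open>The identification of the tangent space at \<open>a\<close> with \<open>gr_space r G a\<close>.\<close>

definition gr_of_tangent ::
    "nat \<Rightarrow> ('a::topological_space, 'e::euclidean_space) graded_group \<Rightarrow> 'a \<Rightarrow>
     'a tangent \<Rightarrow> nat \<Rightarrow> 'a tangent set"
  where "gr_of_tangent r G a v =
    (\<lambda>w\<in>{1..r}. gr_class G a w (component r (\<lambda>i. carnot_layer G i a) w v))"

definition tangent_of_gr ::
    "nat \<Rightarrow> ('a::topological_space, 'e::euclidean_space) graded_group \<Rightarrow> 'a \<Rightarrow>
     (nat \<Rightarrow> 'a tangent set) \<Rightarrow> 'a tangent"
  where "tangent_of_gr r G a = inv_into (tangent_space (charts G) a) (gr_of_tangent r G a)"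

text \<open>The bracket of homogeneous classes \<open>x\<close>, \<open>y\<close> of weights \<open>w\<close>, \<open>w'\<close>.\<close>

definition class_bracket ::
    "('a::topological_space, 'e::euclidean_space) graded_group \<Rightarrow> 'a \<Rightarrow> nat \<Rightarrow> nat \<Rightarrow>
     'a tangent set \<Rightarrow> 'a tangent set \<Rightarrow> 'a tangent set"
  where "class_bracket G a w w' x y =
    (THE c. \<exists>X\<in>filtration_sections G w. \<exists>Y\<in>filtration_sections G w'.
      X a \<in> x \<and> Y a \<in> y \<and> c = gr_class G a (w + w') (vf_bracket (charts G) X Y a))"

text \<open>The leading summand is the zero class of weight \<open>k\<close>; cosets are added as sets.\<close>

definition gr_bracket ::
    "nat \<Rightarrow> ('a::topological_space, 'e::euclidean_space) graded_group \<Rightarrow> 'a \<Rightarrow>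
     (nat \<Rightarrow> 'a tangent set) \<Rightarrow> (nat \<Rightarrow> 'a tangent set) \<Rightarrow> nat \<Rightarrow> 'a tangent set"
  where "gr_bracket r G a \<Xi> \<Theta> =
    (\<lambda>k\<in>{1..r}. filtration G (k - 1) a + (\<Sum>w\<in>{1..<k}. class_bracket G a w (k - w) (\<Xi> w) (\<Theta> (k - w))))"

fun nested_bracket :: "('v::zero \<Rightarrow> 'v \<Rightarrow> 'v) \<Rightarrow> 'v list \<Rightarrow> 'v"
  where
    "nested_bracket br [] = 0"
  | "nested_bracket br [x] = x"
  | "nested_bracket br (x # y # zs) = br x (nested_bracket br (y # zs))"

text \<open>Dynkin's form of the Baker-Campbell-Hausdorff series, for a bracket \<open>br\<close> whose iterated brackets
  with more than \<open>r\<close> entries vanish.\<close>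

definition bch :: "nat \<Rightarrow> ('v::real_vector \<Rightarrow> 'v \<Rightarrow> 'v) \<Rightarrow> 'v \<Rightarrow> 'v \<Rightarrow> 'v"
  where "bch r br x y =
    (\<Sum>n=1..r. \<Sum>ps | length ps = n \<and> (\<forall>(p, q)\<in>set ps. p + q > 0) \<and> (\<Sum>(p, q)\<leftarrow>ps. p + q) \<le> r.
      ((-1) ^ (n - 1) /
        (real n * real (\<Sum>(p, q)\<leftarrow>ps. p + q) * (\<Prod>(p, q)\<leftarrow>ps. fact p * fact q))) *\<^sub>R
      nested_bracket br (concat (map (\<lambda>(p, q). replicate p x @ replicate q y) ps)))"

text \<open>The linear structure of \<open>gr_space r G a\<close> needed for the Baker-Campbell-Hausdorff product is taken
  from the tangent space at \<open>a\<close> through the identification above.\<close>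

definition tangent_group ::
    "nat \<Rightarrow> ('a::topological_space, 'e::euclidean_space) graded_group \<Rightarrow> 'a \<Rightarrow> (nat \<Rightarrow> 'a tangent set) monoid"
  where "tangent_group r G a =
    \<lparr> carrier = gr_space r G a,
      mult = (\<lambda>\<Xi> \<Theta>. gr_of_tangent r G a
        (bch r (\<lambda>u v. tangent_of_gr r G a
                 (gr_bracket r G a (gr_of_tangent r G a u) (gr_of_tangent r G a v)))
          (tangent_of_gr r G a \<Xi>) (tangent_of_gr r G a \<Theta>))),
      one = gr_of_tangent r G a 0 \<rparr>"

definition Lambda ::
    "nat \<Rightarrow> ('a::topological_space, 'e::euclidean_space) graded_group \<Rightarrow> 'a \<Rightarrow>
     (nat \<Rightarrow> 'a tangent set) \<Rightarrow> 'a"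
  where "Lambda r G a \<Xi> =
    lie_exp G (inv_into (lie_algebra G) (differential (charts G) (left_mult G a)) (tangent_of_gr r G a \<Xi>))"

text \<open>The image of a coset of \<open>H\<^sub>w\<^sub>-\<^sub>1(a)\<close> lies in a single coset of \<open>H'\<^sub>w\<^sub>-\<^sub>1(\<phi>(a))\<close>, which is recovered
  by adding that subspace.\<close>

definition carnot_differential ::
    "nat \<Rightarrow> ('a::topological_space, 'e::euclidean_space) graded_group \<Rightarrow>
     ('b::topological_space, 'f::euclidean_space) graded_group \<Rightarrow> ('a \<Rightarrow> 'b) \<Rightarrow> 'a \<Rightarrow>
     (nat \<Rightarrow> 'a tangent set) \<Rightarrow> nat \<Rightarrow> 'b tangent set"
  where "carnot_differential r G G' \<phi> a \<Xi> =
    (\<lambda>w\<in>{1..r}. differential (charts G') \<phi> ` \<Xi> w + filtration G' (w - 1) (\<phi> a))"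


section \<open>Pansu derivative\<close>

definition pansu_quotient ::
    "nat \<Rightarrow> ('a::topological_space, 'e::euclidean_space) graded_group \<Rightarrow>
     ('b::topological_space, 'f::euclidean_space) graded_group \<Rightarrow> ('a \<Rightarrow> 'b) \<Rightarrow> 'a \<Rightarrow> 'a \<Rightarrow> real \<Rightarrow> 'b"
  where "pansu_quotient r G G' \<phi> a x t =
    inv_into UNIV (dilation r G' t) (inv\<^bsub>G'\<^esub> (\<phi> a) \<otimes>\<^bsub>G'\<^esub> \<phi> (a \<otimes>\<^bsub>G\<^esub> dilation r G t x))"

definition pansu_differentiable ::
    "nat \<Rightarrow> ('a::topological_space, 'e::euclidean_space) graded_group \<Rightarrow>
     ('b::topological_space, 'f::euclidean_space) graded_group \<Rightarrow> ('a \<Rightarrow> 'b) \<Rightarrow> 'a \<Rightarrow> bool"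
  where "pansu_differentiable r G G' \<phi> a \<longleftrightarrow>
    (\<forall>x. \<exists>l. (pansu_quotient r G G' \<phi> a x \<longlongrightarrow> l) (at 0))"

definition pansu_derivative ::
    "nat \<Rightarrow> ('a::topological_space, 'e::euclidean_space) graded_group \<Rightarrow>
     ('b::t2_space, 'f::euclidean_space) graded_group \<Rightarrow> ('a \<Rightarrow> 'b) \<Rightarrow> 'a \<Rightarrow> 'a \<Rightarrow> 'b"
  where "pansu_derivative r G G' \<phi> a x = Lim (at 0) (pansu_quotient r G G' \<phi> a x)"

end

theory Submission
  imports Defs
begin

text \<open>In the global chart given by the exponential map, left-trivialize the differential of \<open>\<phi>\<close>: as a
  Carnot map it becomes a block-triangular matrix \<open>A(x)\<close>, so that \<open>\<delta>\<^bsub>1/t\<^esub> A(\<delta>\<^bsub>t\<^esub> x) \<delta>\<^bsub>t\<^esub>\<close> extends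
  continuously to \<open>t = 0\<close>, with the block-diagonal part \<open>L\<close> of \<open>A(0)\<close> as its value. It relates the left
  logarithmic derivatives of \<open>s \<mapsto> \<delta>\<^bsub>s\<^esub> x\<close> and of \<open>s \<mapsto> \<delta>\<^bsub>1/t\<^esub> \<phi>(\<delta>\<^bsub>ts\<^esub> x)\<close>. By the Maurer-Cartan equation \<open>L\<close>
  is a Lie algebra homomorphism, hence (like the dilations) it intertwines the left-invariant vector
  fields in exponential coordinates, and \<open>s \<mapsto> L(\<delta>\<^bsub>s\<^esub> x)\<close> has the limiting logarithmic derivative. Curves
  that start at the unit and have uniformly close logarithmic derivatives stay close, and \<open>s = 1\<close> gives
  the claim.\<close>


section \<open>Calculus of smooth maps\<close>

text \<open>The obstacle is the division of the weight \<open>w\<close> coordinate by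
  \<open>t ^ w\<close>: the differential at \<open>a\<close> alone controls increments only up to
  o(t), which says too little once \<open>w > 1\<close>. The missing information is the Carnot
  condition at all points near \<open>a\<close>, and it enters by integration along a curve.
  Dilation orbits are the right curves because a dilation only reparametrizes them: the logarithmic
  derivative of \<open>s \<mapsto> \<delta>_(ts) x\<close> is \<open>\<delta>_t\<close> applied to a
  vector that does not depend on \<open>t\<close>, so the conjugated differential appears by itself.
  All curves are explicit and only have to be compared. For this the quotient of two curves is
  differentiated: its derivative is linear in the difference of the logarithmic derivatives. The
  bracket reaches the group law through the derivative of the exponential map, which solves a linear
  equation along each ray whose coefficients involve only the bracket. In the Maurer-Cartan equation
  the unwanted derivative terms drop out because a block that vanishes at every point has zero
  derivative; the leading weight then gives the homomorphism identity.\<close>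

abbreviation fd :: "('a::real_normed_vector \<Rightarrow> 'b::real_normed_vector) \<Rightarrow> 'a \<Rightarrow> 'a \<Rightarrow> 'b"
  where "fd f x \<equiv> frechet_derivative f (at x)"

lemma fd_eqI: "(f has_derivative f') (at x) \<Longrightarrow> fd f x = f'"
  using frechet_derivative_at by metis

lemma has_derivative_fd: "f differentiable (at x) \<Longrightarrow> (f has_derivative fd f x) (at x)"
  using frechet_derivative_works by blast

lemma k_smooth_on_subset: "k_smooth_on k S f \<Longrightarrow> T \<subseteq> S \<Longrightarrow> k_smooth_on k T f"
  by (induction k arbitrary: f) (auto intro: continuous_on_subset)

lemma k_smooth_on_Suc_imp: "k_smooth_on (Suc k) S f \<Longrightarrow> k_smooth_on k S f"
proof (induction k arbitrary: f)
  case 0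
  then show ?case
    by (auto simp: differentiable_imp_continuous_within intro!: continuous_at_imp_continuous_on)
qed auto

text \<open>The derivative is the unrestricted one \<open>at x\<close>, so agreement on a set
  determines it only if the set is open. This is why \<open>open S\<close> accompanies most closure
  properties below.\<close>

lemma fd_cong_open:
  assumes "open S" "x \<in> S" "\<And>y. y \<in> S \<Longrightarrow> f y = g y"
  shows "f differentiable (at x) \<longleftrightarrow> g differentiable (at x)" "fd f x = fd g x"
proof -
  have h: "(f has_derivative f') (at x) \<longleftrightarrow> (g has_derivative f') (at x)" for f'
    using has_derivative_transform_within_open[OF _ assms(1,2)] assms(3) by metis
  then show "f differentiable (at x) \<longleftrightarrow> g differentiable (at x)"
    by (simp add: differentiable_def)
  show "fd f x = fd g x"
    by (simp add: frechet_derivative_def h)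
qed

lemma k_smooth_on_cong:
  assumes "open S" "\<And>y. y \<in> S \<Longrightarrow> f y = g y" "k_smooth_on k S f"
  shows "k_smooth_on k S g"
  using assms(2,3)
proof (induction k arbitrary: f g)
  case 0 then show ?case using continuous_on_cong by force
next
  case (Suc k)
  have "f differentiable (at x) \<longleftrightarrow> g differentiable (at x)" "fd f x = fd g x" if "x \<in> S" for x
    using fd_cong_open[OF assms(1) that] Suc.prems(1) by blast+
  moreover have "k_smooth_on k S (\<lambda>x. fd g x v)" for v
    by (rule Suc.IH[of "\<lambda>x. fd f x v"]) (use calculation Suc.prems in auto)
  ultimately show ?case using Suc.prems by auto
qed

lemma k_smooth_on_local:
  assumes "\<And>x. x \<in> S \<Longrightarrow> \<exists>T. open T \<and> x \<in> T \<and> k_smooth_on k T f"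
  shows "k_smooth_on k S f"
  using assms
proof (induction k arbitrary: f)
  case 0
  show ?case
  proof (simp, rule continuous_at_imp_continuous_on, safe)
    fix x assume "x \<in> S"
    then obtain T where "open T" "x \<in> T" "continuous_on T f" using 0 by auto
    then show "isCont f x" using continuous_on_eq_continuous_at by blast
  qed
next
  case (Suc k)
  have "f differentiable (at x)" if "x \<in> S" for x using Suc.prems[OF that] by auto
  moreover have "k_smooth_on k S (\<lambda>x. fd f x v)" for v
    by (rule Suc.IH) (use Suc.prems in fastforce)
  ultimately show ?case by simp
qed

lemma k_smooth_on_const [simp]: "k_smooth_on k S (\<lambda>x. c)"
  by (induction k arbitrary: c) (auto simp: fd_eqI[OF has_derivative_const])

lemma k_smooth_on_bounded_linear:
  assumes "bounded_linear f" shows "k_smooth_on k S f"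
proof (cases k)
  case 0 then show ?thesis
    by (simp add: assms linear_continuous_on)
next
  case (Suc n)
  have d: "(f has_derivative f) (at x)" for x
    using assms bounded_linear_imp_has_derivative by blast
  show ?thesis using Suc by (auto simp: fd_eqI[OF d] intro: differentiableI[OF d])
qed

lemma k_smooth_on_linear_compose:
  assumes "bounded_linear L" "open S" "k_smooth_on k S f"
  shows "k_smooth_on k S (\<lambda>x. L (f x))"
  using assms(3)
proof (induction k arbitrary: f)
  case 0 then show ?case
    using assms(1) bounded_linear.continuous_on by auto
next
  case (Suc k)
  have d: "((\<lambda>x. L (f x)) has_derivative (\<lambda>v. L (fd f x v))) (at x)" if "x \<in> S" for x
    using Suc.prems that has_derivative_fd[of f x] bounded_linear.has_derivative[OF assms(1)] by auto
  have "k_smooth_on k S (\<lambda>x. fd (\<lambda>x. L (f x)) x v)" for v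
    by (rule k_smooth_on_cong[OF assms(2) _ Suc.IH[of "\<lambda>x. fd f x v"]])
      (use fd_eqI[OF d] Suc.prems in auto)
  then show ?case using d by (auto intro: differentiableI)
qed

lemma k_smooth_on_Pair:
  assumes "open S" "k_smooth_on k S f" "k_smooth_on k S g"
  shows "k_smooth_on k S (\<lambda>x. (f x, g x))"
  using assms(2,3)
proof (induction k arbitrary: f g)
  case 0 then show ?case by (auto intro: continuous_on_Pair)
next
  case (Suc k)
  have d: "((\<lambda>x. (f x, g x)) has_derivative (\<lambda>v. (fd f x v, fd g x v))) (at x)" if "x \<in> S" for x
    using Suc.prems that has_derivative_fd[of f x] has_derivative_fd[of g x]
    by (auto intro: has_derivative_Pair)
  have "k_smooth_on k S (\<lambda>x. fd (\<lambda>x. (f x, g x)) x v)" for v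
    by (rule k_smooth_on_cong[OF assms(1) _ Suc.IH[of "\<lambda>x. fd f x v" "\<lambda>x. fd g x v"]])
      (use fd_eqI[OF d] Suc.prems in auto)
  then show ?case using d by (auto intro: differentiableI)
qed

lemma k_smooth_on_add:
  assumes "open S" "k_smooth_on k S f" "k_smooth_on k S g"
  shows "k_smooth_on k S (\<lambda>x. f x + g x)"
  using k_smooth_on_linear_compose[OF _ assms(1) k_smooth_on_Pair[OF assms], of "\<lambda>z. fst z + snd z"]
  by (simp add: bounded_linear_add bounded_linear_fst bounded_linear_snd)

lemma k_smooth_on_sum:
  assumes "open S" "\<And>i. i \<in> I \<Longrightarrow> k_smooth_on k S (f i)"
  shows "k_smooth_on k S (\<lambda>x. \<Sum>i\<in>I. f i x)"
proof (cases "finite I")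
  case True
  then show ?thesis using assms(2)
    by (induction I) (auto intro: k_smooth_on_add[OF assms(1)])
qed simp

lemma k_smooth_on_bilinear:
  assumes "bounded_bilinear B" "open S" "k_smooth_on k S f" "k_smooth_on k S g"
  shows "k_smooth_on k S (\<lambda>x. B (f x) (g x))"
  using assms(3,4)
proof (induction k arbitrary: f g)
  case 0 then show ?case
    using bounded_bilinear.continuous_on[OF assms(1)] by auto
next
  case (Suc k)
  have d: "((\<lambda>x. B (f x) (g x)) has_derivative (\<lambda>v. B (f x) (fd g x v) + B (fd f x v) (g x))) (at x)"
    if "x \<in> S" for x
    using Suc.prems that has_derivative_fd[of f x] has_derivative_fd[of g x]
    by (auto intro: bounded_bilinear.FDERIV[OF assms(1)])
  have "k_smooth_on k S (\<lambda>x. fd (\<lambda>x. B (f x) (g x)) x v)" for v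
  proof (rule k_smooth_on_cong[OF assms(2), of "\<lambda>x. B (f x) (fd g x v) + B (fd f x v) (g x)"])
    show "k_smooth_on k S (\<lambda>x. B (f x) (fd g x v) + B (fd f x v) (g x))"
      using Suc.prems k_smooth_on_Suc_imp[OF Suc.prems(1)] k_smooth_on_Suc_imp[OF Suc.prems(2)]
      by (intro k_smooth_on_add assms(2) Suc.IH) auto
  qed (use fd_eqI[OF d] in auto)
  then show ?case using d by (auto intro: differentiableI)
qed

lemma linear_euclidean_expand:
  fixes L :: "'a::euclidean_space \<Rightarrow> 'b::real_vector"
  assumes "linear L"
  shows "L v = (\<Sum>b\<in>Basis. (v \<bullet> b) *\<^sub>R L b)"
proof -
  have "L v = L (\<Sum>b\<in>Basis. (v \<bullet> b) *\<^sub>R b)" by (simp add: euclidean_representation)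
  also have "\<dots> = (\<Sum>b\<in>Basis. (v \<bullet> b) *\<^sub>R L b)"
    by (simp add: linear_sum[OF assms] linear_cmul[OF assms])
  finally show ?thesis .
qed

text \<open>In the chain rule both the base point \<open>g x\<close> and the direction
  \<open>fd g x v\<close> move with \<open>x\<close>, while the induction hypothesis speaks of fixed
  directions. Expanding the direction in a basis separates the two, whence the Euclidean middle
  space.\<close>

lemma k_smooth_on_compose:
  fixes g :: "'a::real_normed_vector \<Rightarrow> 'b::euclidean_space"
    and f :: "'b \<Rightarrow> 'c::real_normed_vector"
  assumes "open S" "g ` S \<subseteq> T" "k_smooth_on k T f" "k_smooth_on k S g"
  shows "k_smooth_on k S (\<lambda>x. f (g x))"
  using assms(3,4)
proof (induction k arbitrary: f)
  case 0 then show ?case using assms(2) continuous_on_compose2 by auto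
next
  case (Suc k)
  have d: "((\<lambda>x. f (g x)) has_derivative (\<lambda>v. fd f (g x) (fd g x v))) (at x)" if "x \<in> S" for x
  proof -
    have "g x \<in> T" using that assms(2) by auto
    then show ?thesis
      using Suc.prems that has_derivative_fd[of g x] has_derivative_fd[of f "g x"]
      by (auto intro: has_derivative_compose)
  qed
  have e: "fd f (g x) (fd g x v) = (\<Sum>b\<in>Basis. (fd g x v \<bullet> b) *\<^sub>R fd f (g x) b)" if "x \<in> S" for x v
  proof (rule linear_euclidean_expand)
    have "f differentiable at (g x)" using Suc.prems that assms(2) by auto
    then show "linear (fd f (g x))" by (rule linear_frechet_derivative)
  qed
  have "k_smooth_on k S (\<lambda>x. fd (\<lambda>x. f (g x)) x v)" for v
  proof (rule k_smooth_on_cong[OF assms(1), of "\<lambda>x. \<Sum>b\<in>Basis. (fd g x v \<bullet> b) *\<^sub>R fd f (g x) b"])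
    have "k_smooth_on k S (\<lambda>x. fd f (g x) b)" for b
      by (rule Suc.IH) (use Suc.prems k_smooth_on_Suc_imp[OF Suc.prems(2)] in auto)
    moreover have "k_smooth_on k S (\<lambda>x. fd g x v \<bullet> b)" for b
      by (rule k_smooth_on_linear_compose[OF bounded_linear_inner_left assms(1)]) (use Suc.prems in auto)
    ultimately show "k_smooth_on k S (\<lambda>x. \<Sum>b\<in>Basis. (fd g x v \<bullet> b) *\<^sub>R fd f (g x) b)"
      by (intro k_smooth_on_sum k_smooth_on_bilinear[OF bounded_bilinear_scaleR] assms(1))
  qed (use fd_eqI[OF d] e in auto)
  then show ?case using d by (auto intro: differentiableI)
qed

lemma smooth_on_subset: "smooth_on S f \<Longrightarrow> T \<subseteq> S \<Longrightarrow> smooth_on T f"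
  by (auto simp: smooth_on_def intro: k_smooth_on_subset)

lemma smooth_on_cong:
  "open S \<Longrightarrow> (\<And>y. y \<in> S \<Longrightarrow> f y = g y) \<Longrightarrow> smooth_on S f \<Longrightarrow> smooth_on S g"
  unfolding smooth_on_def using k_smooth_on_cong by blast

lemma smooth_on_local:
  "(\<And>x. x \<in> S \<Longrightarrow> \<exists>T. open T \<and> x \<in> T \<and> smooth_on T f) \<Longrightarrow> smooth_on S f"
  unfolding smooth_on_def by (meson k_smooth_on_local)

lemma smooth_on_compose:
  fixes g :: "'a::real_normed_vector \<Rightarrow> 'b::euclidean_space"
    and f :: "'b \<Rightarrow> 'c::real_normed_vector"
  shows "open S \<Longrightarrow> g ` S \<subseteq> T \<Longrightarrow> smooth_on T f \<Longrightarrow> smooth_on S g \<Longrightarrow> smooth_on S (\<lambda>x. f (g x))"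
  unfolding smooth_on_def using k_smooth_on_compose by blast

lemma smooth_on_Pair:
  "open S \<Longrightarrow> smooth_on S f \<Longrightarrow> smooth_on S g \<Longrightarrow> smooth_on S (\<lambda>x. (f x, g x))"
  unfolding smooth_on_def using k_smooth_on_Pair by blast

abbreviation smooth :: "('a::real_normed_vector \<Rightarrow> 'b::real_normed_vector) \<Rightarrow> bool"
  where "smooth \<equiv> smooth_on UNIV"

named_theorems smooth_intros

lemma smooth_bounded_linear: "bounded_linear f \<Longrightarrow> smooth f"
  by (simp add: smooth_on_def k_smooth_on_bounded_linear)

lemma smooth_const [smooth_intros]: "smooth (\<lambda>x. c)"
  by (simp add: smooth_on_def)

lemma smooth_ident [smooth_intros]: "smooth (\<lambda>x. x)"
  by (rule smooth_bounded_linear) (rule bounded_linear_ident)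

lemma smooth_compose:
  fixes g :: "'a::real_normed_vector \<Rightarrow> 'b::euclidean_space"
  shows "smooth f \<Longrightarrow> smooth g \<Longrightarrow> smooth (\<lambda>x. f (g x))"
  by (rule smooth_on_compose) auto

lemma smooth_bounded_linear_compose:
  "bounded_linear L \<Longrightarrow> smooth f \<Longrightarrow> smooth (\<lambda>x. L (f x))"
  unfolding smooth_on_def using k_smooth_on_linear_compose by blast

lemma smooth_linear_compose:
  fixes L :: "'a::euclidean_space \<Rightarrow> 'b::real_normed_vector"
  shows "linear L \<Longrightarrow> smooth f \<Longrightarrow> smooth (\<lambda>x. L (f x))"
  by (simp add: linear_conv_bounded_linear smooth_bounded_linear_compose)

lemma smooth_Pair [smooth_intros]: "smooth f \<Longrightarrow> smooth g \<Longrightarrow> smooth (\<lambda>x. (f x, g x))"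
  by (simp add: smooth_on_Pair)

lemma smooth_fst [smooth_intros]: "smooth f \<Longrightarrow> smooth (\<lambda>x. fst (f x))"
  by (rule smooth_bounded_linear_compose[OF bounded_linear_fst])

lemma smooth_snd [smooth_intros]: "smooth f \<Longrightarrow> smooth (\<lambda>x. snd (f x))"
  by (rule smooth_bounded_linear_compose[OF bounded_linear_snd])

lemma smooth_add [smooth_intros]: "smooth f \<Longrightarrow> smooth g \<Longrightarrow> smooth (\<lambda>x. f x + g x)"
  by (auto simp: smooth_on_def intro: k_smooth_on_add)

lemma smooth_minus [smooth_intros]: "smooth f \<Longrightarrow> smooth (\<lambda>x. - f x)"
  by (rule smooth_bounded_linear_compose[OF bounded_linear_minus[OF bounded_linear_ident]])

lemma smooth_diff [smooth_intros]: "smooth f \<Longrightarrow> smooth g \<Longrightarrow> smooth (\<lambda>x. f x - g x)"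
  using smooth_add[of f "\<lambda>x. - g x"] smooth_minus[of g] by simp

lemma smooth_sum [smooth_intros]:
  "(\<And>i. i \<in> I \<Longrightarrow> smooth (f i)) \<Longrightarrow> smooth (\<lambda>x. \<Sum>i\<in>I. f i x)"
  by (auto simp: smooth_on_def intro: k_smooth_on_sum)

lemma smooth_scaleR [smooth_intros]:
  "smooth f \<Longrightarrow> smooth g \<Longrightarrow> smooth (\<lambda>x. f x *\<^sub>R g x)"
  by (auto simp: smooth_on_def intro: k_smooth_on_bilinear[OF bounded_bilinear_scaleR])

lemma smooth_inner [smooth_intros]:
  "smooth f \<Longrightarrow> smooth g \<Longrightarrow> smooth (\<lambda>x. f x \<bullet> g x)"
  by (auto simp: smooth_on_def intro: k_smooth_on_bilinear[OF bounded_bilinear_inner])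

lemma smooth_mult [smooth_intros]:
  fixes f :: "'a::real_normed_vector \<Rightarrow> real"
  shows "smooth f \<Longrightarrow> smooth g \<Longrightarrow> smooth (\<lambda>x. f x * g x)"
  using smooth_scaleR[of f g] by simp

lemma smooth_power [smooth_intros]:
  fixes f :: "'a::real_normed_vector \<Rightarrow> real"
  shows "smooth f \<Longrightarrow> smooth (\<lambda>x. f x ^ n)"
  by (induction n) (auto intro: smooth_intros)

lemma smooth_differentiable: "smooth f \<Longrightarrow> f differentiable (at x)"
  using k_smooth_on.simps(2)[of 0 UNIV f] by (auto simp: smooth_on_def)

lemma smooth_has_derivative: "smooth f \<Longrightarrow> (f has_derivative fd f x) (at x)"
  by (simp add: has_derivative_fd smooth_differentiable)

lemma smooth_linear_fd: "smooth f \<Longrightarrow> linear (fd f x)"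
  by (simp add: linear_frechet_derivative smooth_differentiable)

lemma smooth_fd: "smooth f \<Longrightarrow> smooth (\<lambda>x. fd f x v)"
  unfolding smooth_on_def using k_smooth_on.simps(2) by blast

lemma smooth_continuous_on: "smooth f \<Longrightarrow> continuous_on S f"
  unfolding smooth_on_def
  by (meson continuous_on_subset k_smooth_on.simps(1) top_greatest)

lemma smooth_isCont: "smooth f \<Longrightarrow> isCont f x"
  using smooth_continuous_on[of f UNIV] by (simp add: continuous_on_eq_continuous_at)

text \<open>Upgrades smoothness in each fixed direction to joint smoothness in point and direction;
  this makes \<open>dl\<close>, \<open>dr\<close> and \<open>tdiff\<close> smooth in all
  arguments.\<close>

lemma smooth_fd_joint [smooth_intros]:
  fixes f :: "'a::euclidean_space \<Rightarrow> 'b::real_normed_vector"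
    and g h :: "'c::real_normed_vector \<Rightarrow> 'a"
  assumes "smooth f" "smooth g" "smooth h"
  shows "smooth (\<lambda>x. fd f (g x) (h x))"
proof -
  have "(\<lambda>x. fd f (g x) (h x)) = (\<lambda>x. \<Sum>b\<in>Basis. (h x \<bullet> b) *\<^sub>R fd f (g x) b)"
    using linear_euclidean_expand[OF smooth_linear_fd[OF assms(1)]] by fast
  moreover have "smooth (\<lambda>x. fd f (g x) b)" for b
    using smooth_compose[OF smooth_fd[OF assms(1)] assms(2)] .
  ultimately show ?thesis using assms by (auto intro!: smooth_intros)
qed

lemma fd_add: "smooth f \<Longrightarrow> fd f x (u + v) = fd f x u + fd f x v"
  by (simp add: linear_add smooth_linear_fd)

lemma fd_scaleR: "smooth f \<Longrightarrow> fd f x (c *\<^sub>R u) = c *\<^sub>R fd f x u"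
  by (simp add: linear_cmul smooth_linear_fd)

lemma fd_zero: "smooth f \<Longrightarrow> fd f x 0 = 0"
  by (simp add: linear_0 smooth_linear_fd)

lemma fd_minus: "smooth f \<Longrightarrow> fd f x (- u) = - fd f x u"
  by (simp add: linear_neg smooth_linear_fd)

lemma fd_diff: "smooth f \<Longrightarrow> fd f x (u - v) = fd f x u - fd f x v"
  by (simp add: linear_diff smooth_linear_fd)

lemma fd_compose:
  fixes f :: "'b::real_normed_vector \<Rightarrow> 'c::real_normed_vector"
  assumes "smooth f" "smooth g"
  shows "fd (\<lambda>x. f (g x)) x v = fd f (g x) (fd g x v)"
  using fd_eqI[OF has_derivative_compose[OF smooth_has_derivative[OF assms(2), of x]
      smooth_has_derivative[OF assms(1), of "g x"]]]
  by metis

lemma fd_linear: "bounded_linear f \<Longrightarrow> fd f x = f"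
  using bounded_linear_imp_has_derivative fd_eqI by blast

lemma has_vector_derivative_fd:
  assumes "(c has_vector_derivative v) (at t)" "smooth f"
  shows "((\<lambda>t. f (c t)) has_vector_derivative fd f (c t) v) (at t)"
  using has_derivative_compose[OF assms(1)[unfolded has_vector_derivative_def]
      smooth_has_derivative[OF assms(2), of "c t"]]
  by (simp add: has_vector_derivative_def fd_scaleR[OF assms(2)])

lemma fd_vector_derivative:
  assumes "smooth f"
  shows "((\<lambda>t. f (x + t *\<^sub>R v)) has_vector_derivative fd f (x + t *\<^sub>R v) v) (at t)"
proof -
  have "((\<lambda>t. x + t *\<^sub>R v) has_vector_derivative v) (at t)"
    by (auto intro!: derivative_eq_intros)
  from has_vector_derivative_fd[OF this assms] show ?thesis .
qed

lemma fd_eq_vector_derivative: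
  assumes "smooth f" "((\<lambda>t. f (x + t *\<^sub>R v)) has_vector_derivative w) (at 0)"
  shows "fd f x v = w"
  using vector_derivative_unique_at[OF fd_vector_derivative[OF assms(1), of x v 0] assms(2)] by simp

section \<open>Symmetry of second derivatives\<close>

lemma second_difference_mean_value:
  fixes f :: "'a::euclidean_space \<Rightarrow> real"
  assumes "smooth f" "h > 0"
  shows "\<exists>s\<in>{0<..<h}. \<exists>t\<in>{0<..<h}.
    f (x + h *\<^sub>R u + h *\<^sub>R v) - f (x + h *\<^sub>R u) - f (x + h *\<^sub>R v) + f x
      = h * h * fd (\<lambda>y. fd f y u) (x + s *\<^sub>R u + t *\<^sub>R v) v"
proof -
  let ?g = "\<lambda>s. f ((x + h *\<^sub>R v) + s *\<^sub>R u) - f (x + s *\<^sub>R u)"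
  have g: "(?g has_real_derivative (fd f ((x + h *\<^sub>R v) + s *\<^sub>R u) u - fd f (x + s *\<^sub>R u) u)) (at s)" for s
    unfolding has_real_derivative_iff_has_vector_derivative
    by (intro has_vector_derivative_diff fd_vector_derivative assms)
  obtain s where s: "0 < s" "s < h"
    "?g h - ?g 0 = (h - 0) * (fd f ((x + h *\<^sub>R v) + s *\<^sub>R u) u - fd f (x + s *\<^sub>R u) u)"
    using MVT2[OF assms(2), of ?g "\<lambda>s. fd f ((x + h *\<^sub>R v) + s *\<^sub>R u) u - fd f (x + s *\<^sub>R u) u"] g by blast
  let ?k = "\<lambda>t. fd f ((x + s *\<^sub>R u) + t *\<^sub>R v) u"
  have k: "(?k has_real_derivative fd (\<lambda>y. fd f y u) ((x + s *\<^sub>R u) + t *\<^sub>R v) v) (at t)" for t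
    unfolding has_real_derivative_iff_has_vector_derivative
    by (rule fd_vector_derivative[where f = "\<lambda>y. fd f y u"]) (rule smooth_fd[OF assms(1)])
  obtain t where t: "0 < t" "t < h"
    "?k h - ?k 0 = (h - 0) * fd (\<lambda>y. fd f y u) ((x + s *\<^sub>R u) + t *\<^sub>R v) v"
    using MVT2[OF assms(2), of ?k "\<lambda>t. fd (\<lambda>y. fd f y u) ((x + s *\<^sub>R u) + t *\<^sub>R v) v"] k by blast
  show ?thesis
    using s t by (intro bexI[of _ s] bexI[of _ t]) (simp_all add: algebra_simps)
qed

text \<open>The second difference is symmetric in \<open>u\<close> and \<open>v\<close>. Divided by
  \<open>h * h\<close> it equals a mixed derivative at a nearby point, in either order, so by
  continuity it converges to both.\<close>

lemma fd_fd_commute_real: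
  fixes f :: "'a::euclidean_space \<Rightarrow> real"
  assumes "smooth f"
  shows "fd (\<lambda>y. fd f y u) x v = fd (\<lambda>y. fd f y v) x u"
proof -
  define h where "h n = inverse (real (Suc n))" for n
  have h0: "h n > 0" for n by (simp add: h_def)
  have hl: "h \<longlonglongrightarrow> 0" unfolding h_def by (rule LIMSEQ_inverse_real_of_nat)
  have key: "\<exists>S. S \<longlonglongrightarrow> fd (\<lambda>y. fd f y u) x v \<and> (\<forall>n. f (x + h n *\<^sub>R u + h n *\<^sub>R v) - f (x + h n *\<^sub>R u)
       - f (x + h n *\<^sub>R v) + f x = h n * h n * S n)" for u v
  proof -
    define P where "P n p \<longleftrightarrow> fst p \<in> {0<..<h n} \<and> snd p \<in> {0<..<h n} \<and>
        f (x + h n *\<^sub>R u + h n *\<^sub>R v) - f (x + h n *\<^sub>R u) - f (x + h n *\<^sub>R v) + f x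
      = h n * h n * fd (\<lambda>y. fd f y u) (x + fst p *\<^sub>R u + snd p *\<^sub>R v) v" for n p
    have "\<exists>p. P n p" for n
      using second_difference_mean_value[OF assms h0[of n], of x u v] unfolding P_def by force
    then have "\<forall>n. P n (SOME p. P n p)" by (meson someI_ex)
    define s t where "s n = fst (SOME p. P n p)" and "t n = snd (SOME p. P n p)" for n
    have st: "s n \<in> {0<..<h n} \<and> t n \<in> {0<..<h n} \<and>
        f (x + h n *\<^sub>R u + h n *\<^sub>R v) - f (x + h n *\<^sub>R u) - f (x + h n *\<^sub>R v) + f x
      = h n * h n * fd (\<lambda>y. fd f y u) (x + s n *\<^sub>R u + t n *\<^sub>R v) v" for n
      using \<open>\<forall>n. P n (SOME p. P n p)\<close>[rule_format, of n] unfolding P_def s_def t_def .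
    have "s \<longlonglongrightarrow> 0"
      by (rule tendsto_sandwich[OF _ _ tendsto_const hl])
        (use st in \<open>auto intro!: always_eventually less_imp_le\<close>)
    moreover have "t \<longlonglongrightarrow> 0"
      by (rule tendsto_sandwich[OF _ _ tendsto_const hl])
        (use st in \<open>auto intro!: always_eventually less_imp_le\<close>)
    ultimately have "(\<lambda>n. x + s n *\<^sub>R u + t n *\<^sub>R v) \<longlonglongrightarrow> x + 0 *\<^sub>R u + 0 *\<^sub>R v"
      by (intro tendsto_intros)
    moreover have "isCont (\<lambda>y. fd (\<lambda>y. fd f y u) y v) x"
      by (rule smooth_isCont) (intro smooth_intros assms)
    ultimately have "(\<lambda>n. fd (\<lambda>y. fd f y u) (x + s n *\<^sub>R u + t n *\<^sub>R v) v) \<longlonglongrightarrow> fd (\<lambda>y. fd f y u) x v"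
      using isCont_tendsto_compose by fastforce
    then show ?thesis using st by blast
  qed
  obtain S where S: "S \<longlonglongrightarrow> fd (\<lambda>y. fd f y u) x v"
    "\<And>n. f (x + h n *\<^sub>R u + h n *\<^sub>R v) - f (x + h n *\<^sub>R u) - f (x + h n *\<^sub>R v) + f x = h n * h n * S n"
    using key by blast
  obtain T where T: "T \<longlonglongrightarrow> fd (\<lambda>y. fd f y v) x u"
    "\<And>n. f (x + h n *\<^sub>R v + h n *\<^sub>R u) - f (x + h n *\<^sub>R v) - f (x + h n *\<^sub>R u) + f x = h n * h n * T n"
    using key by blast
  have "h n * h n * S n = h n * h n * T n" for n
    unfolding S(2)[symmetric] T(2)[symmetric] by (simp add: algebra_simps)
  then have "S n = T n" for n using h0[of n] by (metis mult_cancel_left less_irrefl mult_eq_0_iff)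
  then have "S = T" by blast
  then show ?thesis using S T LIMSEQ_unique by blast
qed

lemma fd_fd_commute:
  fixes f :: "'a::euclidean_space \<Rightarrow> 'b::euclidean_space"
  assumes "smooth f"
  shows "fd (\<lambda>y. fd f y u) x v = fd (\<lambda>y. fd f y v) x u"
proof (rule euclidean_eqI)
  fix b :: 'b assume "b \<in> Basis"
  have sb: "smooth (\<lambda>y. f y \<bullet> b)" by (intro smooth_intros assms)
  have 1: "fd (\<lambda>y. g y \<bullet> b) y w = fd g y w \<bullet> b" if "smooth g" for g :: "'a \<Rightarrow> 'b" and y w
    using fd_compose[OF smooth_bounded_linear[OF bounded_linear_inner_left[of b]] that]
    by (simp add: fd_linear[OF bounded_linear_inner_left])
  have 2: "fd (\<lambda>y. fd (\<lambda>y. f y \<bullet> b) y u) x v = fd (\<lambda>y. fd f y u) x v \<bullet> b" for u v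
    unfolding 1[OF assms] using 1[OF smooth_fd[OF assms]] .
  show "fd (\<lambda>y. fd f y u) x v \<bullet> b = fd (\<lambda>y. fd f y v) x u \<bullet> b"
    using fd_fd_commute_real[OF sb, of u x v] unfolding 2 .
qed


section \<open>Lie groups in a global coordinate\<close>

lemma has_vector_derivative_shift:
  fixes c :: "real \<Rightarrow> 'b::real_normed_vector"
  assumes "((\<lambda>t. c (s + t)) has_vector_derivative w) (at 0)"
  shows "(c has_vector_derivative w) (at s)"
proof -
  have "((\<lambda>t. t - s) has_derivative (\<lambda>t. t)) (at s)"
    by (auto intro!: derivative_eq_intros)
  moreover have "((\<lambda>t. c (s + t)) has_derivative (\<lambda>t. t *\<^sub>R w)) (at (s - s))"
    using assms by (simp add: has_vector_derivative_def)
  ultimately have "((\<lambda>t. c (s + (t - s))) has_derivative (\<lambda>t. t *\<^sub>R w)) (at s)"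
    by (rule has_derivative_compose)
  then show ?thesis by (simp add: has_vector_derivative_def)
qed

locale coordinate_lie_group =
  fixes m :: "'v::euclidean_space \<Rightarrow> 'v \<Rightarrow> 'v" and e :: 'v and i :: "'v \<Rightarrow> 'v"
  assumes smooth_m: "smooth (\<lambda>z. m (fst z) (snd z))"
    and smooth_i: "smooth i"
    and assoc: "m (m x y) z = m x (m y z)"
    and unit_left [simp]: "m e x = x" and unit_right [simp]: "m x e = x"
    and inv_left [simp]: "m (i x) x = e" and inv_right [simp]: "m x (i x) = e"
begin

lemma smooth_mult [smooth_intros]: "smooth f \<Longrightarrow> smooth g \<Longrightarrow> smooth (\<lambda>x. m (f x) (g x))"
  using smooth_compose[OF smooth_m, of "\<lambda>x. (f x, g x)"] by (simp add: smooth_intros)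

lemma smooth_inv [smooth_intros]: "smooth f \<Longrightarrow> smooth (\<lambda>x. i (f x))"
  using smooth_compose[OF smooth_i] .

lemma inv_cancel_left [simp]: "m (i x) (m x y) = y" "m x (m (i x) y) = y"
  by (simp_all flip: assoc)

lemma inv_mult: "i (m x y) = m (i y) (i x)"
proof -
  have "m (m x y) (m (i y) (i x)) = e" by (simp add: assoc)
  then show ?thesis by (metis inv_cancel_left(1) unit_right)
qed

lemma inv_unit [simp]: "i e = e"
  by (metis inv_left unit_right)

text \<open>Differentials of left and right translation: \<open>dl p q\<close> is that of \<open>m p\<close> at \<open>q\<close>, \<open>dr p q\<close> that
  of \<open>\<lambda>y. m y q\<close> at \<open>p\<close>, and \<open>lif p v\<close> is the left-invariant field with value \<open>v\<close> at \<open>e\<close>.\<close>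

definition dl :: "'v \<Rightarrow> 'v \<Rightarrow> 'v \<Rightarrow> 'v"
  where "dl p q v = fd (\<lambda>z. m (fst z) (snd z)) (p, q) (0, v)"

definition dr :: "'v \<Rightarrow> 'v \<Rightarrow> 'v \<Rightarrow> 'v"
  where "dr p q v = fd (\<lambda>z. m (fst z) (snd z)) (p, q) (v, 0)"

abbreviation lif :: "'v \<Rightarrow> 'v \<Rightarrow> 'v"
  where "lif p v \<equiv> dl p e v"

lemma smooth_dl [smooth_intros]:
  "smooth f \<Longrightarrow> smooth g \<Longrightarrow> smooth h \<Longrightarrow> smooth (\<lambda>x. dl (f x) (g x) (h x))"
  unfolding dl_def by (intro smooth_fd_joint smooth_m smooth_intros)

lemma smooth_dr [smooth_intros]:
  "smooth f \<Longrightarrow> smooth g \<Longrightarrow> smooth h \<Longrightarrow> smooth (\<lambda>x. dr (f x) (g x) (h x))"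
  unfolding dr_def by (intro smooth_fd_joint smooth_m smooth_intros)

lemma fd_left: "fd (m p) q = dl p q"
proof
  fix v
  have "fd (\<lambda>y. m p y) q v = fd (\<lambda>y. (\<lambda>z. m (fst z) (snd z)) (p, y)) q v" by simp
  also have "\<dots> = fd (\<lambda>z. m (fst z) (snd z)) (p, q) (fd (\<lambda>y. (p, y)) q v)"
    by (rule fd_compose[OF smooth_m]) (intro smooth_intros)
  also have "fd (\<lambda>y. (p, y)) q = (\<lambda>v. (0, v))"
    by (rule fd_eqI) (auto intro!: derivative_eq_intros)
  finally show "fd (m p) q v = dl p q v" by (simp add: dl_def)
qed

lemma fd_right: "fd (\<lambda>y. m y q) p = dr p q"
proof
  fix v
  have "fd (\<lambda>y. m y q) p v = fd (\<lambda>y. (\<lambda>z. m (fst z) (snd z)) (y, q)) p v" by simp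
  also have "\<dots> = fd (\<lambda>z. m (fst z) (snd z)) (p, q) (fd (\<lambda>y. (y, q)) p v)"
    by (rule fd_compose[OF smooth_m]) (intro smooth_intros)
  also have "fd (\<lambda>y. (y, q)) p = (\<lambda>v. (v, 0))"
    by (rule fd_eqI) (auto intro!: derivative_eq_intros)
  finally show "fd (\<lambda>y. m y q) p v = dr p q v" by (simp add: dr_def)
qed

lemma smooth_left: "smooth (m p)"
  using smooth_mult[OF smooth_const smooth_ident] by simp

lemma smooth_right: "smooth (\<lambda>y. m y q)"
  using smooth_mult[OF smooth_ident smooth_const] by simp

lemma linear_dl: "linear (dl p q)"
  using smooth_linear_fd[OF smooth_left] by (simp add: fd_left)

lemma linear_dr: "linear (dr p q)"
  using smooth_linear_fd[OF smooth_right] by (simp add: fd_right)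

lemma mult_has_vector_derivative:
  assumes "(c has_vector_derivative u) (at s)" "(d has_vector_derivative v) (at s)"
  shows "((\<lambda>s. m (c s) (d s)) has_vector_derivative dr (c s) (d s) u + dl (c s) (d s) v) (at s)"
proof -
  have "((\<lambda>s. (c s, d s)) has_vector_derivative (u, v)) (at s)"
    by (rule has_vector_derivative_Pair) fact+
  from has_vector_derivative_fd[OF this smooth_m]
  have "((\<lambda>s. m (c s) (d s)) has_vector_derivative
      fd (\<lambda>z. m (fst z) (snd z)) (c s, d s) ((u, 0) + (0, v))) (at s)" by simp
  then show ?thesis by (simp only: fd_add[OF smooth_m] dl_def dr_def)
qed

lemma dl_dl: "dl p (m q y) (dl q y v) = dl (m p q) y v"
proof -
  have "m (m p q) = (\<lambda>y. m p (m q y))" by (auto simp: assoc)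
  then have "fd (m (m p q)) y v = fd (m p) (m q y) (fd (m q) y v)"
    using fd_compose[OF smooth_left smooth_left] by metis
  then show ?thesis by (simp add: fd_left)
qed

lemma dl_lif: "dl p q (lif q v) = lif (m p q) v"
  using dl_dl[of p q e v] by simp

lemma dl_unit [simp]: "dl e q v = v"
proof -
  have "m e = (\<lambda>y. y)" by auto
  then show ?thesis using fd_left[of e q] fd_linear[OF bounded_linear_ident] by metis
qed

lemma dr_unit [simp]: "dr p e v = v"
proof -
  have "(\<lambda>y. m y e) = (\<lambda>y. y)" by auto
  then show ?thesis using fd_right[of e p] fd_linear[OF bounded_linear_ident] by metis
qed

lemma dl_inv_lif [simp]: "dl (i p) p (lif p v) = v"
  by (simp add: dl_lif)

lemma lif_dl_inv [simp]: "lif p (dl (i p) p v) = v"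
  using dl_dl[of p "i p" p v] by simp

lemma lif_inject: "lif p u = lif p v \<longleftrightarrow> u = v"
  by (metis dl_inv_lif)

text \<open>Left translations commute with right translations. The left translate is moved to the
  outside, which leaves a right differential at the unit.\<close>

lemma dr_lif: "dr p q (lif p v) = dl p q (dr e q v)"
proof -
  have "(\<lambda>y. m (m p y) q) = (\<lambda>y. m p (m y q))" by (auto simp: assoc)
  then have "fd (\<lambda>y. m y q) (m p e) (fd (m p) e v) = fd (m p) (m e q) (fd (\<lambda>y. m y q) e v)"
    using fd_compose[OF smooth_right[of q] smooth_left[of p]]
      fd_compose[OF smooth_left[of p] smooth_right[of q]] by metis
  then show ?thesis by (simp add: fd_left fd_right)
qed

lemma fd_inv_unit: "fd i e v = - v"
proof -
  have c: "((\<lambda>t. e + t *\<^sub>R v) has_vector_derivative v) (at 0)"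
    by (auto intro!: derivative_eq_intros)
  have "((\<lambda>t. m (e + t *\<^sub>R v) (i (e + t *\<^sub>R v))) has_vector_derivative v + fd i e v) (at 0)"
    using mult_has_vector_derivative[OF c has_vector_derivative_fd[OF c smooth_i]] by simp
  then have "((\<lambda>t. e) has_vector_derivative v + fd i e v) (at (0::real))" by simp
  then have "v + fd i e v = 0"
    using has_vector_derivative_const vector_derivative_unique_at by blast
  then show ?thesis by (simp add: add_eq_0_iff)
qed

lemma fd_inv_lif: "fd i p (lif p v) = - dr e (i p) v"
proof -
  have "(\<lambda>y. i (m p y)) = (\<lambda>y. m (i y) (i p))" by (auto simp: inv_mult)
  then have "fd i (m p e) (fd (m p) e v) = fd (\<lambda>y. m y (i p)) (i e) (fd i e v)"
    using fd_compose[OF smooth_i smooth_left[of p]]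
      fd_compose[OF smooth_right[of "i p"] smooth_i] by metis
  then show ?thesis by (simp add: fd_left fd_right fd_inv_unit linear_neg[OF linear_dr])
qed

text \<open>With the inverse on the right, the contributions of \<open>c\<close> and
  \<open>d\<close> meet at the same place between \<open>c s\<close> and \<open>i (d s)\<close>, so
  only \<open>u - v\<close> survives. Uniqueness and stability of curves both rest on this
  formula.\<close>

lemma quotient_has_vector_derivative:
  assumes "(c has_vector_derivative lif (c s) u) (at s)" "(d has_vector_derivative lif (d s) v) (at s)"
  shows "((\<lambda>s. m (c s) (i (d s))) has_vector_derivative
    dl (c s) (i (d s)) (dr e (i (d s)) (u - v))) (at s)"
proof -
  note mult_has_vector_derivative[OF assms(1) has_vector_derivative_fd[OF assms(2) smooth_i]]
  moreover have "dr (c s) (i (d s)) (lif (c s) u) + dl (c s) (i (d s)) (fd i (d s) (lif (d s) v))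
    = dl (c s) (i (d s)) (dr e (i (d s)) (u - v))"
    by (simp add: dr_lif fd_inv_lif linear_diff[OF linear_dl] linear_diff[OF linear_dr]
        linear_neg[OF linear_dl])
  ultimately show ?thesis by simp
qed

text \<open>For equal logarithmic derivatives the quotient of the curves has derivative zero, hence
  is constant.\<close>

lemma lif_curve_unique:
  assumes "\<And>s. (c has_vector_derivative lif (c s) (u s)) (at s)"
    and "\<And>s. (d has_vector_derivative lif (d s) (u s)) (at s)"
    and "c 0 = d 0"
  shows "c s = d s"
proof -
  have "((\<lambda>s. m (c s) (i (d s))) has_vector_derivative 0) (at s)" for s
    using quotient_has_vector_derivative[OF assms(1,2)]
    by (simp add: linear_0[OF linear_dl] linear_0[OF linear_dr])
  then have "m (c s) (i (d s)) = m (c 0) (i (d 0))"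
    using has_derivative_zero_constant[of UNIV "\<lambda>s. m (c s) (i (d s))"]
    unfolding has_vector_derivative_def by force
  then have "m (m (c s) (i (d s))) (d s) = d s" using assms(3) by simp
  then show ?thesis by (simp add: assoc)
qed

lemma one_parameter_has_vector_derivative:
  assumes "(c has_vector_derivative v) (at 0)" "\<And>s t. c (s + t) = m (c s) (c t)"
  shows "(c has_vector_derivative lif (c s) v) (at s)"
proof -
  have c0: "c 0 = e"
    using assms(2)[of 0 0] by (metis add.right_neutral inv_cancel_left(1) inv_left)
  have "((\<lambda>t. m (c s) (c t)) has_vector_derivative lif (c s) v) (at 0)"
    using has_vector_derivative_fd[OF assms(1) smooth_left[of "c s"]] by (simp add: fd_left c0)
  then have "((\<lambda>t. c (s + t)) has_vector_derivative lif (c s) v) (at 0)"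
    by (simp add: assms(2))
  then show ?thesis by (rule has_vector_derivative_shift)
qed

lemma one_parameter_unique:
  assumes "(c has_vector_derivative v) (at 0)" "\<And>s t. c (s + t) = m (c s) (c t)"
    and "(d has_vector_derivative v) (at 0)" "\<And>s t. d (s + t) = m (d s) (d t)"
  shows "c s = d s"
proof (rule lif_curve_unique)
  show "c 0 = d 0"
    using assms(2)[of 0 0] assms(4)[of 0 0] by (metis add.right_neutral inv_cancel_left(1) inv_left)
qed (use one_parameter_has_vector_derivative assms in blast)+

end

section \<open>Exponential coordinates\<close>

text \<open>\<open>mult_scaleR\<close> says that the rays are one-parameter subgroups, i.e. that the
  coordinates are exponential. It forces the unit to be \<open>0\<close> and the inverse to be
  \<open>uminus\<close>.\<close>

locale exponential_lie_group =
  fixes m :: "'v::euclidean_space \<Rightarrow> 'v \<Rightarrow> 'v"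
  assumes smooth_m: "smooth (\<lambda>z. m (fst z) (snd z))"
    and assoc: "m (m x y) z = m x (m y z)"
    and mult_scaleR: "m (s *\<^sub>R x) (t *\<^sub>R x) = (s + t) *\<^sub>R x"

sublocale exponential_lie_group \<subseteq> coordinate_lie_group m 0 uminus
proof
  show "smooth (uminus :: 'v \<Rightarrow> 'v)" by (intro smooth_intros)
  show "m 0 x = x" for x using mult_scaleR[of 0 x 1] by simp
  show "m x 0 = x" for x using mult_scaleR[of 1 x 0] by simp
  show "m (- x) x = 0" for x using mult_scaleR[of "-1" x 1] by simp
  show "m x (- x) = 0" for x using mult_scaleR[of 1 x "-1"] by simp
qed (rule smooth_m assoc)+

context exponential_lie_group
begin

text \<open>The commutator at \<open>0\<close> of the left-invariant fields with values
  \<open>u\<close> and \<open>v\<close>, written in coordinates; \<open>lie_bracket_eq\<close>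
  matches it with \<open>lie_bracket\<close>.\<close>

definition bracket :: "'v \<Rightarrow> 'v \<Rightarrow> 'v"
  where "bracket u v = fd (\<lambda>p. lif p v) 0 u - fd (\<lambda>p. lif p u) 0 v"

lemma smooth_lif_const: "smooth (\<lambda>p. lif p v)"
  by (intro smooth_intros)

lemma linear_fd_lif: "linear (\<lambda>v. fd (\<lambda>p. lif p v) 0 u)"
proof
  show "fd (\<lambda>p. lif p (v + w)) 0 u = fd (\<lambda>p. lif p v) 0 u + fd (\<lambda>p. lif p w) 0 u" for v w
  proof -
    have "((\<lambda>p. lif p v + lif p w) has_derivative
        (\<lambda>u. fd (\<lambda>p. lif p v) 0 u + fd (\<lambda>p. lif p w) 0 u)) (at 0)"
      by (intro has_derivative_add smooth_has_derivative smooth_lif_const)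
    from fd_eqI[OF this] show ?thesis by (simp add: linear_add[OF linear_dl])
  qed
  show "fd (\<lambda>p. lif p (r *\<^sub>R v)) 0 u = r *\<^sub>R fd (\<lambda>p. lif p v) 0 u" for r v
  proof -
    have "((\<lambda>p. r *\<^sub>R lif p v) has_derivative (\<lambda>u. r *\<^sub>R fd (\<lambda>p. lif p v) 0 u)) (at 0)"
      by (intro has_derivative_scaleR_right smooth_has_derivative smooth_lif_const)
    from fd_eqI[OF this] show ?thesis by (simp add: linear_cmul[OF linear_dl])
  qed
qed

lemma linear_bracket_left: "linear (\<lambda>u. bracket u v)"
  unfolding bracket_def
  by (intro linear_compose_sub linear_fd_lif smooth_linear_fd smooth_lif_const)

lemma linear_bracket_right: "linear (bracket u)"
proof -
  have "bracket u = (\<lambda>v. fd (\<lambda>p. lif p v) 0 u - fd (\<lambda>p. lif p u) 0 v)"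
    by (auto simp: bracket_def)
  then show ?thesis
    by (simp add: linear_compose_sub linear_fd_lif smooth_linear_fd smooth_lif_const)
qed

text \<open>Both sides are the mixed second derivative of the multiplication at
  \<open>(0, 0)\<close>, once in the first factor along \<open>v\<close> and once in the second
  along \<open>u\<close>.\<close>

lemma fd_dr_unit: "fd (\<lambda>q. dr 0 q v) 0 u = fd (\<lambda>p. lif p u) 0 v"
proof -
  let ?M = "\<lambda>z. m (fst z) (snd z)"
  have l: "fd (\<lambda>q. (0::'v, q::'v)) 0 = (\<lambda>v. (0, v))" "fd (\<lambda>p. (p::'v, 0::'v)) 0 = (\<lambda>v. (v, 0))"
    by (rule fd_eqI, auto intro!: derivative_eq_intros)+
  have "fd (\<lambda>q. dr 0 q v) 0 u = fd (\<lambda>z. fd ?M z (v, 0)) (0, 0) (0, u)"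
    unfolding dr_def
    using fd_compose[OF smooth_fd[OF smooth_m, of "(v, 0)"], of "\<lambda>q. (0, q)" 0 u]
    by (simp add: l smooth_intros)
  also have "\<dots> = fd (\<lambda>z. fd ?M z (0, u)) (0, 0) (v, 0)"
    by (rule fd_fd_commute[OF smooth_m])
  also have "\<dots> = fd (\<lambda>p. lif p u) 0 v"
    unfolding dl_def
    using fd_compose[OF smooth_fd[OF smooth_m, of "(0, u)"], of "\<lambda>p. (p, 0)" 0 v]
    by (simp add: l smooth_intros)
  finally show ?thesis .
qed

text \<open>\<open>dl 0 q\<close> is the identity for every \<open>q\<close>, so moving the second
  argument contributes nothing.\<close>

lemma fd_joint_unit:
  "fd (\<lambda>z. dl (fst z) (snd z) w) (0, 0) (u, v) = fd (\<lambda>p. lif p w) 0 u"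
proof -
  let ?F = "\<lambda>z. dl (fst z) (snd z) w"
  have s: "smooth ?F" by (intro smooth_intros)
  have l: "fd (\<lambda>q. (0::'v, q::'v)) 0 = (\<lambda>v. (0, v))" "fd (\<lambda>p. (p::'v, 0::'v)) 0 = (\<lambda>v. (v, 0))"
    by (rule fd_eqI, auto intro!: derivative_eq_intros)+
  have "fd ?F (0, 0) (0, v) = fd (\<lambda>q. dl 0 q w) 0 v"
    using fd_compose[OF s, of "\<lambda>q. (0, q)" 0 v] by (simp add: l smooth_intros)
  also have "\<dots> = 0" by (simp add: fd_eqI[OF has_derivative_const])
  finally have "fd ?F (0, 0) (0, v) = 0" .
  moreover have "fd ?F (0, 0) (u, 0) = fd (\<lambda>p. lif p w) 0 u"
    using fd_compose[OF s, of "\<lambda>p. (p, 0)" 0 u] by (simp add: l smooth_intros)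
  ultimately show ?thesis using fd_add[OF s, of "(0, 0)" "(u, 0)" "(0, v)"] by simp
qed

end


section \<open>Lie algebra homomorphisms in exponential coordinates\<close>

lemma has_vector_derivative_fd2:
  fixes f :: "'a::euclidean_space \<Rightarrow> 'b::euclidean_space"
  assumes "smooth f" "(c has_vector_derivative u) (at s)" "(w has_vector_derivative w') (at s)"
  shows "((\<lambda>h. fd f (c h) (w h)) has_vector_derivative
    fd (\<lambda>x. fd f x (w s)) (c s) u + fd f (c s) w') (at s)"
proof -
  let ?K = "\<lambda>z. fd f (fst z) (snd z)"
  have sK: "smooth ?K" by (intro smooth_intros assms)
  have "fd (\<lambda>x::'a. (x, w s)) (c s) = (\<lambda>v. (v, 0))" "fd (Pair (c s)) (w s) = (\<lambda>v. (0, v))"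
    by (rule fd_eqI, auto intro!: derivative_eq_intros)+
  then have "fd ?K (c s, w s) (u, 0) = fd (\<lambda>x. fd f x (w s)) (c s) u"
    "fd ?K (c s, w s) (0, w') = fd f (c s) w'"
    using fd_compose[OF sK, of "\<lambda>x. (x, w s)" "c s" u] fd_compose[OF sK, of "Pair (c s)" "w s" w']
    by (simp_all add: smooth_intros fd_linear linear_conv_bounded_linear[THEN iffD1] smooth_linear_fd assms(1))
  moreover have "((\<lambda>h. ?K (c h, w h)) has_vector_derivative fd ?K (c s, w s) ((u, 0) + (0, w'))) (at s)"
    using has_vector_derivative_fd[OF has_vector_derivative_Pair[OF assms(2,3)] sK] by simp
  ultimately show ?thesis by (simp only: fd_add[OF sK]) simp
qed

context exponential_lie_group
begin

text \<open>Left-trivialized derivative of the exponential map along the ray through \<open>x\<close>.\<close>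

definition dexp :: "'v \<Rightarrow> 'v \<Rightarrow> real \<Rightarrow> 'v"
  where "dexp x v s = dl (- (s *\<^sub>R x)) (s *\<^sub>R x) (s *\<^sub>R v)"

lemma dexp_has_vector_derivative_ray:
  "((\<lambda>\<epsilon>. m (- (s *\<^sub>R x)) (s *\<^sub>R (x + \<epsilon> *\<^sub>R v))) has_vector_derivative dexp x v s) (at 0)"
proof -
  have "((\<lambda>\<epsilon>. s *\<^sub>R (x + \<epsilon> *\<^sub>R v)) has_vector_derivative s *\<^sub>R v) (at 0)"
    by (auto intro!: derivative_eq_intros)
  from has_vector_derivative_fd[OF this smooth_left[of "- (s *\<^sub>R x)"]]
  show ?thesis by (simp add: dexp_def fd_left)
qed

text \<open>Since both rays are one-parameter subgroups, the quotient at time \<open>s + h\<close>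
  is the quotient at time \<open>s\<close>, multiplied by \<open>- (h *\<^sub>R x)\<close> on the
  left and by \<open>h *\<^sub>R (x + \<epsilon> *\<^sub>R v)\<close> on the right. Differentiating
  in \<epsilon> gives the adjoint action of \<open>- (h *\<^sub>R x)\<close> on the old value plus a
  new increment.\<close>

lemma dexp_add: "dexp x v (s + h) = dl (- (h *\<^sub>R x)) (h *\<^sub>R x) (dr 0 (h *\<^sub>R x) (dexp x v s)) + dexp x v h"
proof -
  let ?P = "\<lambda>\<epsilon>. m (- (s *\<^sub>R x)) (s *\<^sub>R (x + \<epsilon> *\<^sub>R v))"
  have P0: "?P 0 = 0" by simp
  have "((\<lambda>\<epsilon>. h *\<^sub>R (x + \<epsilon> *\<^sub>R v)) has_vector_derivative h *\<^sub>R v) (at 0)"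
    by (auto intro!: derivative_eq_intros)
  from mult_has_vector_derivative[OF dexp_has_vector_derivative_ray this]
  have "((\<lambda>\<epsilon>. m (?P \<epsilon>) (h *\<^sub>R (x + \<epsilon> *\<^sub>R v))) has_vector_derivative
      dr 0 (h *\<^sub>R x) (dexp x v s) + h *\<^sub>R v) (at 0)" by simp
  from has_vector_derivative_fd[OF this smooth_left[of "- (h *\<^sub>R x)"]]
  have "((\<lambda>\<epsilon>. m (- (h *\<^sub>R x)) (m (?P \<epsilon>) (h *\<^sub>R (x + \<epsilon> *\<^sub>R v)))) has_vector_derivative
      dl (- (h *\<^sub>R x)) (h *\<^sub>R x) (dr 0 (h *\<^sub>R x) (dexp x v s)) + dexp x v h) (at 0)"
    by (simp add: fd_left linear_add[OF linear_dl] dexp_def)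
  moreover have "m (- (h *\<^sub>R x)) (m (?P \<epsilon>) (h *\<^sub>R (x + \<epsilon> *\<^sub>R v)))
      = m (- ((s + h) *\<^sub>R x)) ((s + h) *\<^sub>R (x + \<epsilon> *\<^sub>R v))" for \<epsilon>
  proof -
    have "- ((s + h) *\<^sub>R x) = m (- (h *\<^sub>R x)) (- (s *\<^sub>R x))"
      using inv_mult[of "s *\<^sub>R x" "h *\<^sub>R x"] by (simp add: mult_scaleR)
    then show ?thesis by (simp only: assoc mult_scaleR[symmetric])
  qed
  ultimately show ?thesis
    using dexp_has_vector_derivative_ray[of "s + h" x v] vector_derivative_unique_at by auto
qed

lemma dl_has_vector_derivative:
  assumes "(c has_vector_derivative u) (at s)" "(d has_vector_derivative v) (at s)"
    and "(w has_vector_derivative w') (at s)" and "c s = 0" "d s = 0"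
  shows "((\<lambda>h. dl (c h) (d h) (w h)) has_vector_derivative fd (\<lambda>p. lif p (w s)) 0 u + w') (at s)"
proof -
  have "fd (\<lambda>z. fd (\<lambda>z. m (fst z) (snd z)) z (0, w s)) (0, 0) (u, v) = fd (\<lambda>p. lif p (w s)) 0 u"
    using fd_joint_unit[of "w s" u v] by (simp add: dl_def)
  then show ?thesis
    using has_vector_derivative_fd2[OF smooth_m has_vector_derivative_Pair[OF assms(1,2)]
        has_vector_derivative_Pair[OF has_vector_derivative_const[of 0] assms(3)]]
    by (simp add: assms(4,5) flip: dl_def)
qed

text \<open>The infinitesimal adjoint action is the bracket: one half of \<open>bracket\<close>
  comes from the left factor, the other from the right one by \<open>fd_dr_unit\<close>.\<close>

lemma conjugation_has_vector_derivative:
  "((\<lambda>h. dl (- (h *\<^sub>R x)) (h *\<^sub>R x) (dr 0 (h *\<^sub>R x) w)) has_vector_derivative - bracket x w) (at 0)"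
proof -
  have lin: "((\<lambda>h. h *\<^sub>R x) has_vector_derivative x) (at 0)"
    by (auto intro!: derivative_eq_intros)
  have sr: "smooth (\<lambda>q. dr 0 q w)" by (intro smooth_intros)
  have "((\<lambda>h. dr 0 (h *\<^sub>R x) w) has_vector_derivative fd (\<lambda>p. lif p x) 0 w) (at 0)"
    using has_vector_derivative_fd[OF lin sr] by (simp add: fd_dr_unit)
  from dl_has_vector_derivative[OF has_vector_derivative_minus[OF lin] lin this]
  show ?thesis by (simp add: bracket_def fd_minus[OF smooth_lif_const])
qed

text \<open>Differentiates the addition law \<open>dexp_add\<close> in \<open>h\<close> at
  \<open>0\<close>. The result is a linear equation whose coefficients see the group only through
  its bracket.\<close>

lemma dexp_has_vector_derivative:
  "(dexp x v has_vector_derivative v - bracket x (dexp x v s)) (at s)"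
proof (rule has_vector_derivative_shift)
  have s: "smooth (\<lambda>h::real. dl (- (h *\<^sub>R x)) (h *\<^sub>R x) v)" by (intro smooth_intros)
  have "((\<lambda>h::real. h *\<^sub>R dl (- (h *\<^sub>R x)) (h *\<^sub>R x) v) has_vector_derivative v) (at 0)"
    using has_vector_derivative_scaleR[OF DERIV_ident[of "at 0"]
        has_vector_derivative_fd[OF has_vector_derivative_id s]]
    by simp
  then have "(dexp x v has_vector_derivative v) (at 0)"
    by (simp add: dexp_def[abs_def] linear_cmul[OF linear_dl])
  from has_vector_derivative_add[OF conjugation_has_vector_derivative[of x "dexp x v s"] this]
  show "((\<lambda>h. dexp x v (s + h)) has_vector_derivative v - bracket x (dexp x v s)) (at 0)"
    by (simp add: dexp_add)
qed

end

text \<open>Gronwall's argument: with an operator bound \<open>K\<close> for \<open>A\<close>, the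
  weight \<open>exp (- (2 * K * s))\<close> makes the squared norm of \<open>d\<close>
  nonincreasing.\<close>

lemma linear_ode_zero:
  fixes d :: "real \<Rightarrow> 'v::euclidean_space"
  assumes "linear A" "\<And>s. (d has_vector_derivative A (d s)) (at s)" "d 0 = 0" "s \<ge> 0"
  shows "d s = 0"
proof -
  obtain K where K: "\<And>x. norm (A x) \<le> norm x * K"
    using assms(1) bounded_linear.bounded linear_conv_bounded_linear by blast
  let ?g = "\<lambda>s. exp (- (2 * K * s)) * (d s \<bullet> d s)"
  have dd: "((\<lambda>s. d s \<bullet> d s) has_real_derivative 2 * (d s \<bullet> A (d s))) (at s)" for s
  proof -
    have "((\<lambda>s. d s \<bullet> d s) has_derivative (\<lambda>h. d s \<bullet> (h *\<^sub>R A (d s)) + (h *\<^sub>R A (d s)) \<bullet> d s)) (at s)"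
      using assms(2)[of s] unfolding has_vector_derivative_def by (intro has_derivative_inner)
    moreover have "(\<lambda>h. d s \<bullet> (h *\<^sub>R A (d s)) + (h *\<^sub>R A (d s)) \<bullet> d s) = (*) (2 * (d s \<bullet> A (d s)))"
      by (auto simp: inner_commute)
    ultimately show ?thesis by (simp add: has_field_derivative_def)
  qed
  have "(?g has_real_derivative exp (- (2 * K * s)) * (2 * (d s \<bullet> A (d s)) - 2 * K * (d s \<bullet> d s))) (at s)" for s
    by (rule derivative_eq_intros dd refl)+ (simp add: algebra_simps)
  moreover have "exp (- (2 * K * s)) * (2 * (d s \<bullet> A (d s)) - 2 * K * (d s \<bullet> d s)) \<le> 0" for s
  proof -
    have "d s \<bullet> A (d s) \<le> norm (d s) * (norm (d s) * K)"
      using norm_cauchy_schwarz[of "d s" "A (d s)"] mult_left_mono[OF K[of "d s"] norm_ge_zero[of "d s"]]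
      by linarith
    also have "\<dots> = K * (d s \<bullet> d s)" by (simp add: dot_square_norm power2_eq_square)
    finally show ?thesis by (simp add: mult_nonneg_nonpos)
  qed
  ultimately have "?g s \<le> ?g 0"
    by (intro DERIV_nonpos_imp_nonincreasing[OF assms(4)]) blast
  then have "d s \<bullet> d s \<le> 0" by (simp add: assms(3) mult_le_0_iff)
  then show ?thesis by (metis inner_ge_zero inner_eq_zero_iff order_antisym)
qed

locale lie_algebra_hom =
  G: exponential_lie_group m + H: exponential_lie_group m'
  for m :: "'v::euclidean_space \<Rightarrow> 'v \<Rightarrow> 'v" and m' :: "'w::euclidean_space \<Rightarrow> 'w \<Rightarrow> 'w" +
  fixes \<alpha> :: "'v \<Rightarrow> 'w"
  assumes linear: "linear \<alpha>"
    and hom_bracket: "\<alpha> (G.bracket x y) = H.bracket (\<alpha> x) (\<alpha> y)"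
begin

text \<open>Both sides solve the same linear differential equation along the ray through \<open>x\<close>.\<close>

lemma hom_dexp: "\<alpha> (G.dexp x v 1) = H.dexp (\<alpha> x) (\<alpha> v) 1"
proof -
  let ?d = "\<lambda>s. \<alpha> (G.dexp x v s) - H.dexp (\<alpha> x) (\<alpha> v) s"
  have bl: "bounded_linear \<alpha>" using linear linear_conv_bounded_linear by blast
  have "?d 1 = 0"
  proof (rule linear_ode_zero)
    show "linear (\<lambda>u. - H.bracket (\<alpha> x) u)"
      by (intro linear_compose_neg H.linear_bracket_right)
    show "(?d has_vector_derivative - H.bracket (\<alpha> x) (?d s)) (at s)" for s
      using has_vector_derivative_diff[OF
          bounded_linear.has_vector_derivative[OF bl G.dexp_has_vector_derivative[of x v s]]
          H.dexp_has_vector_derivative[of "\<alpha> x" "\<alpha> v" s]]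
      by (simp add: linear_diff[OF linear] linear_diff[OF H.linear_bracket_right] hom_bracket)
    show "?d 0 = 0"
      by (simp add: G.dexp_def H.dexp_def linear_0[OF linear])
  qed simp
  then show ?thesis by simp
qed

text \<open>In \<open>hom_dexp\<close> the vector \<open>v\<close> is replaced by
  \<open>lif x v\<close>, whose left-trivialized derivative at time \<open>1\<close> is
  \<open>v\<close> itself. So \<alpha> carries left-invariant fields to left-invariant fields, which
  is the form in which homomorphisms are used on curves.\<close>

lemma hom_lif: "\<alpha> (G.lif x v) = H.lif (\<alpha> x) (\<alpha> v)"
proof -
  have "\<alpha> v = H.dl (- \<alpha> x) (\<alpha> x) (\<alpha> (G.lif x v))"
    using hom_dexp[of x "G.lif x v"] by (simp add: G.dexp_def H.dexp_def)
  then show ?thesis by (simp only: H.lif_dl_inv)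
qed

end


section \<open>Gradings and dilations in coordinates\<close>

text \<open>The grading is encoded by its projections. The last assumption covers both bracket
  conditions: if \<open>i + j > r\<close>, every component with index in \<open>{1..r}\<close>
  vanishes, and with it the bracket.\<close>

locale graded_exponential_group = exponential_lie_group m
  for m :: "'v::euclidean_space \<Rightarrow> 'v \<Rightarrow> 'v" +
  fixes r :: nat and pr :: "nat \<Rightarrow> 'v \<Rightarrow> 'v"
  assumes linear_pr: "linear (pr w)"
    and pr_pr: "pr w (pr w' x) = (if w = w' then pr w x else 0)"
    and sum_pr: "(\<Sum>w=1..r. pr w x) = x"
    and pr_bracket: "k \<noteq> i + j \<Longrightarrow> pr k (bracket (pr i x) (pr j y)) = 0"
begin

lemma pr_self [simp]: "pr w (pr w x) = pr w x"
  by (simp add: pr_pr)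

lemma pr_outside: "w \<notin> {1..r} \<Longrightarrow> pr w x = 0"
  using linear_sum[OF linear_pr, of w "\<lambda>w. pr w x" "{1..r}"]
  by (subst sum_pr[of x, symmetric]) (auto simp: linear_sum[OF linear_pr] pr_pr intro!: sum.neutral)

lemma pr_eqI: "(\<And>w. w \<in> {1..r} \<Longrightarrow> pr w x = pr w y) \<Longrightarrow> x = y"
  using sum.cong[of "{1..r}" "{1..r}" "\<lambda>w. pr w x" "\<lambda>w. pr w y"] unfolding sum_pr by blast

lemma bracket_expand: "bracket x y = (\<Sum>i=1..r. \<Sum>j=1..r. bracket (pr i x) (pr j y))"
proof -
  have "bracket x y = bracket (\<Sum>i=1..r. pr i x) (\<Sum>j=1..r. pr j y)" unfolding sum_pr ..
  also have "\<dots> = (\<Sum>i=1..r. \<Sum>j=1..r. bracket (pr i x) (pr j y))"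
    unfolding linear_sum[OF linear_bracket_left] by (simp add: linear_sum[OF linear_bracket_right])
  finally show ?thesis .
qed

lemma pr_bracket_homogeneous: "pr (i + j) (bracket (pr i x) (pr j y)) = bracket (pr i x) (pr j y)"
proof (rule pr_eqI)
  fix w show "pr w (pr (i + j) (bracket (pr i x) (pr j y))) = pr w (bracket (pr i x) (pr j y))"
    by (cases "w = i + j") (auto simp: pr_pr pr_bracket)
qed

text \<open>In exponential coordinates the dilations of the algebra and of the group are the same
  map. Being polynomial in \<open>t\<close>, it extends smoothly to \<open>t = 0\<close>, where it
  is zero because the weights start at \<open>1\<close>.\<close>

definition dil :: "real \<Rightarrow> 'v \<Rightarrow> 'v"
  where "dil t x = (\<Sum>w=1..r. t ^ w *\<^sub>R pr w x)"

lemma pr_dil: "pr w (dil t x) = t ^ w *\<^sub>R pr w x"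
proof (cases "w \<in> {1..r}")
  case True
  have "pr w (dil t x) = (\<Sum>v=1..r. if v = w then t ^ w *\<^sub>R pr w x else 0)"
    unfolding dil_def linear_sum[OF linear_pr]
    by (rule sum.cong) (auto simp: linear_cmul[OF linear_pr] pr_pr)
  then show ?thesis using True by simp
qed (simp add: pr_outside)

lemma linear_dil: "linear (dil t)"
  unfolding dil_def[abs_def]
  by (intro linear_compose_sum ballI linear_compose_scale_right linear_pr)

lemma smooth_dil [smooth_intros]: "smooth f \<Longrightarrow> smooth g \<Longrightarrow> smooth (\<lambda>x. dil (f x) (g x))"
  unfolding dil_def by (intro smooth_intros smooth_linear_compose[OF linear_pr])

lemma dil_dil: "dil s (dil t x) = dil (s * t) x"
  by (rule pr_eqI) (simp add: pr_dil power_mult_distrib)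

lemma dil_one [simp]: "dil 1 x = x"
  by (simp add: dil_def sum_pr del: One_nat_def)

lemma dil_zero [simp]: "dil 0 x = 0"
  by (auto simp: dil_def intro!: sum.neutral)

lemma dil_bracket: "dil t (bracket x y) = bracket (dil t x) (dil t y)"
proof (rule pr_eqI)
  fix k
  have "pr k (dil t (bracket x y)) = (\<Sum>i=1..r. \<Sum>j=1..r. t ^ k *\<^sub>R pr k (bracket (pr i x) (pr j y)))"
    by (simp add: pr_dil bracket_expand[of x y] linear_sum[OF linear_pr] scaleR_sum_right)
  also have "\<dots> = (\<Sum>i=1..r. \<Sum>j=1..r. (t ^ i * t ^ j) *\<^sub>R pr k (bracket (pr i x) (pr j y)))"
  proof (intro sum.cong refl)
    fix i j
    show "t ^ k *\<^sub>R pr k (bracket (pr i x) (pr j y)) = (t ^ i * t ^ j) *\<^sub>R pr k (bracket (pr i x) (pr j y))"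
      by (cases "k = i + j") (simp_all add: power_add pr_bracket)
  qed
  also have "\<dots> = pr k (bracket (dil t x) (dil t y))"
    unfolding bracket_expand[of "dil t x" "dil t y"] linear_sum[OF linear_pr] pr_dil
    by (simp add: linear_cmul[OF linear_pr] linear_cmul[OF linear_bracket_left]
        linear_cmul[OF linear_bracket_right] mult.commute)
  finally show "pr k (dil t (bracket x y)) = pr k (bracket (dil t x) (dil t y))" .
qed

lemma dil_hom: "lie_algebra_hom m m (dil t)"
  by unfold_locales (simp_all add: linear_add[OF linear_dil] linear_cmul[OF linear_dil] dil_bracket)

lemmas dil_lif = lie_algebra_hom.hom_lif[OF dil_hom]

end

text \<open>A continuity argument: up to the first time \<open>s0\<close> at which the norm reaches
  \<epsilon>, the derivative is at most \<open>\<epsilon> / 2\<close>, so the mean value inequality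
  gives norm at most \<open>\<epsilon> / 2\<close> at \<open>s0\<close>, a contradiction. The bound
  on \<open>q'\<close> is assumed only where \<open>q\<close> is small, since the coefficient in the
  application depends on \<open>q\<close>.\<close>

lemma small_derivative_stays_small:
  fixes q :: "real \<Rightarrow> 'v::euclidean_space"
  assumes "\<And>s. (q has_vector_derivative q' s) (at s)" "q 0 = 0" "\<epsilon> > 0"
    and "\<And>s. s \<in> {0..1} \<Longrightarrow> norm (q s) \<le> \<epsilon> \<Longrightarrow> norm (q' s) \<le> \<epsilon> / 2"
  shows "norm (q 1) \<le> \<epsilon>"
proof (rule ccontr)
  assume contra: "\<not> norm (q 1) \<le> \<epsilon>"
  have cont: "continuous_on S q" for S
    by (intro continuous_at_imp_continuous_on ballI has_vector_derivative_continuous[OF assms(1)])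
  let ?S = "{s \<in> {0..1}. \<epsilon> \<le> norm (q s)}"
  have "closed ?S"
    by (rule continuous_on_closed_Collect_le[OF continuous_on_const continuous_on_norm[OF cont]]) simp
  moreover have "?S \<noteq> {}" using contra by (auto intro!: exI[of _ 1])
  moreover have bdd: "bdd_below ?S" by (rule bdd_belowI[of _ 0]) auto
  ultimately have "Inf ?S \<in> ?S" by (intro closed_contains_Inf)
  define s0 where "s0 = Inf ?S"
  have s0: "0 \<le> s0" "s0 \<le> 1" "\<epsilon> \<le> norm (q s0)" using \<open>Inf ?S \<in> ?S\<close> by (auto simp: s0_def)
  have before: "norm (q s) < \<epsilon>" if "0 \<le> s" "s < s0" for s
  proof (rule ccontr)
    assume "\<not> norm (q s) < \<epsilon>"
    then have "s \<in> ?S" using that s0 by auto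
    then show False using cInf_lower[OF _ bdd] that s0_def by fastforce
  qed
  have "s0 \<noteq> 0" using s0 assms(2,3) by auto
  then have "0 < s0" using s0 by simp
  obtain x where x: "x \<in> {0<..<s0}" "norm (q s0 - q 0) \<le> norm ((s0 - 0) *\<^sub>R q' x)"
    using mvt_general[OF \<open>0 < s0\<close> cont, of "\<lambda>x h. h *\<^sub>R q' x"]
      assms(1)[unfolded has_vector_derivative_def] by metis
  have "norm (q' x) \<le> \<epsilon> / 2"
    using before[of x] x s0 by (intro assms(4)) auto
  then have "norm ((s0 - 0) *\<^sub>R q' x) \<le> 1 * (\<epsilon> / 2)"
    using s0 by (simp only: norm_scaleR) (intro mult_mono, auto)
  then show False using x s0 assms(2,3) by simp
qed

section \<open>Filtered maps in coordinates\<close>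

text \<open>\<open>filtered\<close> is the block-triangular shape at every point \<open>x\<close>:
  vectors of weight \<open>i\<close> have image components of weight at most \<open>i\<close>
  only.\<close>

locale coordinate_carnot_map =
  G: graded_exponential_group m r pr + H: graded_exponential_group m' r pr'
  for m :: "'v::euclidean_space \<Rightarrow> 'v \<Rightarrow> 'v" and r pr
    and m' :: "'w::euclidean_space \<Rightarrow> 'w \<Rightarrow> 'w" and pr' +
  fixes \<psi> :: "'v \<Rightarrow> 'w"
  assumes smooth_\<psi>: "smooth \<psi>"
    and filtered: "i < w \<Longrightarrow> pr' w (H.dl (- \<psi> x) (\<psi> x) (fd \<psi> x (G.lif x (pr i v)))) = 0"
begin

text \<open>The differential of \<open>\<psi>\<close> in the left trivializations of both tangent bundles, and its
  block-diagonal part.\<close>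

definition tdiff :: "'v \<Rightarrow> 'v \<Rightarrow> 'w"
  where "tdiff x v = H.dl (- \<psi> x) (\<psi> x) (fd \<psi> x (G.lif x v))"

definition gr_diff :: "'v \<Rightarrow> 'v \<Rightarrow> 'w"
  where "gr_diff x v = (\<Sum>w=1..r. pr' w (tdiff x (pr w v)))"

lemma smooth_tdiff [smooth_intros]: "smooth f \<Longrightarrow> smooth g \<Longrightarrow> smooth (\<lambda>x. tdiff (f x) (g x))"
  unfolding tdiff_def by (intro smooth_intros smooth_\<psi> smooth_compose[OF smooth_\<psi>])

lemma lif_tdiff: "H.lif (\<psi> x) (tdiff x v) = fd \<psi> x (G.lif x v)"
  by (simp add: tdiff_def)

lemma linear_tdiff: "linear (tdiff x)"
proof -
  have "linear (H.dl (- \<psi> x) (\<psi> x) \<circ> (fd \<psi> x \<circ> G.lif x))"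
    by (intro linear_compose H.linear_dl G.linear_dl smooth_linear_fd smooth_\<psi>)
  then show ?thesis by (simp add: tdiff_def[abs_def] comp_def)
qed

lemma pr_tdiff: "i < w \<Longrightarrow> pr' w (tdiff x (pr i v)) = 0"
  by (simp add: tdiff_def filtered)

lemma linear_gr_diff: "linear (gr_diff x)"
proof -
  have "linear (\<lambda>v. pr' w (tdiff x (pr w v)))" for w
    using linear_compose[OF linear_compose[OF G.linear_pr linear_tdiff] H.linear_pr]
    by (simp add: comp_def)
  then show ?thesis unfolding gr_diff_def[abs_def] by (intro linear_compose_sum) auto
qed

lemma pr_gr_diff: "pr' w (gr_diff x v) = pr' w (tdiff x (pr w v))"
proof (cases "w \<in> {1..r}")
  case True
  have "pr' w (gr_diff x v) = (\<Sum>u=1..r. if u = w then pr' w (tdiff x (pr w v)) else 0)"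
    unfolding gr_diff_def linear_sum[OF H.linear_pr] by (rule sum.cong) (auto simp: H.pr_pr)
  then show ?thesis using True by simp
qed (simp add: H.pr_outside)

lemma gr_diff_pr: "gr_diff x (pr w v) = pr' w (tdiff x (pr w v))"
proof (rule H.pr_eqI)
  fix k show "pr' k (gr_diff x (pr w v)) = pr' k (pr' w (tdiff x (pr w v)))"
    by (auto simp: pr_gr_diff H.pr_pr G.pr_pr linear_0[OF linear_tdiff] linear_0[OF H.linear_pr])
qed

text \<open>The rescaled differential \<open>\<delta>'\<^bsub>1/t\<^esub> \<circ> tdiff x \<circ> \<delta>\<^bsub>t\<^esub>\<close> is polynomial in \<open>t\<close> because
  the blocks that would carry negative powers vanish.\<close>

definition rescaled_tdiff :: "real \<Rightarrow> 'v \<Rightarrow> 'v \<Rightarrow> 'w"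
  where "rescaled_tdiff t x v = (\<Sum>w=1..r. \<Sum>i=w..r. t ^ (i - w) *\<^sub>R pr' w (tdiff x (pr i v)))"

lemma rescaled_tdiff:
  assumes "t \<noteq> 0"
  shows "H.dil (inverse t) (tdiff x (G.dil t v)) = rescaled_tdiff t x v"
proof -
  have "inverse t ^ w *\<^sub>R pr' w (tdiff x (G.dil t v)) = (\<Sum>i=w..r. t ^ (i - w) *\<^sub>R pr' w (tdiff x (pr i v)))"
    if "w \<in> {1..r}" for w
  proof -
    have "inverse t ^ w *\<^sub>R pr' w (tdiff x (G.dil t v))
        = (\<Sum>i=1..r. inverse t ^ w *\<^sub>R t ^ i *\<^sub>R pr' w (tdiff x (pr i v)))"
      by (simp add: G.dil_def linear_sum[OF linear_tdiff] linear_sum[OF H.linear_pr]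
          linear_cmul[OF linear_tdiff] linear_cmul[OF H.linear_pr] scaleR_sum_right)
    also have "\<dots> = (\<Sum>i=w..r. inverse t ^ w *\<^sub>R t ^ i *\<^sub>R pr' w (tdiff x (pr i v)))"
      using that by (intro sum.mono_neutral_right) (auto simp: pr_tdiff)
    also have "\<dots> = (\<Sum>i=w..r. t ^ (i - w) *\<^sub>R pr' w (tdiff x (pr i v)))"
    proof (rule sum.cong[OF refl])
      fix i assume "i \<in> {w..r}"
      then have "inverse t ^ w * t ^ i = t ^ (i - w)"
        using assms by (simp add: power_diff power_inverse divide_inverse mult.commute)
      then show "inverse t ^ w *\<^sub>R t ^ i *\<^sub>R pr' w (tdiff x (pr i v)) = t ^ (i - w) *\<^sub>R pr' w (tdiff x (pr i v))"
        by simp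
    qed
    finally show ?thesis .
  qed
  then show ?thesis by (simp add: H.dil_def rescaled_tdiff_def)
qed

lemma rescaled_tdiff_zero: "rescaled_tdiff 0 x v = gr_diff x v"
  unfolding rescaled_tdiff_def gr_diff_def
proof (rule sum.cong[OF refl])
  fix w assume w: "w \<in> {1..r}"
  \<comment> \<open>Because \<open>0 ^ 0 = 1\<close>, precisely the diagonal block survives at
    \<open>t = 0\<close>.\<close>
  have "(\<Sum>i=w..r. 0 ^ (i - w) *\<^sub>R pr' w (tdiff x (pr i v)))
      = (\<Sum>i=w..r. if i = w then pr' w (tdiff x (pr w v)) else 0)"
    by (rule sum.cong) auto
  then show "(\<Sum>i=w..r. 0 ^ (i - w) *\<^sub>R pr' w (tdiff x (pr i v))) = pr' w (tdiff x (pr w v))"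
    using w by simp
qed

lemma smooth_rescaled_tdiff [smooth_intros]:
  "smooth f \<Longrightarrow> smooth g \<Longrightarrow> smooth h \<Longrightarrow> smooth (\<lambda>x. rescaled_tdiff (f x) (g x) (h x))"
  unfolding rescaled_tdiff_def
  by (intro smooth_intros smooth_linear_compose[OF H.linear_pr] smooth_linear_compose[OF G.linear_pr])

end


context coordinate_carnot_map
begin

text \<open>Reduces every base point to the unit. Left trivializations are invariant under left
  translation, so the translated map has the same \<open>tdiff\<close>, merely at the shifted
  point.\<close>

lemma coordinate_carnot_map_translate:
  "coordinate_carnot_map m r pr m' pr' (\<lambda>x. m' (- \<psi> a) (\<psi> (m a x)))" (is ?map)
  and tdiff_translate: "coordinate_carnot_map.tdiff m m' (\<lambda>x. m' (- \<psi> a) (\<psi> (m a x))) x v = tdiff (m a x) v"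
proof -
  let ?\<chi> = "\<lambda>x. m' (- \<psi> a) (\<psi> (m a x))"
  have s1: "smooth (\<lambda>x. \<psi> (m a x))" by (intro smooth_compose[OF smooth_\<psi>] smooth_intros)
  have d: "fd ?\<chi> x (G.lif x v) = H.lif (?\<chi> x) (tdiff (m a x) v)" for x v
  proof -
    have "fd ?\<chi> x (G.lif x v) = H.dl (- \<psi> a) (\<psi> (m a x)) (fd \<psi> (m a x) (G.dl a x (G.lif x v)))"
      using fd_compose[OF H.smooth_left s1, of "- \<psi> a"] fd_compose[OF smooth_\<psi> G.smooth_left]
      by (simp add: H.fd_left G.fd_left)
    also have "\<dots> = H.lif (?\<chi> x) (tdiff (m a x) v)"
      by (simp add: G.dl_lif H.dl_lif flip: lif_tdiff)
    finally show ?thesis .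
  qed
  then have e: "H.dl (- ?\<chi> x) (?\<chi> x) (fd ?\<chi> x (G.lif x v)) = tdiff (m a x) v" for x v
    by simp
  show m: ?map
    by unfold_locales (auto simp: e pr_tdiff intro!: smooth_intros s1)
  show "coordinate_carnot_map.tdiff m m' ?\<chi> x v = tdiff (m a x) v"
    unfolding coordinate_carnot_map.tdiff_def[OF m] by (rule e)
qed

end

locale pointed_coordinate_carnot_map = coordinate_carnot_map +
  assumes \<psi>_zero: "\<psi> 0 = 0"
begin

lemma tdiff_zero: "tdiff 0 v = fd \<psi> 0 v"
  by (simp add: tdiff_def \<psi>_zero)

text \<open>The derivative of \<open>\<lambda>x. tdiff x v\<close> at \<open>0\<close> in the
  direction \<open>u\<close>. The three terms come from the three occurrences of the base point in
  \<open>tdiff\<close>: the outer left translation, the differential of \<psi>, and the inner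
  left-invariant field.\<close>

definition tdiff_deriv :: "'a \<Rightarrow> 'a \<Rightarrow> 'b"
  where "tdiff_deriv u v = - fd (\<lambda>p. H.lif p (tdiff 0 v)) 0 (tdiff 0 u)
    + (fd (\<lambda>x. fd \<psi> x v) 0 u + tdiff 0 (fd (\<lambda>p. G.lif p v) 0 u))"

lemma tdiff_has_vector_derivative:
  "((\<lambda>h. tdiff (h *\<^sub>R u) v) has_vector_derivative tdiff_deriv u v) (at 0)"
proof -
  have lin: "((\<lambda>h. h *\<^sub>R u) has_vector_derivative u) (at 0)"
    by (auto intro!: derivative_eq_intros)
  have psi: "((\<lambda>h. \<psi> (h *\<^sub>R u)) has_vector_derivative tdiff 0 u) (at 0)"
    using has_vector_derivative_fd[OF lin smooth_\<psi>] by (simp add: tdiff_zero)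
  have "((\<lambda>h. G.lif (h *\<^sub>R u) v) has_vector_derivative fd (\<lambda>p. G.lif p v) 0 u) (at 0)"
    using has_vector_derivative_fd[OF lin G.smooth_lif_const] by simp
  from has_vector_derivative_fd2[OF smooth_\<psi> lin this]
  have w: "((\<lambda>h. fd \<psi> (h *\<^sub>R u) (G.lif (h *\<^sub>R u) v)) has_vector_derivative
      fd (\<lambda>x. fd \<psi> x v) 0 u + tdiff 0 (fd (\<lambda>p. G.lif p v) 0 u)) (at 0)"
    by (simp add: tdiff_zero)
  from H.dl_has_vector_derivative[OF has_vector_derivative_minus[OF psi] psi w]
  show ?thesis
    by (simp add: tdiff_def[abs_def] \<psi>_zero tdiff_deriv_def fd_minus[OF H.smooth_lif_const])
qed

text \<open>The Maurer-Cartan equation at the unit.\<close>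

lemma tdiff_deriv_commutator:
  "tdiff_deriv u v - tdiff_deriv v u = tdiff 0 (G.bracket u v) - H.bracket (tdiff 0 u) (tdiff 0 v)"
  by (simp add: tdiff_deriv_def G.bracket_def H.bracket_def linear_diff[OF linear_tdiff]
      fd_fd_commute[OF smooth_\<psi>, of v 0 u])

text \<open>The block vanishes at every point, not only at the unit, so its derivative vanishes as
  well.\<close>

lemma pr_tdiff_deriv:
  assumes "j < k" shows "pr' k (tdiff_deriv u (pr j v)) = 0"
proof -
  have "((\<lambda>h. pr' k (tdiff (h *\<^sub>R u) (pr j v))) has_vector_derivative pr' k (tdiff_deriv u (pr j v))) (at 0)"
    by (rule bounded_linear.has_vector_derivative[OF _ tdiff_has_vector_derivative])
      (simp add: H.linear_pr flip: linear_conv_bounded_linear)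
  then have "((\<lambda>h::real. 0) has_vector_derivative pr' k (tdiff_deriv u (pr j v))) (at 0)"
    by (simp add: pr_tdiff[OF assms])
  then show ?thesis using has_vector_derivative_const vector_derivative_unique_at by blast
qed

text \<open>The component of weight \<open>i + j\<close> of the Maurer-Cartan equation is taken on
  vectors of weights \<open>i\<close> and \<open>j\<close>: the derivative terms vanish and on the
  right only the product of the diagonal blocks reaches this weight.\<close>

lemma gr_diff_bracket_homogeneous:
  assumes "i \<in> {1..r}" "j \<in> {1..r}"
  shows "gr_diff 0 (G.bracket (pr i x) (pr j y)) = H.bracket (gr_diff 0 (pr i x)) (gr_diff 0 (pr j y))"
proof -
  let ?k = "i + j" and ?D = "tdiff 0"
  \<comment> \<open>Weights are at least \<open>1\<close>, so \<open>i + j\<close> exceeds both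
    \<open>i\<close> and \<open>j\<close>.\<close>
  have "pr' ?k (tdiff_deriv (pr i x) (pr j y)) = 0" "pr' ?k (tdiff_deriv (pr j y) (pr i x)) = 0"
    using assms by (simp_all add: pr_tdiff_deriv)
  then have "pr' ?k (tdiff_deriv (pr i x) (pr j y) - tdiff_deriv (pr j y) (pr i x)) = 0"
    by (simp add: linear_diff[OF H.linear_pr])
  then have 1: "pr' ?k (?D (G.bracket (pr i x) (pr j y))) = pr' ?k (H.bracket (?D (pr i x)) (?D (pr j y)))"
    unfolding tdiff_deriv_commutator by (simp add: linear_diff[OF H.linear_pr])
  have "gr_diff 0 (G.bracket (pr i x) (pr j y)) = gr_diff 0 (pr ?k (G.bracket (pr i x) (pr j y)))"
    by (simp only: G.pr_bracket_homogeneous)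
  also have "\<dots> = pr' ?k (?D (G.bracket (pr i x) (pr j y)))"
    using gr_diff_pr[of 0 ?k "G.bracket (pr i x) (pr j y)"] by (simp only: G.pr_bracket_homogeneous)
  also have "\<dots> = (\<Sum>a=1..r. \<Sum>b=1..r. pr' ?k (H.bracket (pr' a (?D (pr i x))) (pr' b (?D (pr j y)))))"
    unfolding 1 by (subst H.bracket_expand) (simp add: linear_sum[OF H.linear_pr])
  also have "\<dots> = (\<Sum>a=1..r. \<Sum>b=1..r. if b = j then if a = i then
      H.bracket (gr_diff 0 (pr i x)) (gr_diff 0 (pr j y)) else 0 else 0)"
  proof (intro sum.cong refl)
    fix a b
    \<comment> \<open>Triangularity removes \<open>a > i\<close> and \<open>b > j\<close>; in the
      remaining range any other pair than \<open>(i, j)\<close> has \<open>a + b < i + j\<close> and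
      is removed by the grading of the target.\<close>
    consider "i < a" | "j < b" | "a = i" "b = j" | "\<not> i < a" "\<not> j < b" "a \<noteq> i \<or> b \<noteq> j" by blast
    then show "pr' ?k (H.bracket (pr' a (?D (pr i x))) (pr' b (?D (pr j y))))
      = (if b = j then if a = i then
      H.bracket (gr_diff 0 (pr i x)) (gr_diff 0 (pr j y)) else 0 else 0)"
    proof cases
      case 1 then show ?thesis
        by (simp add: pr_tdiff linear_0[OF H.linear_bracket_left] linear_0[OF H.linear_pr])
    next
      case 2 then show ?thesis
        by (simp add: pr_tdiff linear_0[OF H.linear_bracket_right] linear_0[OF H.linear_pr])
    next
      case 3 then show ?thesis by (simp add: gr_diff_pr H.pr_bracket_homogeneous)
    next
      case 4 then show ?thesis by (auto simp: H.pr_bracket)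
    qed
  qed
  also have "\<dots> = H.bracket (gr_diff 0 (pr i x)) (gr_diff 0 (pr j y))"
    using assms by simp
  finally show ?thesis .
qed

lemma gr_diff_hom: "lie_algebra_hom m m' (gr_diff 0)"
proof unfold_locales
  fix x y
  have "gr_diff 0 (G.bracket x y)
      = (\<Sum>i=1..r. \<Sum>j=1..r. H.bracket (gr_diff 0 (pr i x)) (gr_diff 0 (pr j y)))"
    by (subst G.bracket_expand) (simp add: linear_sum[OF linear_gr_diff] gr_diff_bracket_homogeneous)
  also have "\<dots> = H.bracket (gr_diff 0 (\<Sum>i=1..r. pr i x)) (gr_diff 0 (\<Sum>j=1..r. pr j y))"
    unfolding linear_sum[OF linear_gr_diff] linear_sum[OF H.linear_bracket_left]
    by (simp only: linear_sum[OF H.linear_bracket_right])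
  finally show "gr_diff 0 (G.bracket x y) = H.bracket (gr_diff 0 x) (gr_diff 0 y)"
    unfolding G.sum_pr .
qed (simp_all add: linear_add[OF linear_gr_diff] linear_cmul[OF linear_gr_diff])

text \<open>The left logarithmic derivative of the dilation orbit \<open>s \<mapsto> \<delta>\<^bsub>s\<^esub> x\<close>.\<close>

definition orbit_log :: "'a \<Rightarrow> real \<Rightarrow> 'a"
  where "orbit_log x s = G.dl (- G.dil s x) (G.dil s x) (fd (\<lambda>s. G.dil s x) s 1)"

lemma smooth_orbit_log: "smooth (orbit_log x)"
  unfolding orbit_log_def[abs_def] by (intro smooth_intros)

lemma orbit_has_vector_derivative:
  "((\<lambda>s. G.dil s x) has_vector_derivative G.lif (G.dil s x) (orbit_log x s)) (at s)"
proof -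
  have s: "smooth (\<lambda>s. G.dil s x)" by (intro smooth_intros)
  show ?thesis
    using has_vector_derivative_fd[OF has_vector_derivative_id s] by (simp add: orbit_log_def)
qed

lemma orbit_scale_has_vector_derivative:
  "((\<lambda>s. G.dil (t * s) x) has_vector_derivative t *\<^sub>R G.lif (G.dil (t * s) x) (orbit_log x (t * s))) (at s)"
proof -
  have "((\<lambda>s. t * s) has_derivative (\<lambda>h. t * h)) (at s)"
    by (auto intro!: derivative_eq_intros)
  from has_derivative_compose[OF this orbit_has_vector_derivative[of x "t * s", unfolded has_vector_derivative_def]]
  show ?thesis by (simp add: has_vector_derivative_def mult.commute)
qed

text \<open>The orbit \<open>s \<mapsto> dil (t * s) x\<close> is differentiated twice, as a
  reparametrization of an orbit and as its image under the homomorphism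
  \<open>dil t\<close>.\<close>

lemma dil_orbit_log: "G.dil t (orbit_log x s) = t *\<^sub>R orbit_log x (t * s)"
proof -
  have "((\<lambda>s. G.dil t (G.dil s x)) has_vector_derivative G.dil t (G.lif (G.dil s x) (orbit_log x s))) (at s)"
    by (rule bounded_linear.has_vector_derivative[OF _ orbit_has_vector_derivative])
      (simp add: G.linear_dil flip: linear_conv_bounded_linear)
  then have "((\<lambda>s. G.dil (t * s) x) has_vector_derivative
      G.lif (G.dil (t * s) x) (G.dil t (orbit_log x s))) (at s)"
    by (simp add: G.dil_dil G.dil_lif)
  from vector_derivative_unique_at[OF this orbit_scale_has_vector_derivative]
  have "G.lif (G.dil (t * s) x) (G.dil t (orbit_log x s))
      = G.lif (G.dil (t * s) x) (t *\<^sub>R orbit_log x (t * s))"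
    by (simp add: linear_cmul[OF G.linear_dl])
  then show ?thesis by (simp only: G.lif_inject)
qed

text \<open>For \<open>t \<noteq> 0\<close> it runs from the unit at \<open>s = 0\<close> to the
  difference quotient of \<psi> at \<open>s = 1\<close>.\<close>

definition rescaled_curve :: "'a \<Rightarrow> real \<Rightarrow> real \<Rightarrow> 'b"
  where "rescaled_curve x t s = H.dil (inverse t) (\<psi> (G.dil (t * s) x))"

text \<open>The inner orbit has logarithmic derivative \<open>dil t (orbit_log x s)\<close>, the map
  \<psi> applies \<open>tdiff\<close>, and the outer dilation passes through \<open>lif\<close> as a
  homomorphism. The three factors are those of \<open>rescaled_tdiff\<close>.\<close>

lemma rescaled_curve_has_vector_derivative:
  assumes "t \<noteq> 0"
  shows "(rescaled_curve x t has_vector_derivative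
    H.lif (rescaled_curve x t s) (rescaled_tdiff t (G.dil (t * s) x) (orbit_log x s))) (at s)"
proof -
  have "((\<lambda>s. \<psi> (G.dil (t * s) x)) has_vector_derivative
      fd \<psi> (G.dil (t * s) x) (G.lif (G.dil (t * s) x) (G.dil t (orbit_log x s)))) (at s)"
    using has_vector_derivative_fd[OF orbit_scale_has_vector_derivative smooth_\<psi>]
    by (simp add: dil_orbit_log linear_cmul[OF G.linear_dl])
  then have "((\<lambda>s. \<psi> (G.dil (t * s) x)) has_vector_derivative
      H.lif (\<psi> (G.dil (t * s) x)) (tdiff (G.dil (t * s) x) (G.dil t (orbit_log x s)))) (at s)"
    by (simp add: lif_tdiff)
  then have "((\<lambda>s. H.dil (inverse t) (\<psi> (G.dil (t * s) x))) has_vector_derivative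
      H.dil (inverse t) (H.lif (\<psi> (G.dil (t * s) x)) (tdiff (G.dil (t * s) x) (G.dil t (orbit_log x s))))) (at s)"
    by (rule bounded_linear.has_vector_derivative[rotated])
      (simp add: H.linear_dil flip: linear_conv_bounded_linear)
  then show ?thesis
    by (simp add: H.dil_lif rescaled_tdiff[OF assms] rescaled_curve_def[abs_def])
qed

lemma limit_curve_has_vector_derivative:
  "((\<lambda>s. gr_diff 0 (G.dil s x)) has_vector_derivative
    H.lif (gr_diff 0 (G.dil s x)) (gr_diff 0 (orbit_log x s))) (at s)"
proof -
  have "((\<lambda>s. gr_diff 0 (G.dil s x)) has_vector_derivative
      gr_diff 0 (G.lif (G.dil s x) (orbit_log x s))) (at s)"
    by (rule bounded_linear.has_vector_derivative[OF _ orbit_has_vector_derivative])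
      (simp add: linear_gr_diff flip: linear_conv_bounded_linear)
  then show ?thesis by (simp add: lie_algebra_hom.hom_lif[OF gr_diff_hom])
qed

text \<open>The difference is smooth in \<open>(t, s)\<close> across \<open>t = 0\<close> and
  vanishes there; uniform continuity on a compact rectangle makes it small for all \<open>s\<close>
  at once.\<close>

lemma uniformly_small_log_difference:
  assumes "\<eta> > 0"
  shows "\<exists>d>0. \<forall>t. \<bar>t\<bar> < d \<longrightarrow> (\<forall>s\<in>{0..1}.
    norm (rescaled_tdiff t (G.dil (t * s) x) (orbit_log x s) - gr_diff 0 (orbit_log x s)) < \<eta>)"
proof -
  define z where "z p = rescaled_tdiff (fst p) (G.dil (fst p * snd p) x) (orbit_log x (snd p))
    - gr_diff 0 (orbit_log x (snd p))" for p
  have "smooth z"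
    unfolding z_def[abs_def]
    by (intro smooth_intros smooth_linear_compose[OF linear_gr_diff] smooth_compose[OF smooth_orbit_log])
  then have "uniformly_continuous_on ({-1..1} \<times> {0..1}) z"
    by (intro compact_uniformly_continuous smooth_continuous_on compact_Times compact_Icc)
  then obtain d where d: "d > 0" and
    "\<forall>p\<in>{-1..1} \<times> {0..1}. \<forall>q\<in>{-1..1} \<times> {0..1}. dist q p < d \<longrightarrow> dist (z q) (z p) < \<eta>"
    unfolding uniformly_continuous_on_def using assms by metis
  then have close: "p \<in> {-1..1} \<times> {0..1} \<Longrightarrow> q \<in> {-1..1} \<times> {0..1} \<Longrightarrow> dist q p < d \<Longrightarrow> dist (z q) (z p) < \<eta>"
    for p q by blast
  have "norm (z (t, s)) < \<eta>" if "\<bar>t\<bar> < min d 1" "s \<in> {0..1}" for t s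
  proof -
    have "z (0, s) = 0" by (simp add: z_def rescaled_tdiff_zero)
    moreover have "dist (t, s) (0, s) < d" using that by (simp add: dist_Pair_Pair dist_real_def)
    ultimately show ?thesis using close[of "(0, s)" "(t, s)"] that by (auto simp: dist_norm abs_less_iff)
  qed
  then show ?thesis using d by (intro exI[of _ "min d 1"]) (auto simp: z_def)
qed

text \<open>The quotient of the rescaled curve by the limit curve starts at the unit, and its
  derivative is a bounded linear image of the small difference of logarithmic derivatives. The bound
  holds as long as the quotient stays in the unit ball, which
  \<open>small_derivative_stays_small\<close> guarantees.\<close>

lemma rescaled_curve_quotient_tendsto:
  "((\<lambda>t. m' (rescaled_curve x t 1) (- gr_diff 0 x)) \<longlongrightarrow> 0) (at 0)"
proof (rule tendstoI)
  fix \<epsilon>' :: real assume "\<epsilon>' > 0"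
  \<comment> \<open>The cap \<open>1\<close> keeps the quotient in the unit ball, where
    \<open>C\<close> is valid; halving gives a strict inequality at the end.\<close>
  define \<epsilon> where "\<epsilon> = min 1 (\<epsilon>' / 2)"
  have \<epsilon>: "0 < \<epsilon>" "\<epsilon> \<le> 1" "\<epsilon> < \<epsilon>'" using \<open>\<epsilon>' > 0\<close> by (auto simp: \<epsilon>_def)
  let ?\<tau> = "\<lambda>s. gr_diff 0 (G.dil s x)"
  let ?z = "\<lambda>t s. rescaled_tdiff t (G.dil (t * s) x) (orbit_log x s) - gr_diff 0 (orbit_log x s)"
  \<comment> \<open>The rescaled curve is written as quotient times limit curve. The coefficient
    then depends on \<open>t\<close> only through the quotient \<open>y\<close>, so one constant
    \<open>C\<close> serves all \<open>t\<close>.\<close>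
  define F where "F y s = (\<lambda>w. H.dl (m' y (?\<tau> s)) (- ?\<tau> s) (H.dr 0 (- ?\<tau> s) w))" for y s
  have linear_F: "linear (F y s)" for y s
    using linear_compose[OF H.linear_dr H.linear_dl] by (simp add: F_def comp_def)
  have sF: "smooth (\<lambda>p. F (fst (fst p)) (snd (fst p)) (snd p))"
    unfolding F_def by (intro smooth_intros smooth_linear_compose[OF linear_gr_diff])
  have "bounded ((\<lambda>p. F (fst (fst p)) (snd (fst p)) (snd p)) ` ((cball 0 1 \<times> {0..1}) \<times> cball 0 1))"
    by (intro compact_imp_bounded compact_continuous_image smooth_continuous_on[OF sF] compact_Times compact_cball compact_Icc)
  then obtain C where C: "C > 0"
    "\<forall>u\<in>(\<lambda>p. F (fst (fst p)) (snd (fst p)) (snd p)) ` ((cball 0 1 \<times> {0..1}) \<times> cball 0 1). norm u \<le> C"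
    unfolding bounded_pos by blast
  have unit_bound: "norm (F y s w) \<le> C" if "norm y \<le> 1" "s \<in> {0..1}" "norm w \<le> 1" for y s w
    using C(2) that by (auto dest!: bspec[where x = "F y s w"] intro!: image_eqI[where x = "((y, s), w)"])
  have bound: "norm (F y s w) \<le> C * norm w" if "norm y \<le> 1" "s \<in> {0..1}" for y s w
  proof (cases "w = 0")
    case True then show ?thesis using linear_0[OF linear_F] by simp
  next
    case False
    then have "norm (F y s ((1 / norm w) *\<^sub>R w)) \<le> C"
      using that by (intro unit_bound) auto
    then show ?thesis using False by (simp add: linear_cmul[OF linear_F] field_simps)
  qed
  \<comment> \<open>The threshold \<open>\<epsilon> / (2 * C)\<close> becomes the required
    \<open>\<epsilon> / 2\<close> after multiplication by \<open>C\<close>.\<close>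
  obtain d where d: "d > 0" "\<And>t s. \<bar>t\<bar> < d \<Longrightarrow> s \<in> {0..1} \<Longrightarrow> norm (?z t s) < \<epsilon> / (2 * C)"
    using uniformly_small_log_difference[of "\<epsilon> / (2 * C)" x] \<epsilon>(1) C(1) by (auto simp del: atLeastAtMost_iff)
  have "norm (m' (rescaled_curve x t 1) (- gr_diff 0 x)) < \<epsilon>'" if t: "t \<noteq> 0" "\<bar>t\<bar> < d" for t
  proof -
    let ?q = "\<lambda>s. m' (rescaled_curve x t s) (- ?\<tau> s)"
    have "norm (?q 1) \<le> \<epsilon>"
    proof (rule small_derivative_stays_small)
      show "(?q has_vector_derivative F (?q s) s (?z t s)) (at s)" for s
      proof -
        have F_q: "F (?q s) s w = H.dl (rescaled_curve x t s) (- ?\<tau> s) (H.dr 0 (- ?\<tau> s) w)" for w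
          by (simp add: F_def H.assoc)
        show ?thesis
          unfolding F_q
          by (rule H.quotient_has_vector_derivative[where c = "rescaled_curve x t" and d = ?\<tau>])
            (rule rescaled_curve_has_vector_derivative[OF t(1)] limit_curve_has_vector_derivative)+
      qed
      show "?q 0 = 0"
        by (simp add: rescaled_curve_def \<psi>_zero linear_0[OF linear_gr_diff] linear_0[OF H.linear_dil])
      show "norm (F (?q s) s (?z t s)) \<le> \<epsilon> / 2" if "s \<in> {0..1}" "norm (?q s) \<le> \<epsilon>" for s
      proof -
        have "norm (F (?q s) s (?z t s)) \<le> C * norm (?z t s)"
          using that \<epsilon> by (intro bound) auto
        also have "\<dots> \<le> C * (\<epsilon> / (2 * C))"
          using d(2)[OF t(2) that(1)] C by (intro mult_left_mono) auto
        finally show ?thesis using C by simp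
      qed
    qed (rule \<epsilon>)
    then show ?thesis using \<epsilon> by simp
  qed
  then show "\<forall>\<^sub>F t in at 0. dist (m' (rescaled_curve x t 1) (- gr_diff 0 x)) 0 < \<epsilon>'"
    unfolding eventually_at using d(1) by (auto simp: dist_real_def)
qed

lemma pansu_limit_zero: "((\<lambda>t. H.dil (inverse t) (\<psi> (G.dil t x))) \<longlongrightarrow> gr_diff 0 x) (at 0)"
proof -
  have "isCont (\<lambda>y. m' y (gr_diff 0 x)) 0"
    by (rule smooth_isCont[OF H.smooth_right])
  from isCont_tendsto_compose[OF this rescaled_curve_quotient_tendsto[of x]]
  show ?thesis by (simp add: H.assoc rescaled_curve_def)
qed

end

lemma (in coordinate_carnot_map) pansu_limit:
  "((\<lambda>t. H.dil (inverse t) (m' (- \<psi> a) (\<psi> (m a (G.dil t x))))) \<longlongrightarrow> gr_diff a x) (at 0)"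
proof -
  let ?\<chi> = "\<lambda>x. m' (- \<psi> a) (\<psi> (m a x))"
  interpret T: pointed_coordinate_carnot_map m r pr m' pr' ?\<chi>
    by (intro pointed_coordinate_carnot_map.intro coordinate_carnot_map_translate
        pointed_coordinate_carnot_map_axioms.intro) simp
  have "T.gr_diff 0 x = gr_diff a x"
    by (simp add: T.gr_diff_def gr_diff_def tdiff_translate)
  then show ?thesis using T.pansu_limit_zero[of x] by simp
qed


section \<open>Direct sums, filtrations and their graded pieces\<close>

lemma direct_sumD:
  assumes "direct_sum r V T"
  shows "w \<in> {1..r} \<Longrightarrow> subspace (V w)"
    and "v \<in> T \<Longrightarrow> w \<in> {1..r} \<Longrightarrow> component r V w v \<in> V w"
    and "v \<in> T \<Longrightarrow> (\<Sum>w=1..r. component r V w v) = v"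
    and "(\<And>w. w \<in> {1..r} \<Longrightarrow> \<xi> w \<in> V w) \<Longrightarrow> (\<Sum>w=1..r. \<xi> w) \<in> T"
    and "(\<And>w. w \<in> {1..r} \<Longrightarrow> \<xi> w \<in> V w) \<Longrightarrow> w \<in> {1..r} \<Longrightarrow> component r V w (\<Sum>w=1..r. \<xi> w) = \<xi> w"
proof -
  let ?S = "\<lambda>\<xi>. \<Sum>w=1..r. \<xi> w" and ?P = "\<Pi>\<^sub>E w\<in>{1..r}. V w"
  have bij: "bij_betw ?S ?P T" and sub: "\<forall>w\<in>{1..r}. subspace (V w)"
    using assms by (auto simp: direct_sum_def)
  have inv: "inv_into ?P ?S v \<in> ?P" "?S (inv_into ?P ?S v) = v" if "v \<in> T" for v
    using bij that unfolding bij_betw_def by (metis inv_into_into, metis f_inv_into_f)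
  show "w \<in> {1..r} \<Longrightarrow> subspace (V w)" using sub by blast
  show "v \<in> T \<Longrightarrow> w \<in> {1..r} \<Longrightarrow> component r V w v \<in> V w"
    using inv(1) unfolding component_def by (meson PiE_mem)
  show "v \<in> T \<Longrightarrow> (\<Sum>w=1..r. component r V w v) = v"
    using inv(2) unfolding component_def .
  \<comment> \<open>Elements of \<open>?P\<close> are \<open>undefined\<close> off
    \<open>{1..r}\<close>, so an arbitrary family is first restricted.\<close>
  have restr: "(\<lambda>w\<in>{1..r}. \<xi> w) \<in> ?P" "?S (\<lambda>w\<in>{1..r}. \<xi> w) = ?S \<xi>"
    if "\<And>w. w \<in> {1..r} \<Longrightarrow> \<xi> w \<in> V w" for \<xi>
    using that by (auto intro: sum.cong)
  show "(\<And>w. w \<in> {1..r} \<Longrightarrow> \<xi> w \<in> V w) \<Longrightarrow> (\<Sum>w=1..r. \<xi> w) \<in> T"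
    using restr bij unfolding bij_betw_def by (metis imageI)
  show "component r V w (\<Sum>w=1..r. \<xi> w) = \<xi> w" if "\<And>w. w \<in> {1..r} \<Longrightarrow> \<xi> w \<in> V w" "w \<in> {1..r}"
  proof -
    have "inv_into ?P ?S (?S (\<lambda>w\<in>{1..r}. \<xi> w)) = (\<lambda>w\<in>{1..r}. \<xi> w)"
      using bij restr(1)[OF that(1)] by (intro inv_into_f_f) (auto simp: bij_betw_def)
    then show ?thesis
      unfolding component_def restr(2)[OF that(1)] using that(2) by simp
  qed
qed

text \<open>Meant for the differential of a left translation, which is linear on all operators but
  is known to be injective only on the Lie algebra; hence injectivity on \<open>T\<close>.\<close>

lemma direct_sum_image:
  assumes "direct_sum r V T" "linear F" "inj_on F T"
  shows "direct_sum r (\<lambda>w. F ` V w) (F ` T)"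
    and "v \<in> T \<Longrightarrow> w \<in> {1..r} \<Longrightarrow> component r (\<lambda>w. F ` V w) w (F v) = F (component r V w v)"
proof -
  note D = direct_sumD[OF assms(1)]
  let ?S = "\<lambda>\<xi>. \<Sum>w=1..r. \<xi> w" and ?P = "\<Pi>\<^sub>E w\<in>{1..r}. F ` V w"
  have pre: "\<exists>\<eta>. (\<forall>w\<in>{1..r}. \<eta> w \<in> V w \<and> F (\<eta> w) = \<xi> w)" if "\<xi> \<in> ?P" for \<xi>
  proof -
    have "\<forall>w\<in>{1..r}. \<exists>y. y \<in> V w \<and> F y = \<xi> w"
    proof
      fix w assume "w \<in> {1..r}"
      from PiE_mem[OF that this] show "\<exists>y. y \<in> V w \<and> F y = \<xi> w" by (elim imageE) auto
    qed
    then show ?thesis by (rule bchoice)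
  qed
  have sumF: "?S \<xi> = F (?S \<eta>)" if "\<forall>w\<in>{1..r}. \<eta> w \<in> V w \<and> F (\<eta> w) = \<xi> w" for \<xi> \<eta>
  proof -
    have "F (?S \<eta>) = (\<Sum>w=1..r. F (\<eta> w))" by (rule linear_sum[OF assms(2)])
    also have "\<dots> = ?S \<xi>" by (rule sum.cong) (use that in auto)
    finally show ?thesis by simp
  qed
  have "inj_on ?S ?P"
  proof (rule inj_onI)
    fix \<xi> \<xi>' assume P: "\<xi> \<in> ?P" "\<xi>' \<in> ?P" and eq: "?S \<xi> = ?S \<xi>'"
    obtain \<eta> where \<eta>: "\<forall>w\<in>{1..r}. \<eta> w \<in> V w \<and> F (\<eta> w) = \<xi> w"
      using pre[OF P(1)] by (rule exE)
    obtain \<eta>' where \<eta>': "\<forall>w\<in>{1..r}. \<eta>' w \<in> V w \<and> F (\<eta>' w) = \<xi>' w"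
      using pre[OF P(2)] by (rule exE)
    have "?S \<eta> \<in> T" "?S \<eta>' \<in> T" using D(4) \<eta> \<eta>' by blast+
    moreover have "F (?S \<eta>) = F (?S \<eta>')"
      using eq unfolding sumF[OF \<eta>] sumF[OF \<eta>'] .
    ultimately have "?S \<eta> = ?S \<eta>'" using assms(3) by (simp only: inj_on_eq_iff)
    moreover have "component r V w (?S \<eta>) = \<eta> w" "component r V w (?S \<eta>') = \<eta>' w" if "w \<in> {1..r}" for w
      using \<eta> \<eta>' that by (intro D(5); blast)+
    ultimately have "\<eta> w = \<eta>' w" if "w \<in> {1..r}" for w
      using that by metis
    then have "\<xi> w = \<xi>' w" if "w \<in> {1..r}" for w
      using bspec[OF \<eta> that] bspec[OF \<eta>' that] that by simp
    then show "\<xi> = \<xi>'" using P by (intro PiE_ext[of _ "{1..r}"]) auto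
  qed
  moreover have "?S ` ?P = F ` T"
  proof safe
    fix \<xi> assume "\<xi> \<in> ?P"
    then obtain \<eta> where \<eta>: "\<forall>w\<in>{1..r}. \<eta> w \<in> V w \<and> F (\<eta> w) = \<xi> w" using pre by blast
    then show "?S \<xi> \<in> F ` T" using sumF[OF \<eta>] D(4)[of \<eta>] by blast
  next
    fix v assume v: "v \<in> T"
    let ?\<xi> = "\<lambda>w\<in>{1..r}. F (component r V w v)"
    have "?S ?\<xi> = F v"
      using D(3)[OF v] linear_sum[OF assms(2), of "\<lambda>w. component r V w v" "{1..r}"] by simp
    moreover have "?\<xi> \<in> ?P" using D(2)[OF v] by auto
    ultimately show "F v \<in> ?S ` ?P" by (metis imageI)
  qed
  ultimately have "bij_betw ?S ?P (F ` T)" by (simp add: bij_betw_def)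
  moreover have "subspace (F ` V w)" if "w \<in> {1..r}" for w
    using D(1)[OF that] linear_subspace_image[OF assms(2)] by blast
  ultimately show ds: "direct_sum r (\<lambda>w. F ` V w) (F ` T)" by (simp add: direct_sum_def)
  show "component r (\<lambda>w. F ` V w) w (F v) = F (component r V w v)" if "v \<in> T" "w \<in> {1..r}"
  proof -
    have "F v = (\<Sum>w=1..r. F (component r V w v))"
      using D(3)[OF that(1)] linear_sum[OF assms(2), of "\<lambda>w. component r V w v" "{1..r}"] by simp
    moreover have "component r (\<lambda>w. F ` V w) w (\<Sum>w=1..r. F (component r V w v)) = F (component r V w v)"
      by (rule direct_sumD(5)[OF ds]) (use D(2) that in auto)
    ultimately show ?thesis by simp
  qed
qed

context
  fixes r :: nat and V :: "nat \<Rightarrow> 'v::real_vector set" and T :: "'v set"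
  assumes ds: "direct_sum r V T"
begin

lemma component_unique:
  assumes "\<And>w. w \<in> {1..r} \<Longrightarrow> \<xi> w \<in> V w" "(\<Sum>w=1..r. \<xi> w) = v" "w \<in> {1..r}"
  shows "component r V w v = \<xi> w"
  using direct_sumD(5)[OF ds assms(1) assms(3)] assms(2) by blast

lemma direct_sum_subspace: "subspace T"
proof (rule subspaceI)
  show "0 \<in> T" using direct_sumD(4)[OF ds, of "\<lambda>_. 0"] direct_sumD(1)[OF ds] subspace_0 by auto
  fix x y c assume "x \<in> T" "y \<in> T"
  have "(\<Sum>w=1..r. component r V w x + component r V w y) \<in> T"
    by (rule direct_sumD(4)[OF ds]) (use direct_sumD(1,2)[OF ds] \<open>x \<in> T\<close> \<open>y \<in> T\<close> subspace_add in blast)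
  then show "x + y \<in> T"
    using direct_sumD(3)[OF ds \<open>x \<in> T\<close>] direct_sumD(3)[OF ds \<open>y \<in> T\<close>] by (simp add: sum.distrib)
  have "(\<Sum>w=1..r. c *\<^sub>R component r V w x) \<in> T"
    by (rule direct_sumD(4)[OF ds]) (use direct_sumD(1,2)[OF ds] \<open>x \<in> T\<close> subspace_scale in blast)
  then show "c *\<^sub>R x \<in> T"
    using direct_sumD(3)[OF ds \<open>x \<in> T\<close>] by (simp flip: scaleR_sum_right)
qed

lemma component_add:
  assumes "x \<in> T" "y \<in> T" "w \<in> {1..r}"
  shows "component r V w (x + y) = component r V w x + component r V w y"
proof (rule component_unique[OF _ _ assms(3)])
  show "component r V w x + component r V w y \<in> V w" if "w \<in> {1..r}" for w
    using direct_sumD(1,2)[OF ds] assms that subspace_add by blast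
qed (use direct_sumD(3)[OF ds] assms in \<open>simp add: sum.distrib\<close>)

lemma component_scaleR:
  assumes "x \<in> T" "w \<in> {1..r}"
  shows "component r V w (c *\<^sub>R x) = c *\<^sub>R component r V w x"
proof (rule component_unique[OF _ _ assms(2)])
  show "c *\<^sub>R component r V w x \<in> V w" if "w \<in> {1..r}" for w
    using direct_sumD(1,2)[OF ds] assms that subspace_scale by blast
qed (use direct_sumD(3)[OF ds] assms in \<open>simp flip: scaleR_sum_right\<close>)

lemma layer_subset_and_component:
  assumes "v \<in> V u" "u \<in> {1..r}"
  shows "v \<in> T" and "w \<in> {1..r} \<Longrightarrow> component r V w v = (if w = u then v else 0)"
proof -
  let ?\<xi> = "\<lambda>w. if w = u then v else 0"
  have 1: "?\<xi> w \<in> V w" if "w \<in> {1..r}" for w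
    using assms direct_sumD(1)[OF ds that] subspace_0 by auto
  have 2: "(\<Sum>w=1..r. ?\<xi> w) = v" using assms by simp
  show "v \<in> T" using direct_sumD(4)[OF ds 1] 2 by simp
  show "w \<in> {1..r} \<Longrightarrow> component r V w v = ?\<xi> w" by (rule component_unique[OF 1 2])
qed

text \<open>Turns membership in a filtration step, a sum of sets, into the vanishing of the higher
  components.\<close>

lemma sum_layers_iff:
  assumes "w \<le> r"
  shows "v \<in> (\<Sum>i=1..w. V i) \<longleftrightarrow> v \<in> T \<and> (\<forall>i\<in>{1..r}. w < i \<longrightarrow> component r V i v = 0)"
proof
  assume "v \<in> (\<Sum>i=1..w. V i)"
  then obtain \<xi> where \<xi>: "v = (\<Sum>i=1..w. \<xi> i)" "\<forall>i\<in>{1..w}. \<xi> i \<in> V i"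
    by (auto simp: set_sum_alt)
  let ?\<eta> = "\<lambda>i. if i \<le> w then \<xi> i else 0"
  have 1: "?\<eta> i \<in> V i" if "i \<in> {1..r}" for i
    using \<xi> that direct_sumD(1)[OF ds that] subspace_0 by auto
  have "(\<Sum>i=1..r. ?\<eta> i) = (\<Sum>i=1..w. ?\<eta> i)"
    using assms by (intro sum.mono_neutral_right) auto
  then have 2: "(\<Sum>i=1..r. ?\<eta> i) = v" using \<xi> by simp
  have "v \<in> T" using direct_sumD(4)[OF ds 1] 2 by simp
  moreover have "component r V i v = ?\<eta> i" if "i \<in> {1..r}" for i
    by (rule component_unique[OF 1 2 that])
  ultimately show "v \<in> T \<and> (\<forall>i\<in>{1..r}. w < i \<longrightarrow> component r V i v = 0)" by auto
next
  assume v: "v \<in> T \<and> (\<forall>i\<in>{1..r}. w < i \<longrightarrow> component r V i v = 0)"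
  then have "(\<Sum>i=1..r. component r V i v) = (\<Sum>i=1..w. component r V i v)"
    using assms by (intro sum.mono_neutral_right) auto
  then have "v = (\<Sum>i=1..w. component r V i v)" using direct_sumD(3)[OF ds] v by metis
  moreover have "\<forall>i\<in>{1..w}. component r V i v \<in> V i"
    using direct_sumD(2)[OF ds] v assms by auto
  ultimately show "v \<in> (\<Sum>i=1..w. V i)" by (auto simp: set_sum_alt)
qed

lemma component_zero: "w \<in> {1..r} \<Longrightarrow> component r V w 0 = 0"
  using component_scaleR[of 0 w 0] subspace_0[OF direct_sum_subspace] by simp

lemma subspace_sum_layers:
  assumes "w \<le> r" shows "subspace (\<Sum>i=1..w. V i)"
proof -
  have "subspace {v. v \<in> T \<and> (\<forall>i\<in>{1..r}. w < i \<longrightarrow> component r V i v = 0)}"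
    by (rule subspaceI)
      (auto simp: component_add component_scaleR component_zero subspace_0[OF direct_sum_subspace]
        subspace_add[OF direct_sum_subspace] subspace_scale[OF direct_sum_subspace])
  also have "{v. v \<in> T \<and> (\<forall>i\<in>{1..r}. w < i \<longrightarrow> component r V i v = 0)} = (\<Sum>i=1..w. V i)"
    by (rule Set.set_eqI) (simp only: sum_layers_iff[OF assms] mem_Collect_eq)
  finally show ?thesis .
qed

end


section \<open>Smooth maps in charts\<close>

definition topological_atlas :: "('m::topological_space, 'e::euclidean_space) atlas \<Rightarrow> bool"
  where "topological_atlas A \<longleftrightarrow> (\<Union>(U, \<psi>)\<in>A. U) = UNIV \<and>
    (\<forall>(U, \<psi>)\<in>A. open U \<and> open (\<psi> ` U) \<and> homeomorphism U (\<psi> ` U) \<psi> (inv_into U \<psi>))"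

lemma smooth_atlas_imp_topological: "smooth_atlas A \<Longrightarrow> topological_atlas A"
  by (simp add: smooth_atlas_def topological_atlas_def)

lemma inv_ident: "inv_into UNIV (\<lambda>x. x) = (\<lambda>x. x)"
  by (simp flip: id_def)

lemma topological_atlas_euclid: "topological_atlas euclid_atlas"
  by (auto simp: topological_atlas_def euclid_atlas_def inv_ident homeomorphism_def)

lemma topological_atlasD:
  assumes "topological_atlas A"
  shows "\<exists>U \<psi>. (U, \<psi>) \<in> A \<and> p \<in> U" "(U, \<psi>) \<in> A \<Longrightarrow> open U" "(U, \<psi>) \<in> A \<Longrightarrow> inj_on \<psi> U"
    and "(U, \<psi>) \<in> A \<Longrightarrow> open N \<Longrightarrow> open (\<psi> ` (U \<inter> N))"
proof -
  show "\<exists>U \<psi>. (U, \<psi>) \<in> A \<and> p \<in> U"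
    using assms unfolding topological_atlas_def by (fastforce simp: set_eq_iff)
  show "(U, \<psi>) \<in> A \<Longrightarrow> open U" using assms by (auto simp: topological_atlas_def)
  assume "(U, \<psi>) \<in> A"
  then have h: "open (\<psi> ` U)" "homeomorphism U (\<psi> ` U) \<psi> (inv_into U \<psi>)"
    using assms by (auto simp: topological_atlas_def)
  then show inj: "inj_on \<psi> U" by (metis homeomorphism_def inj_on_inverseI)
  assume "open N"
  have "open (\<psi> ` U \<inter> inv_into U \<psi> -` N)"
    using h \<open>open N\<close> by (intro continuous_open_preimage) (auto simp: homeomorphism_def)
  moreover have "\<psi> ` U \<inter> inv_into U \<psi> -` N = \<psi> ` (U \<inter> N)"
    using inj by auto
  ultimately show "open (\<psi> ` (U \<inter> N))" by simp
qed

text \<open>Near each point a chart of \<open>B\<close> around the image is inserted between the two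
  maps. The conditions on \<open>B\<close> are listed one by one so that \<open>prod_atlas\<close>
  can be the middle atlas.\<close>

lemma smooth_map_compose:
  fixes A :: "('m::topological_space, 'd::euclidean_space) atlas"
    and B :: "('n::topological_space, 'e::euclidean_space) atlas"
    and C :: "('p::topological_space, 'f::euclidean_space) atlas"
  assumes A: "topological_atlas A"
    and B: "\<And>q. \<exists>V \<theta>. (V, \<theta>) \<in> B \<and> q \<in> V"
      "\<And>V \<theta>. (V, \<theta>) \<in> B \<Longrightarrow> open V" "\<And>V \<theta>. (V, \<theta>) \<in> B \<Longrightarrow> inj_on \<theta> V"
    and C: "\<And>W \<zeta>. (W, \<zeta>) \<in> C \<Longrightarrow> open W"
    and f: "smooth_map A B f" and g: "smooth_map B C g"
  shows "smooth_map A C (g \<circ> f)"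
proof -
  have cf: "continuous_on UNIV f" and cg: "continuous_on UNIV g"
    using f g by (auto simp: smooth_map_def)
  then have cont: "continuous_on UNIV (g \<circ> f)"
    by (metis continuous_on_compose continuous_on_subset top_greatest)
  have "smooth_on (\<psi> ` (U \<inter> (g \<circ> f) -` W)) (\<zeta> \<circ> (g \<circ> f) \<circ> inv_into U \<psi>)"
    if U: "(U, \<psi>) \<in> A" and W: "(W, \<zeta>) \<in> C" for U \<psi> W \<zeta>
  proof (rule smooth_on_local)
    fix x assume "x \<in> \<psi> ` (U \<inter> (g \<circ> f) -` W)"
    then obtain p where p: "x = \<psi> p" "p \<in> U" "g (f p) \<in> W" by auto
    obtain V \<theta> where V: "(V, \<theta>) \<in> B" "f p \<in> V" using B(1) by blast
    let ?T = "\<psi> ` (U \<inter> f -` (V \<inter> g -` W))"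
    have "open (f -` (V \<inter> g -` W))"
      using B(2)[OF V(1)] C[OF W] cf cg by (intro open_vimage open_Int)
    then have T: "open ?T" by (rule topological_atlasD(4)[OF A U])
    have inv_U: "inv_into U \<psi> (\<psi> q) = q" if "q \<in> U" for q
      using topological_atlasD(3)[OF A U] that by simp
    have sm: "smooth_on ?T (\<lambda>x. (\<zeta> \<circ> g \<circ> inv_into V \<theta>) ((\<theta> \<circ> f \<circ> inv_into U \<psi>) x))"
    proof (rule smooth_on_compose[OF T, where f = "\<zeta> \<circ> g \<circ> inv_into V \<theta>" and T = "\<theta> ` (V \<inter> g -` W)"])
      show "smooth_on (\<theta> ` (V \<inter> g -` W)) (\<zeta> \<circ> g \<circ> inv_into V \<theta>)"
        using g V W unfolding smooth_map_def by blast
      have "smooth_on (\<psi> ` (U \<inter> f -` V)) (\<theta> \<circ> f \<circ> inv_into U \<psi>)"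
        using f U V unfolding smooth_map_def by blast
      then show "smooth_on ?T (\<theta> \<circ> f \<circ> inv_into U \<psi>)" by (rule smooth_on_subset) auto
    qed (auto simp: inv_U)
    have eq: "(\<zeta> \<circ> g \<circ> inv_into V \<theta>) ((\<theta> \<circ> f \<circ> inv_into U \<psi>) y) = (\<zeta> \<circ> (g \<circ> f) \<circ> inv_into U \<psi>) y"
      if "y \<in> ?T" for y
      using that B(3)[OF V(1)] by (auto simp: inv_U)
    have "smooth_on ?T (\<zeta> \<circ> (g \<circ> f) \<circ> inv_into U \<psi>)"
      by (rule smooth_on_cong[OF T eq sm])
    then show "\<exists>T. open T \<and> x \<in> T \<and> smooth_on T (\<zeta> \<circ> (g \<circ> f) \<circ> inv_into U \<psi>)"
      using T p V by (intro exI[of _ ?T]) auto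
  qed
  then show ?thesis using cont unfolding smooth_map_def by blast
qed

lemma smooth_map_compose_topological:
  assumes "topological_atlas A" "topological_atlas B" "topological_atlas C"
    and "smooth_map A B f" "smooth_map B C g"
  shows "smooth_map A C (g \<circ> f)"
  by (rule smooth_map_compose[OF assms(1) topological_atlasD(1)[OF assms(2)] topological_atlasD(2)[OF assms(2)]
        topological_atlasD(3)[OF assms(2)] topological_atlasD(2)[OF assms(3)] assms(4,5)])

lemma smooth_map_euclid_iff:
  fixes f :: "'d::euclidean_space \<Rightarrow> 'e::euclidean_space"
  shows "smooth_map euclid_atlas euclid_atlas f \<longleftrightarrow> smooth f"
  by (auto simp: smooth_map_def euclid_atlas_def inv_ident comp_def smooth_continuous_on)

locale global_chart =
  fixes A :: "('m::topological_space, 'e::euclidean_space) atlas" and E :: "'e \<Rightarrow> 'm"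
  assumes atlas: "smooth_atlas A" and diffeo: "diffeomorphism euclid_atlas A E"
begin

abbreviation coord :: "'m \<Rightarrow> 'e"
  where "coord \<equiv> inv_into UNIV E"

lemma bij_E: "bij E"
  using diffeo by (simp add: diffeomorphism_def)

lemma E_coord [simp]: "E (coord p) = p"
  using bij_E by (simp add: bij_is_surj surj_f_inv_f)

lemma coord_E [simp]: "coord (E x) = x"
  using bij_E by (simp add: bij_is_inj)

lemma E_eq_iff [simp]: "E x = E y \<longleftrightarrow> x = y"
  using bij_E by (simp add: bij_is_inj inj_eq)

lemma top_atlas: "topological_atlas A"
  using atlas by (rule smooth_atlas_imp_topological)

lemma smooth_map_E: "smooth_map euclid_atlas A E" and smooth_map_coord: "smooth_map A euclid_atlas coord"
  using diffeo by (auto simp: diffeomorphism_def)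

lemma smooth_map_into_iff:
  fixes c :: "'d::euclidean_space \<Rightarrow> 'm"
  shows "smooth_map euclid_atlas A c \<longleftrightarrow> smooth (\<lambda>x. coord (c x))"
proof
  assume "smooth_map euclid_atlas A c"
  from smooth_map_compose_topological[OF topological_atlas_euclid top_atlas topological_atlas_euclid
      this smooth_map_coord]
  show "smooth (\<lambda>x. coord (c x))" by (simp add: smooth_map_euclid_iff comp_def)
next
  assume "smooth (\<lambda>x. coord (c x))"
  then have "smooth_map euclid_atlas euclid_atlas (\<lambda>x. coord (c x))"
    by (simp add: smooth_map_euclid_iff)
  from smooth_map_compose_topological[OF topological_atlas_euclid topological_atlas_euclid top_atlas
      this smooth_map_E]
  show "smooth_map euclid_atlas A c" by (simp add: comp_def)
qed

lemma smooth_functions_iff: "f \<in> smooth_functions A \<longleftrightarrow> smooth (\<lambda>x. f (E x))"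
proof
  assume "f \<in> smooth_functions A"
  then have "smooth_map A euclid_atlas f" by (simp add: smooth_functions_def)
  from smooth_map_compose_topological[OF topological_atlas_euclid top_atlas topological_atlas_euclid
      smooth_map_E this]
  show "smooth (\<lambda>x. f (E x))" by (simp add: smooth_map_euclid_iff comp_def)
next
  assume "smooth (\<lambda>x. f (E x))"
  then have "smooth_map euclid_atlas euclid_atlas (\<lambda>x. f (E x))"
    by (simp add: smooth_map_euclid_iff)
  from smooth_map_compose_topological[OF top_atlas topological_atlas_euclid topological_atlas_euclid
      smooth_map_coord this]
  show "f \<in> smooth_functions A" by (simp add: comp_def smooth_functions_def)
qed

definition tangent :: "'e \<Rightarrow> 'e \<Rightarrow> 'm tangent"
  where "tangent y v = (\<lambda>f. if f \<in> smooth_functions A then fd (\<lambda>x. f (E x)) y v else 0)"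

lemma linear_tangent: "linear (tangent y)"
  by (rule linearI)
    (auto simp: tangent_def fun_eq_iff smooth_functions_iff fd_add fd_scaleR scaleR_fun_def)

text \<open>The coordinates of a global chart are smooth functions on the whole manifold, and they
  detect every component of \<open>v\<close>.\<close>

lemma tangent_inject [simp]: "tangent y v = tangent y w \<longleftrightarrow> v = w"
proof
  assume eq: "tangent y v = tangent y w"
  show "v = w"
  proof (rule euclidean_eqI)
    fix b :: 'e
    have "(\<lambda>p. coord p \<bullet> b) \<in> smooth_functions A"
      by (auto simp: smooth_functions_iff intro!: smooth_intros)
    then show "v \<bullet> b = w \<bullet> b"
      using fun_cong[OF eq, of "\<lambda>p. coord p \<bullet> b"]
      by (simp add: tangent_def fd_linear[OF bounded_linear_inner_left])
  qed
qed simp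

lemma velocity_eq:
  assumes "smooth_map euclid_atlas A \<gamma>" "((\<lambda>t. coord (\<gamma> t)) has_vector_derivative v) (at t)"
  shows "velocity A \<gamma> t = tangent (coord (\<gamma> t)) v"
proof
  fix f
  show "velocity A \<gamma> t f = tangent (coord (\<gamma> t)) v f"
  proof (cases "f \<in> smooth_functions A")
    case True
    then have "smooth (\<lambda>x. f (E x))" by (simp add: smooth_functions_iff)
    from has_vector_derivative_fd[OF assms(2) this]
    have "((\<lambda>t. f (\<gamma> t)) has_real_derivative fd (\<lambda>x. f (E x)) (coord (\<gamma> t)) v) (at t)"
      by (simp add: has_real_derivative_iff_has_vector_derivative)
    then show ?thesis using True by (simp add: velocity_def tangent_def comp_def DERIV_imp_deriv)
  qed (simp add: velocity_def tangent_def)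
qed

lemma tangent_space_eq: "tangent_space A p = range (tangent (coord p))"
proof safe
  fix v assume "v \<in> tangent_space A p"
  then obtain \<gamma> where \<gamma>: "v = velocity A \<gamma> 0" "smooth_map euclid_atlas A \<gamma>" "\<gamma> 0 = p"
    by (auto simp: tangent_space_def)
  then have s: "smooth (\<lambda>t. coord (\<gamma> t))" by (simp add: smooth_map_into_iff)
  have "((\<lambda>t. coord (\<gamma> t)) has_vector_derivative fd (\<lambda>t. coord (\<gamma> t)) 0 1) (at 0)"
    using has_vector_derivative_fd[OF has_vector_derivative_id s] by simp
  then show "v \<in> range (tangent (coord p))" using velocity_eq[OF \<gamma>(2)] \<gamma> by auto
next
  fix v
  let ?\<gamma> = "\<lambda>t. E (coord p + t *\<^sub>R v)"
  have s: "smooth_map euclid_atlas A ?\<gamma>" by (auto simp: smooth_map_into_iff intro!: smooth_intros)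
  have "((\<lambda>t. coord (?\<gamma> t)) has_vector_derivative v) (at 0)"
    by (auto intro!: derivative_eq_intros)
  from velocity_eq[OF s this] have "tangent (coord p) v = velocity A ?\<gamma> 0" by simp
  then show "tangent (coord p) v \<in> tangent_space A p"
    using s unfolding tangent_space_def by (intro CollectI exI[of _ ?\<gamma>]) simp
qed

end

lemma linear_differential: "linear (differential B \<phi>)"
  by (rule linearI) (auto simp: differential_def fun_eq_iff scaleR_fun_def)

lemma differential_tangent:
  assumes "global_chart A E" "global_chart B E'" "smooth (\<lambda>x. inv_into UNIV E' (\<phi> (E x)))"
  shows "differential B \<phi> (global_chart.tangent A E y v)
    = global_chart.tangent B E' (inv_into UNIV E' (\<phi> (E y))) (fd (\<lambda>x. inv_into UNIV E' (\<phi> (E x))) y v)"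
proof
  fix f
  interpret S: global_chart A E by fact
  interpret T: global_chart B E' by fact
  show "differential B \<phi> (S.tangent y v) f = T.tangent (T.coord (\<phi> (E y))) (fd (\<lambda>x. T.coord (\<phi> (E x))) y v) f"
  proof (cases "f \<in> smooth_functions B")
    case True
    then have sf: "smooth (\<lambda>x. f (E' x))" by (simp add: T.smooth_functions_iff)
    have "f \<circ> \<phi> \<in> smooth_functions A"
      using smooth_compose[OF sf assms(3)] by (simp add: S.smooth_functions_iff)
    then show ?thesis
      using True fd_compose[OF sf assms(3), of y v] by (simp add: differential_def S.tangent_def T.tangent_def)
  qed (simp add: differential_def T.tangent_def)
qed

lemma smooth_map_coordinates:
  assumes "global_chart A E" "global_chart B E'" "smooth_map A B \<phi>"
  shows "smooth (\<lambda>x. inv_into UNIV E' (\<phi> (E x)))"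
proof -
  interpret S: global_chart A E by fact
  interpret T: global_chart B E' by fact
  have "smooth_map euclid_atlas B (\<phi> \<circ> E)"
    by (rule smooth_map_compose_topological[OF topological_atlas_euclid S.top_atlas T.top_atlas
          S.smooth_map_E assms(3)])
  then show ?thesis by (simp add: T.smooth_map_into_iff)
qed


section \<open>Lie groups with a global chart\<close>

lemma smooth_map_prod_mult_coordinates:
  assumes "global_chart A E" "smooth_map (prod_atlas A A) A (\<lambda>(x, y). f x y)"
  shows "smooth (\<lambda>z. inv_into UNIV E (f (E (fst z)) (E (snd z))))"
proof -
  interpret global_chart A E by fact
  note top = topological_atlasD[OF top_atlas]
  let ?EE = "\<lambda>z. (E (fst z), E (snd z))"
  have EE: "smooth_map euclid_atlas (prod_atlas A A) ?EE"
  proof -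
    have cont_E: "continuous_on UNIV E" using smooth_map_E by (simp add: smooth_map_def)
    have chart: "smooth_on (E -` U) (\<lambda>x. \<psi> (E x))" "open (E -` U)" if "(U, \<psi>) \<in> A" for U \<psi>
      using smooth_map_E that top(2)[OF that] cont_E
      by (auto simp: smooth_map_def euclid_atlas_def inv_ident comp_def open_vimage)
    have "smooth_on (?EE -` (U \<times> V)) (\<lambda>z. (\<psi> (E (fst z)), \<theta> (E (snd z))))"
      if "(U, \<psi>) \<in> A" "(V, \<theta>) \<in> A" for U \<psi> V \<theta>
    proof -
      have "?EE -` (U \<times> V) = (E -` U) \<times> (E -` V)" by auto
      then have o: "open (?EE -` (U \<times> V))" using chart(2) that by (simp add: open_Times)
      have f: "smooth_on (?EE -` (U \<times> V)) fst" and s: "smooth_on (?EE -` (U \<times> V)) snd"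
        using smooth_bounded_linear[OF bounded_linear_fst] smooth_bounded_linear[OF bounded_linear_snd]
          smooth_on_subset by blast+
      show ?thesis
        by (intro smooth_on_Pair o smooth_on_compose[OF o _ chart(1)[OF that(1)] f]
            smooth_on_compose[OF o _ chart(1)[OF that(2)] s]) auto
    qed
    moreover have "continuous_on UNIV ?EE"
      by (intro continuous_on_Pair continuous_on_compose2[OF cont_E] continuous_on_fst
          continuous_on_snd continuous_on_id) auto
    ultimately show ?thesis
      by (auto simp: smooth_map_def euclid_atlas_def prod_atlas_def inv_ident comp_def map_prod_def
          case_prod_beta)
  qed
  have "smooth_map euclid_atlas A ((\<lambda>(x, y). f x y) \<circ> ?EE)"
  proof (rule smooth_map_compose[OF topological_atlas_euclid _ _ _ top(2) EE assms(2)])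
    show "\<exists>V \<theta>. (V, \<theta>) \<in> prod_atlas A A \<and> q \<in> V" for q
    proof -
      obtain U \<psi> V \<theta> where "(U, \<psi>) \<in> A" "fst q \<in> U" "(V, \<theta>) \<in> A" "snd q \<in> V"
        using top(1)[of "fst q"] top(1)[of "snd q"] by blast
      then show ?thesis
        by (intro exI[of _ "U \<times> V"] exI[of _ "map_prod \<psi> \<theta>"]) (auto simp: prod_atlas_def mem_Times_iff)
    qed
    show "open V" if "(V, \<theta>) \<in> prod_atlas A A" for V \<theta>
      using that top(2) by (auto simp: prod_atlas_def intro: open_Times)
    show "inj_on \<theta> V" if "(V, \<theta>) \<in> prod_atlas A A" for V \<theta>
      using that top(3) by (auto simp: prod_atlas_def intro: map_prod_inj_on)
  qed
  then show ?thesis by (simp add: smooth_map_into_iff)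
qed

locale lie_group_chart =
  fixes G :: "('a::{t2_space,second_countable_topology}, 'e::euclidean_space, 'z) smooth_group_scheme"
    and E :: "'e \<Rightarrow> 'a"
  assumes lie_group: "lie_group G" and chart: "diffeomorphism euclid_atlas (charts G) E"

sublocale lie_group_chart \<subseteq> global_chart "charts G" E
  using lie_group chart by unfold_locales (auto simp: lie_group_def)

context lie_group_chart
begin

definition cmult :: "'e \<Rightarrow> 'e \<Rightarrow> 'e"
  where "cmult x y = coord (E x \<otimes>\<^bsub>G\<^esub> E y)"

definition cunit :: 'e
  where "cunit = coord \<one>\<^bsub>G\<^esub>"

definition cinv :: "'e \<Rightarrow> 'e"
  where "cinv x = coord (inv\<^bsub>G\<^esub> (E x))"

lemma group_G: "group G" and carrier_G [simp]: "x \<in> carrier G"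
  using lie_group by (auto simp: lie_group_def)

lemma E_cmult: "E (cmult x y) = E x \<otimes>\<^bsub>G\<^esub> E y" and E_cunit: "E cunit = \<one>\<^bsub>G\<^esub>"
  by (simp_all add: cmult_def cunit_def)

end

sublocale lie_group_chart \<subseteq> coordinate_lie_group cmult cunit cinv
proof
  interpret group G by (rule group_G)
  have gc: "global_chart (charts G) E" by unfold_locales
  show "smooth (\<lambda>z. cmult (fst z) (snd z))"
    unfolding cmult_def using lie_group
    by (intro smooth_map_prod_mult_coordinates[OF gc]) (auto simp: lie_group_def)
  show "smooth cinv"
    unfolding cinv_def[abs_def] using lie_group
    by (intro smooth_map_coordinates[OF gc gc]) (auto simp: lie_group_def)
  show "cmult (cmult x y) z = cmult x (cmult y z)" for x y z by (simp add: cmult_def m_assoc)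
  show "cmult cunit x = x" "cmult x cunit = x" "cmult (cinv x) x = cunit" "cmult x (cinv x) = cunit" for x
    by (simp_all add: cmult_def cunit_def cinv_def)
qed

context lie_group_chart
begin

lemma global_chart_G: "global_chart (charts G) E"
  by unfold_locales

lemma left_mult_coordinates: "coord (left_mult G (E a) (E y)) = cmult a y"
  by (simp add: left_mult_def cmult_def)

lemma differential_left_mult:
  "differential (charts G) (left_mult G (E a)) (tangent y v) = tangent (cmult a y) (dl a y v)"
  using differential_tangent[OF global_chart_G global_chart_G, of "left_mult G (E a)" y v]
  by (simp add: left_mult_coordinates smooth_left fd_left)

lemma lie_algebra_eq: "lie_algebra G = range (tangent cunit)"
  by (simp add: lie_algebra_def tangent_space_eq cunit_def)

lemma left_invariant_field_eq: "left_invariant_field G (tangent cunit v) (E y) = tangent y (lif y v)"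
  by (simp add: left_invariant_field_def differential_left_mult)

text \<open>Applying two fields in succession yields a second derivative of the test function plus a
  derivative of the coefficients; the second derivatives cancel by symmetry.\<close>

lemma lie_bracket_eq:
  "lie_bracket G (tangent cunit u) (tangent cunit v)
    = tangent cunit (fd (\<lambda>p. lif p v) cunit u - fd (\<lambda>p. lif p u) cunit v)"
proof
  fix f
  show "lie_bracket G (tangent cunit u) (tangent cunit v) f
    = tangent cunit (fd (\<lambda>p. lif p v) cunit u - fd (\<lambda>p. lif p u) cunit v) f"
  proof (cases "f \<in> smooth_functions (charts G)")
    case True
    let ?F = "\<lambda>x. f (E x)"
    have sF: "smooth ?F" using True by (simp add: smooth_functions_iff)
    let ?X = "\<lambda>v q. left_invariant_field G (tangent cunit v) q f"
    have X: "?X v (E y) = fd ?F y (lif y v)" for v y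
      using True unfolding left_invariant_field_eq by (simp add: tangent_def)
    have s: "smooth (\<lambda>y. fd ?F y (lif y v))" for v
      by (intro smooth_intros sF)
    then have Xs: "?X v \<in> smooth_functions (charts G)" for v
      by (simp add: smooth_functions_iff X)
    have "left_invariant_field G (tangent cunit u) \<one>\<^bsub>G\<^esub> (?X v)
        = fd (\<lambda>y. fd ?F y v) cunit u + fd ?F cunit (fd (\<lambda>p. lif p v) cunit u)" for u v
    proof -
      have "left_invariant_field G (tangent cunit u) \<one>\<^bsub>G\<^esub> (?X v) = fd (\<lambda>y. fd ?F y (lif y v)) cunit u"
        using left_invariant_field_eq[of u cunit, unfolded E_cunit] Xs
        by (simp only: dl_unit) (simp add: X tangent_def[of cunit u])
      also have "\<dots> = fd (\<lambda>y. fd ?F y v) cunit u + fd ?F cunit (fd (\<lambda>p. lif p v) cunit u)"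
      proof (rule fd_eq_vector_derivative[OF s])
        have c: "((\<lambda>t. cunit + t *\<^sub>R u) has_vector_derivative u) (at 0)"
          by (auto intro!: derivative_eq_intros)
        have sl: "smooth (\<lambda>p. lif p v)" by (intro smooth_intros)
        show "((\<lambda>t. fd ?F (cunit + t *\<^sub>R u) (lif (cunit + t *\<^sub>R u) v)) has_vector_derivative
            fd (\<lambda>y. fd ?F y v) cunit u + fd ?F cunit (fd (\<lambda>p. lif p v) cunit u)) (at 0)"
          using has_vector_derivative_fd2[OF sF c has_vector_derivative_fd[OF c sl]] by simp
      qed
      finally show ?thesis .
    qed
    then show ?thesis
      using True fd_fd_commute[OF sF, of v cunit u]
      by (simp add: lie_bracket_def vf_bracket_def tangent_def fd_diff[OF sF])
  qed (simp add: lie_bracket_def vf_bracket_def tangent_def)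
qed

definition generates :: "(real \<Rightarrow> 'a) \<Rightarrow> 'a tangent \<Rightarrow> bool"
  where "generates \<gamma> \<xi> \<longleftrightarrow> one_parameter_subgroup G \<gamma> \<and> velocity (charts G) \<gamma> 0 = \<xi>"

lemma generates_iff:
  "generates \<gamma> (tangent cunit v) \<longleftrightarrow> smooth (\<lambda>t. coord (\<gamma> t)) \<and>
    ((\<lambda>t. coord (\<gamma> t)) has_vector_derivative v) (at 0) \<and>
    (\<forall>s t. coord (\<gamma> (s + t)) = cmult (coord (\<gamma> s)) (coord (\<gamma> t)))"
proof -
  have hom: "(\<forall>s t. \<gamma> (s + t) = \<gamma> s \<otimes>\<^bsub>G\<^esub> \<gamma> t) \<longleftrightarrow>
      (\<forall>s t. coord (\<gamma> (s + t)) = cmult (coord (\<gamma> s)) (coord (\<gamma> t)))"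
    by (metis E_coord E_cmult coord_E)
  have "velocity (charts G) \<gamma> 0 = tangent cunit v \<longleftrightarrow> ((\<lambda>t. coord (\<gamma> t)) has_vector_derivative v) (at 0)"
    if s: "smooth_map euclid_atlas (charts G) \<gamma>" and h: "\<forall>s t. coord (\<gamma> (s + t)) = cmult (coord (\<gamma> s)) (coord (\<gamma> t))"
  proof -
    have 0: "coord (\<gamma> 0) = cunit"
      using h by (metis add.right_neutral inv_cancel_left(1) inv_left)
    have sm: "smooth (\<lambda>t. coord (\<gamma> t))" using s by (simp add: smooth_map_into_iff)
    define w where "w = fd (\<lambda>t. coord (\<gamma> t)) 0 1"
    have w: "((\<lambda>t. coord (\<gamma> t)) has_vector_derivative w) (at 0)"
      using has_vector_derivative_fd[OF has_vector_derivative_id sm] by (simp add: w_def)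
    have "velocity (charts G) \<gamma> 0 = tangent cunit w"
      using velocity_eq[OF s w] 0 by simp
    then show ?thesis using w vector_derivative_unique_at by auto
  qed
  then show ?thesis
    unfolding generates_def one_parameter_subgroup_def hom smooth_map_into_iff by blast
qed

lemma generates_unique:
  assumes "generates \<gamma> (tangent cunit v)" "generates \<gamma>' (tangent cunit v)"
  shows "\<gamma> = \<gamma>'"
proof
  fix t
  have "coord (\<gamma> t) = coord (\<gamma>' t)"
    by (rule one_parameter_unique[of "\<lambda>t. coord (\<gamma> t)" v "\<lambda>t. coord (\<gamma>' t)"])
      (use assms generates_iff in blast)+
  then show "\<gamma> t = \<gamma>' t" by (metis E_coord)
qed

lemma generates_scale:
  assumes "generates \<gamma> (tangent cunit v)"
  shows "generates (\<lambda>t. \<gamma> (c * t)) (tangent cunit (c *\<^sub>R v))"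
proof -
  have g: "smooth (\<lambda>t. coord (\<gamma> t))" "((\<lambda>t. coord (\<gamma> t)) has_vector_derivative v) (at 0)"
    "\<And>s t. coord (\<gamma> (s + t)) = cmult (coord (\<gamma> s)) (coord (\<gamma> t))"
    using assms by (auto simp: generates_iff)
  have "((\<lambda>t. c * t) has_derivative (\<lambda>h. c * h)) (at 0)"
    by (auto intro!: derivative_eq_intros)
  from has_derivative_compose[OF this, of "\<lambda>t. coord (\<gamma> t)" "\<lambda>t. t *\<^sub>R v"] g(2)
  have "((\<lambda>t. coord (\<gamma> (c * t))) has_vector_derivative c *\<^sub>R v) (at 0)"
    by (simp add: has_vector_derivative_def mult.commute)
  moreover have "smooth (\<lambda>t. coord (\<gamma> (c * t)))"
    by (rule smooth_compose[OF g(1)]) (intro smooth_intros)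
  ultimately show ?thesis by (simp add: generates_iff g(3) distrib_left)
qed

lemma lie_exp_eqI: "generates \<gamma> (tangent cunit v) \<Longrightarrow> lie_exp G (tangent cunit v) = \<gamma> 1"
  unfolding lie_exp_def
  by (rule the_equality) (use generates_unique in \<open>auto simp: generates_def\<close>)

text \<open>Instead of solving a differential equation: a vector without one-parameter subgroup would
  have the junk value \<open>THE g. False\<close> as its exponential, and so would its double.\<close>

lemma generates_exists:
  assumes "inj_on (lie_exp G) (lie_algebra G)"
  shows "\<exists>\<gamma>. generates \<gamma> (tangent cunit v)"
proof (rule ccontr)
  assume none: "\<nexists>\<gamma>. generates \<gamma> (tangent cunit v)"
  have "generates (\<lambda>t. E cunit) (tangent cunit 0)"
    by (simp add: generates_iff smooth_const)
  then have "v \<noteq> 0" using none by blast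
  have none2: "\<nexists>\<gamma>. generates \<gamma> (tangent cunit (2 *\<^sub>R v))"
  proof
    assume "\<exists>\<gamma>. generates \<gamma> (tangent cunit (2 *\<^sub>R v))"
    then obtain \<gamma> where "generates \<gamma> (tangent cunit (2 *\<^sub>R v))" by blast
    from generates_scale[OF this, of "1 / 2"] show False using none by auto
  qed
  have junk: "lie_exp G \<xi> = (THE g. False)" if "\<nexists>\<gamma>. generates \<gamma> \<xi>" for \<xi>
    using that unfolding lie_exp_def generates_def by (intro arg_cong[where f = The]) auto
  have "lie_exp G (tangent cunit v) = lie_exp G (tangent cunit (2 *\<^sub>R v))"
    using junk none none2 by metis
  then have "v = 2 *\<^sub>R v"
    using inj_onD[OF assms, of "tangent cunit v" "tangent cunit (2 *\<^sub>R v)"] by (auto simp: lie_algebra_eq)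
  then show False using \<open>v \<noteq> 0\<close> by (simp add: scaleR_2)
qed

end

locale exponential_chart = lie_group_chart +
  assumes cunit_zero [simp]: "cunit = 0"
    and cmult_scaleR: "cmult (s *\<^sub>R x) (t *\<^sub>R x) = (s + t) *\<^sub>R x"
    and lie_exp_tangent: "lie_exp G (tangent cunit x) = E x"

text \<open>The chart is the exponential map composed with the linear isomorphism given by
  \<open>exp_diffeomorphism\<close>. By scaling, each ray is the one-parameter subgroup of its
  vector.\<close>

lemma exponential_chart_exists:
  fixes G :: "('a::{t2_space,second_countable_topology}, 'e::euclidean_space, 'z) smooth_group_scheme"
  assumes "lie_group G" "exp_diffeomorphism G"
  shows "\<exists>E. exponential_chart G E"
proof -
  obtain \<beta> :: "'e \<Rightarrow> 'a tangent" where \<beta>: "linear \<beta>" "bij_betw \<beta> UNIV (lie_algebra G)"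
    "diffeomorphism euclid_atlas (charts G) (lie_exp G \<circ> \<beta>)"
    using assms(2) by (auto simp: exp_diffeomorphism_def)
  let ?E = "lie_exp G \<circ> \<beta>"
  interpret lie_group_chart G ?E by unfold_locales (rule assms(1) \<beta>(3))+
  have inj: "inj_on (lie_exp G) (lie_algebra G)"
  proof (rule inj_onI)
    fix \<xi> \<eta> assume a: "\<xi> \<in> lie_algebra G" "\<eta> \<in> lie_algebra G" "lie_exp G \<xi> = lie_exp G \<eta>"
    then obtain x y where "\<xi> = \<beta> x" "\<eta> = \<beta> y" using \<beta>(2) unfolding bij_betw_def by blast
    then show "\<xi> = \<eta>" using a(3) E_eq_iff[of x y] by simp
  qed
  have ray: "generates (\<lambda>t. ?E (t *\<^sub>R x)) (\<beta> x)" for x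
  proof -
    obtain v where v: "\<beta> x = tangent cunit v"
      using \<beta>(2) unfolding bij_betw_def lie_algebra_eq by blast
    obtain \<gamma> where \<gamma>: "generates \<gamma> (tangent cunit v)" using generates_exists[OF inj] by blast
    have "?E (t *\<^sub>R x) = \<gamma> t" for t
    proof -
      have "\<beta> (t *\<^sub>R x) = tangent cunit (t *\<^sub>R v)"
        by (simp add: linear_cmul[OF \<beta>(1)] linear_cmul[OF linear_tangent] v)
      then show ?thesis using lie_exp_eqI[OF generates_scale[OF \<gamma>, of t]] by simp
    qed
    then show ?thesis using \<gamma> v by presburger
  qed
  \<comment> \<open>The image of \<open>0\<close> is idempotent in the group, so \<open>0\<close> is
    the coordinate of the unit.\<close>
  have unit: "cunit = 0"
  proof -
    have "?E ((0 + 0) *\<^sub>R 0) = ?E (0 *\<^sub>R 0) \<otimes>\<^bsub>G\<^esub> ?E (0 *\<^sub>R 0)"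
      using ray[of 0] unfolding generates_def one_parameter_subgroup_def by blast
    then have "?E 0 \<otimes>\<^bsub>G\<^esub> ?E 0 = ?E 0" unfolding scaleR_zero_right by (rule sym)
    then have "cmult 0 0 = 0" unfolding cmult_def by (simp only: coord_E)
    then show ?thesis by (metis inv_cancel_left(1) inv_left)
  qed
  \<comment> \<open>The ray of \<open>x\<close> has velocity \<open>\<beta> x\<close>, and in its
    own chart velocity \<open>x\<close>; so \<beta> is the coordinate frame at the unit.\<close>
  have \<beta>_eq: "\<beta> x = tangent cunit x" for x
  proof -
    obtain v where v: "\<beta> x = tangent cunit v"
      using \<beta>(2) unfolding bij_betw_def lie_algebra_eq by blast
    have "((\<lambda>t. coord (?E (t *\<^sub>R x))) has_vector_derivative v) (at 0)"
      using ray[of x] unfolding v generates_iff by blast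
    then have "((\<lambda>t. t *\<^sub>R x) has_vector_derivative v) (at 0)" unfolding coord_E .
    moreover have "((\<lambda>t. t *\<^sub>R x) has_vector_derivative x) (at 0)"
      by (auto intro!: derivative_eq_intros)
    ultimately have "v = x" using vector_derivative_unique_at by blast
    then show ?thesis using v by simp
  qed
  have "exponential_chart G ?E"
  proof
    show "cunit = 0" by (rule unit)
    show "cmult (s *\<^sub>R x) (t *\<^sub>R x) = (s + t) *\<^sub>R x" for s t x
      using subst[OF \<beta>_eq, of "generates (\<lambda>t. ?E (t *\<^sub>R x))" x, OF ray]
      unfolding generates_iff coord_E by metis
    show "lie_exp G (tangent cunit x) = ?E x" for x
      using arg_cong[OF \<beta>_eq[of x], of "lie_exp G"] by (simp only: comp_apply)
  qed
  then show ?thesis by blast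
qed


section \<open>Graded Lie groups in exponential coordinates\<close>

lemma linear_image_coset:
  fixes F :: "'v::real_vector \<Rightarrow> 'w::real_vector"
  assumes "linear F" "F ` H \<subseteq> H'" "subspace H" "subspace H'"
  shows "F ` (x +o H) + H' = F x +o H'"
proof safe
  fix y assume "y \<in> F ` (x +o H) + H'"
  then obtain h h' where h: "h \<in> H" "h' \<in> H'" "y = F (x + h) + h'"
    by (auto simp: elt_set_plus_def elim!: set_plus_elim)
  then have "F h + h' \<in> H'" using assms by (blast intro: subspace_add)
  then show "y \<in> F x +o H'"
    using h by (auto simp: elt_set_plus_def linear_add[OF assms(1)] add.assoc)
next
  fix y assume "y \<in> F x +o H'"
  then obtain h' where h: "h' \<in> H'" "y = F x + h'" by (auto simp: elt_set_plus_def)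
  have "x + 0 \<in> x +o H" using subspace_0[OF assms(3)] by (rule set_plus_intro2)
  then show "y \<in> F ` (x +o H) + H'" using h by (auto intro!: set_plus_intro)
qed

lemma coset_eq_iff:
  fixes H :: "'v::real_vector set"
  assumes "subspace H"
  shows "x +o H = y +o H \<longleftrightarrow> x - y \<in> H"
proof
  assume "x +o H = y +o H"
  moreover have "x + 0 \<in> x +o H" using subspace_0[OF assms] by (rule set_plus_intro2)
  ultimately show "x - y \<in> H" by (auto simp: elt_set_plus_def)
next
  assume d: "x - y \<in> H"
  have "u +o H \<subseteq> v +o H" if "u - v \<in> H" for u v
  proof
    fix z assume "z \<in> u +o H"
    then obtain h where "h \<in> H" "z = u + h" by (auto simp: elt_set_plus_def)
    then show "z \<in> v +o H"
      using subspace_add[OF assms that] by (auto simp: elt_set_plus_def intro!: bexI[of _ "u - v + h"])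
  qed
  moreover have "y - x \<in> H" using subspace_neg[OF assms d] by simp
  ultimately show "x +o H = y +o H" using d by blast
qed

locale graded_chart = exponential_chart G E
  for G :: "('a::{t2_space,second_countable_topology}, 'e::euclidean_space) graded_group"
    and E :: "'e \<Rightarrow> 'a" +
  fixes r :: nat
  assumes graded: "graded_lie_algebra r G"

sublocale graded_chart \<subseteq> X: exponential_lie_group cmult
  by unfold_locales (rule smooth_m assoc cmult_scaleR)+

context graded_chart
begin

lemma layers: "direct_sum r (layer G) (lie_algebra G)"
  using graded by (simp add: graded_lie_algebra_def)

lemma lie_algebra_range: "lie_algebra G = range (tangent 0)"
  by (simp add: lie_algebra_eq)

lemma tangent_in_lie_algebra [simp]: "tangent 0 x \<in> lie_algebra G"
  by (simp add: lie_algebra_range)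

text \<open>The value \<open>0\<close> outside \<open>{1..r}\<close> is set by hand, because
  \<open>component\<close> is \<open>undefined\<close> there and linearity would fail.\<close>

definition pr :: "nat \<Rightarrow> 'e \<Rightarrow> 'e"
  where "pr w x = (if w \<in> {1..r} then inv_into UNIV (tangent 0) (component r (layer G) w (tangent 0 x)) else 0)"

lemma pr_undefined: "w \<notin> {1..r} \<Longrightarrow> pr w x = 0"
  by (simp only: pr_def if_False)

lemma tangent_pr:
  assumes "w \<in> {1..r}" shows "tangent 0 (pr w x) = component r (layer G) w (tangent 0 x)"
proof -
  have "component r (layer G) w (tangent 0 x) \<in> lie_algebra G"
    by (rule layer_subset_and_component(1)[OF layers
          direct_sumD(2)[OF layers tangent_in_lie_algebra assms] assms])
  then show ?thesis using assms unfolding pr_def lie_algebra_range by (simp only: if_True f_inv_into_f)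
qed

lemma tangent_pr_in_layer: "w \<in> {1..r} \<Longrightarrow> tangent 0 (pr w x) \<in> layer G w"
  using direct_sumD(2)[OF layers tangent_in_lie_algebra] by (simp add: tangent_pr)

lemma pr_tangent_layer:
  assumes "tangent 0 x \<in> layer G u" "u \<in> {1..r}" "w \<noteq> u"
  shows "pr w x = 0"
proof (cases "w \<in> {1..r}")
  case True
  have "tangent 0 (pr w x) = tangent 0 0"
    using layer_subset_and_component(2)[OF layers assms(1,2) True] assms(3)
    by (simp add: tangent_pr[OF True] linear_0[OF linear_tangent])
  then show ?thesis by (simp only: tangent_inject)
qed (rule pr_undefined)

lemma pr_linear: "linear (pr w)"
proof (cases "w \<in> {1..r}")
  case True
  show ?thesis
  proof (rule linearI)
    fix x y c
    have "tangent 0 (pr w (x + y)) = tangent 0 (pr w x + pr w y)"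
      by (simp only: tangent_pr[OF True] linear_add[OF linear_tangent] component_add[OF layers]
          tangent_in_lie_algebra True)
    then show "pr w (x + y) = pr w x + pr w y" by (simp only: tangent_inject)
    have "tangent 0 (pr w (c *\<^sub>R x)) = tangent 0 (c *\<^sub>R pr w x)"
      by (simp only: tangent_pr[OF True] linear_cmul[OF linear_tangent] component_scaleR[OF layers]
          tangent_in_lie_algebra True)
    then show "pr w (c *\<^sub>R x) = c *\<^sub>R pr w x" by (simp only: tangent_inject)
  qed
next
  case False
  then have "pr w = (\<lambda>x. 0)" using pr_undefined by blast
  then show ?thesis by (simp only: linear_zero)
qed

lemma pr_bracket_zero:
  assumes "k \<noteq> i + j"
  shows "pr k (X.bracket (pr i x) (pr j y)) = 0"
proof (cases "i \<in> {1..r} \<and> j \<in> {1..r}")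
  case True
  have b: "lie_bracket G (tangent 0 u) (tangent 0 v) = tangent 0 (X.bracket u v)" for u v
    using lie_bracket_eq[of u v] by (simp add: X.bracket_def)
  show ?thesis
  proof (cases "i + j \<le> r")
    case le: True
    then have "tangent 0 (X.bracket (pr i x) (pr j y)) \<in> layer G (i + j)"
      using graded True tangent_pr_in_layer[of i x] tangent_pr_in_layer[of j y]
      unfolding graded_lie_algebra_def b[symmetric] by blast
    then show ?thesis by (rule pr_tangent_layer) (use True le assms in auto)
  next
    case False
    then have "lie_bracket G (tangent 0 (pr i x)) (tangent 0 (pr j y)) = 0"
      using graded True tangent_pr_in_layer[of i x] tangent_pr_in_layer[of j y]
      unfolding graded_lie_algebra_def not_le by blast
    then have 0: "tangent 0 (X.bracket (pr i x) (pr j y)) = 0" unfolding b .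
    have "0 \<in> layer G i" using direct_sumD(1)[OF layers, of i] True subspace_0 by blast
    then have "tangent 0 (X.bracket (pr i x) (pr j y)) \<in> layer G i"
      "tangent 0 (X.bracket (pr i x) (pr j y)) = tangent 0 0"
      unfolding 0 by (simp_all only: linear_0[OF linear_tangent])
    then have "X.bracket (pr i x) (pr j y) = 0" by (simp only: tangent_inject)
    then show ?thesis by (simp only: linear_0[OF pr_linear])
  qed
next
  case False
  then have "X.bracket (pr i x) (pr j y) = 0"
    using linear_0[OF X.linear_bracket_left] linear_0[OF X.linear_bracket_right] pr_undefined by metis
  then show ?thesis by (simp only: linear_0[OF pr_linear])
qed

end

sublocale graded_chart \<subseteq> X: graded_exponential_group cmult r pr
proof
  show "pr w (pr w' x) = (if w = w' then pr w x else 0)" for w w' x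
  proof (cases "w' \<in> {1..r}")
    case True
    have "pr w (pr w x) = pr w x" if "w \<in> {1..r}"
    proof -
      have "tangent 0 (pr w (pr w x)) = tangent 0 (pr w x)"
        using layer_subset_and_component(2)[OF layers tangent_pr_in_layer[OF that] that that]
        by (simp add: tangent_pr[OF that, of "pr w x"])
      then show ?thesis by (simp only: tangent_inject)
    qed
    then show ?thesis
      using pr_tangent_layer[OF tangent_pr_in_layer[OF True] True] True by auto
  next
    case False
    then have "pr w' x = 0" by (rule pr_undefined)
    then show ?thesis using linear_0[OF pr_linear] by simp
  qed
  show "(\<Sum>w=1..r. pr w x) = x" for x
  proof -
    have "tangent 0 (\<Sum>w=1..r. pr w x) = (\<Sum>w=1..r. component r (layer G) w (tangent 0 x))"
      unfolding linear_sum[OF linear_tangent] by (rule sum.cong) (simp_all only: tangent_pr)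
    then have "tangent 0 (\<Sum>w=1..r. pr w x) = tangent 0 x"
      unfolding direct_sumD(3)[OF layers tangent_in_lie_algebra] .
    then show ?thesis by (simp only: tangent_inject)
  qed
qed (simp_all add: pr_bracket_zero linear_add[OF pr_linear] linear_cmul[OF pr_linear])

context graded_chart
begin

lemma inj_lie_exp: "inj_on (lie_exp G) (lie_algebra G)"
proof (rule inj_onI)
  fix \<xi> \<eta> assume "\<xi> \<in> lie_algebra G" "\<eta> \<in> lie_algebra G" and eq: "lie_exp G \<xi> = lie_exp G \<eta>"
  then obtain x y where "\<xi> = tangent 0 x" "\<eta> = tangent 0 y" unfolding lie_algebra_range by blast
  then show "\<xi> = \<eta>" using eq lie_exp_tangent by simp
qed

lemma dilation_E: "dilation r G t (E x) = E (X.dil t x)"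
proof -
  have "inv_into (lie_algebra G) (lie_exp G) (E x) = tangent 0 x"
    using inv_into_f_f[OF inj_lie_exp tangent_in_lie_algebra[of x]] lie_exp_tangent[of x] by simp
  moreover have "algebra_dilation r G t (tangent 0 x) = tangent 0 (X.dil t x)"
    unfolding algebra_dilation_def X.dil_def linear_sum[OF linear_tangent]
    by (rule sum.cong) (simp_all only: linear_cmul[OF linear_tangent] tangent_pr)
  ultimately show ?thesis using lie_exp_tangent[of "X.dil t x"] by (simp add: dilation_def)
qed

lemma inv_dilation_E:
  assumes "t \<noteq> 0"
  shows "inv_into UNIV (dilation r G t) (E y) = E (X.dil (inverse t) y)"
proof (rule inv_f_eq)
  show "inj (dilation r G t)"
  proof (rule injI)
    fix p q assume "dilation r G t p = dilation r G t q"
    then have "X.dil t (coord p) = X.dil t (coord q)"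
      using dilation_E[of t "coord p"] dilation_E[of t "coord q"] by simp
    then have "X.dil (inverse t) (X.dil t (coord p)) = X.dil (inverse t) (X.dil t (coord q))" by simp
    then show "p = q" using assms by (simp add: X.dil_dil) (metis E_coord)
  qed
  show "dilation r G t (E (X.dil (inverse t) y)) = E y"
    using assms by (simp add: dilation_E X.dil_dil)
qed

text \<open>The left-invariant frame: in it the layers and the filtration have the same description
  at every point.\<close>

definition frame :: "'e \<Rightarrow> 'e \<Rightarrow> 'a tangent"
  where "frame a v = tangent a (X.lif a v)"

lemma frame_eq: "frame a v = differential (charts G) (left_mult G (E a)) (tangent 0 v)"
  using differential_left_mult[of a 0 v] by (simp add: frame_def)

lemma frame_inject [simp]: "frame a u = frame a v \<longleftrightarrow> u = v"
  by (simp add: frame_def X.lif_inject)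

lemma linear_frame: "linear (frame a)"
  using linear_compose[OF X.linear_dl linear_tangent] by (simp add: frame_def[abs_def] comp_def)

lemma inj_left: "inj_on (differential (charts G) (left_mult G (E a))) (lie_algebra G)"
  unfolding lie_algebra_range inj_on_def
  by (auto simp flip: frame_eq)

lemma frame_image: "differential (charts G) (left_mult G (E a)) ` lie_algebra G = range (frame a)"
  unfolding lie_algebra_range by (simp add: image_image flip: frame_eq)

lemma tangent_space_frame: "tangent_space (charts G) (E a) = range (frame a)"
proof -
  have "range (frame a) = tangent a ` range (X.lif a)" by (auto simp: frame_def[abs_def])
  moreover have "range (X.lif a) = UNIV" by (metis X.lif_dl_inv surjI)
  ultimately show ?thesis by (simp add: tangent_space_eq)
qed

lemma carnot_layers: "direct_sum r (\<lambda>w. carnot_layer G w (E a)) (range (frame a))"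
  using direct_sum_image(1)[OF layers linear_differential inj_left, of a]
  by (simp add: carnot_layer_def frame_image)

lemma component_frame:
  "w \<in> {1..r} \<Longrightarrow> component r (\<lambda>w. carnot_layer G w (E a)) w (frame a v) = frame a (pr w v)"
  using direct_sum_image(2)[OF layers linear_differential inj_left tangent_in_lie_algebra, of w a v]
  unfolding carnot_layer_def frame_eq by (simp only: tangent_pr)

lemma frame_in_filtration_iff:
  assumes "w \<le> r"
  shows "frame a v \<in> filtration G w (E a) \<longleftrightarrow> (\<forall>i\<in>{1..r}. w < i \<longrightarrow> pr i v = 0)"
proof -
  have "frame a (pr i v) = 0 \<longleftrightarrow> pr i v = 0" for i
    by (metis frame_inject linear_0[OF linear_frame])
  then show ?thesis
    unfolding filtration_def sum_layers_iff[OF carnot_layers assms] by (simp add: component_frame)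
qed

lemma filtration_subspace: "w \<le> r \<Longrightarrow> subspace (filtration G w (E a))"
  unfolding filtration_def by (rule subspace_sum_layers[OF carnot_layers])

lemma filtration_subset: "w \<le> r \<Longrightarrow> filtration G w (E a) \<subseteq> range (frame a)"
  unfolding filtration_def using sum_layers_iff[OF carnot_layers] by blast

definition gr_frame :: "'e \<Rightarrow> 'e \<Rightarrow> nat \<Rightarrow> 'a tangent set"
  where "gr_frame a v = gr_of_tangent r G (E a) (frame a v)"

lemma gr_frame_eq: "gr_frame a v = (\<lambda>w\<in>{1..r}. gr_class G (E a) w (frame a (pr w v)))"
  unfolding gr_frame_def gr_of_tangent_def by (rule restrict_ext) (simp only: component_frame)

lemma gr_class_frame_eq_iff:
  assumes "w \<in> {1..r}"
  shows "gr_class G (E a) w (frame a u) = gr_class G (E a) w (frame a v)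
    \<longleftrightarrow> (\<forall>i\<in>{1..r}. w \<le> i \<longrightarrow> pr i u = pr i v)"
proof -
  \<comment> \<open>Passing to the quotient by step \<open>w - 1\<close> forgets the components
    below \<open>w\<close>; the subtraction is exact because \<open>w\<close> is at least
    \<open>1\<close>.\<close>
  have w: "w - 1 \<le> r" "\<And>i. w - 1 < i \<longleftrightarrow> w \<le> i" using assms by auto
  show ?thesis
    unfolding gr_class_def coset_eq_iff[OF filtration_subspace[OF w(1)]]
      linear_diff[OF linear_frame, symmetric] frame_in_filtration_iff[OF w(1)] w(2)
    by (simp add: linear_diff[OF X.linear_pr])
qed

lemma gr_frame_inject: "gr_frame a u = gr_frame a v \<longleftrightarrow> u = v"
proof
  assume eq: "gr_frame a u = gr_frame a v"
  show "u = v"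
  proof (rule X.pr_eqI)
    fix w assume w: "w \<in> {1..r}"
    have "gr_class G (E a) w (frame a (pr w u)) = gr_class G (E a) w (frame a (pr w v))"
      using fun_cong[OF eq, of w] w unfolding gr_frame_eq by simp
    then have "pr w (pr w u) = pr w (pr w v)" using w unfolding gr_class_frame_eq_iff[OF w] by blast
    then show "pr w u = pr w v" by simp
  qed
qed simp

lemma gr_space_eq: "gr_space r G (E a) = range (gr_frame a)"
proof safe
  fix \<Xi> assume "\<Xi> \<in> gr_space r G (E a)"
  then have \<Xi>: "\<Xi> \<in> (\<Pi>\<^sub>E w\<in>{1..r}. gr_class G (E a) w ` filtration G w (E a))"
    by (simp only: gr_space_def)
  have "\<forall>w\<in>{1..r}. \<exists>v. frame a v \<in> filtration G w (E a) \<and> \<Xi> w = gr_class G (E a) w (frame a v)"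
  proof
    fix w assume w: "w \<in> {1..r}"
    obtain \<xi> where "\<xi> \<in> filtration G w (E a)" "\<Xi> w = gr_class G (E a) w \<xi>"
      using PiE_mem[OF \<Xi> w] by (elim imageE) auto
    then show "\<exists>v. frame a v \<in> filtration G w (E a) \<and> \<Xi> w = gr_class G (E a) w (frame a v)"
      using filtration_subset[of w a] w by fastforce
  qed
  from bchoice[OF this] obtain f where
    f: "\<forall>w\<in>{1..r}. frame a (f w) \<in> filtration G w (E a) \<and> \<Xi> w = gr_class G (E a) w (frame a (f w))"
    by (rule exE)
  \<comment> \<open>The representative \<open>f w\<close> lies in step \<open>w\<close> of the
    filtration, so only its component of weight \<open>w\<close> matters for its class; these
    components are assembled into one vector.\<close>
  define v where "v = (\<Sum>w=1..r. pr w (f w))"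
  have pr_v: "pr w v = pr w (f w)" if "w \<in> {1..r}" for w
  proof -
    have "pr w v = (\<Sum>u=1..r. if u = w then pr w (f w) else 0)"
      unfolding v_def linear_sum[OF X.linear_pr] by (rule sum.cong) (auto simp: X.pr_pr)
    then show ?thesis using that by simp
  qed
  have "\<Xi> = gr_frame a v"
  proof
    fix w
    show "\<Xi> w = gr_frame a v w"
    proof (cases "w \<in> {1..r}")
      case True
      have "pr i (f w) = pr i (pr w v)" if "i \<in> {1..r}" "w \<le> i" for i
        using bspec[OF f True] frame_in_filtration_iff[of w a "f w"] True that
        by (cases "i = w") (auto simp: X.pr_pr pr_v)
      then have "gr_class G (E a) w (frame a (f w)) = gr_class G (E a) w (frame a (pr w v))"
        unfolding gr_class_frame_eq_iff[OF True] by blast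
      then show ?thesis using f True unfolding gr_frame_eq by simp
    next
      case False
      then show ?thesis by (simp only: PiE_arb[OF \<Xi> False] gr_frame_eq restrict_def if_False)
    qed
  qed
  then show "\<Xi> \<in> range (gr_frame a)" by blast
next
  fix v
  have "frame a (pr w v) \<in> filtration G w (E a)" if "w \<in> {1..r}" for w
    using that frame_in_filtration_iff[of w a "pr w v"] by (auto simp: X.pr_pr)
  then show "gr_frame a v \<in> gr_space r G (E a)"
    unfolding gr_frame_eq gr_space_def by (intro restrict_PiE_iff[THEN iffD2] ballI imageI)
qed

lemma carrier_tangent_group: "carrier (tangent_group r G (E a)) = range (gr_frame a)"
  by (simp add: tangent_group_def gr_space_eq)

text \<open>In frame coordinates the identification with the tangent space and the inverse left
  translation both act as the identity, which leaves the exponential chart.\<close>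

lemma Lambda_gr_frame: "Lambda r G (E a) (gr_frame a v) = E v"
proof -
  have "inj_on (gr_of_tangent r G (E a)) (range (frame a))"
    by (auto simp: inj_on_def gr_frame_inject simp flip: gr_frame_def)
  then have "tangent_of_gr r G (E a) (gr_frame a v) = frame a v"
    unfolding tangent_of_gr_def tangent_space_frame gr_frame_def by (rule inv_into_f_f) simp
  moreover have "inv_into (lie_algebra G) (differential (charts G) (left_mult G (E a))) (frame a v) = tangent 0 v"
    unfolding frame_eq by (rule inv_into_f_f[OF inj_left]) simp
  ultimately show ?thesis using lie_exp_tangent[of v] by (simp add: Lambda_def)
qed

lemma inv_Lambda: "inv_into (carrier (tangent_group r G (E a))) (Lambda r G (E a)) (E v) = gr_frame a v"
proof -
  have "inj_on (Lambda r G (E a)) (carrier (tangent_group r G (E a)))"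
    by (auto simp: carrier_tangent_group inj_on_def Lambda_gr_frame)
  from inv_into_f_f[OF this, of "gr_frame a v"]
  show ?thesis by (simp add: carrier_tangent_group Lambda_gr_frame)
qed

end

section \<open>The Pansu derivative of a Carnot map\<close>

locale carnot_map_charts = S: graded_chart G E r + T: graded_chart G' E' r
  for G :: "('a::{t2_space,second_countable_topology}, 'e::euclidean_space) graded_group"
    and E :: "'e \<Rightarrow> 'a" and r
    and G' :: "('b::{t2_space,second_countable_topology}, 'f::euclidean_space) graded_group"
    and E' :: "'f \<Rightarrow> 'b" +
  fixes \<phi> :: "'a \<Rightarrow> 'b"
  assumes carnot: "carnot_map r G G' \<phi>"
begin

definition \<psi> :: "'e \<Rightarrow> 'f"
  where "\<psi> x = T.coord (\<phi> (E x))"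

lemma E_\<psi>: "E' (\<psi> x) = \<phi> (E x)"
  by (simp add: \<psi>_def)

lemma smooth_coordinates: "smooth \<psi>"
  unfolding \<psi>_def[abs_def]
  using smooth_map_coordinates[OF S.global_chart_G T.global_chart_G] carnot
  by (simp add: carnot_map_def)

lemma differential_frame:
  "differential (charts G') \<phi> (S.frame a v)
    = T.frame (\<psi> a) (T.X.dl (- \<psi> a) (\<psi> a) (fd \<psi> a (S.X.lif a v)))"
  using differential_tangent[OF S.global_chart_G T.global_chart_G, of \<phi> a "S.X.lif a v"] smooth_coordinates
  by (simp add: S.frame_def T.frame_def \<psi>_def[abs_def])

text \<open>The Carnot condition read in frames: a vector of weight \<open>i\<close> lies in step
  \<open>i\<close> of the filtration, so its image does too and has no component of weight
  \<open>w > i\<close>.\<close>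

sublocale coordinate_carnot_map S.cmult r S.pr T.cmult T.pr \<psi>
proof
  show "smooth \<psi>" by (rule smooth_coordinates)
  fix i w :: nat and x v assume "i < w"
  let ?u = "T.X.dl (- \<psi> x) (\<psi> x) (fd \<psi> x (S.X.lif x (S.pr i v)))"
  show "T.pr w ?u = 0"
  proof (cases "i \<in> {1..r} \<and> w \<in> {1..r}")
    case True
    then have "S.frame x (S.pr i v) \<in> filtration G i (E x)"
      using S.frame_in_filtration_iff[of i x "S.pr i v"] by (auto simp: S.X.pr_pr)
    then have "T.frame (\<psi> x) ?u \<in> filtration G' i (E' (\<psi> x))"
      using carnot True unfolding carnot_map_def differential_frame[symmetric] E_\<psi> by blast
    then show ?thesis
      using True \<open>i < w\<close> T.frame_in_filtration_iff[of i "\<psi> x" ?u] by auto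
  next
    case False
    then consider "S.pr i v = 0" | "T.pr w ?u = 0"
      using S.X.pr_outside T.X.pr_outside by blast
    then show ?thesis
      by cases (simp_all add: linear_0[OF S.X.linear_dl] fd_zero[OF smooth_coordinates]
          linear_0[OF T.X.linear_dl] linear_0[OF T.X.linear_pr])
  qed
qed

lemma differential_frame_tdiff: "differential (charts G') \<phi> (S.frame a v) = T.frame (\<psi> a) (tdiff a v)"
  by (simp add: differential_frame tdiff_def)

text \<open>The image of a coset, enlarged by the target subspace, is the coset of the image of a
  representative. Modulo step \<open>w - 1\<close> this image keeps only its component of weight
  \<open>w\<close>, since the higher ones vanish by triangularity.\<close>

lemma carnot_differential_gr_frame:
  "carnot_differential r G G' \<phi> (E a) (S.gr_frame a v) = T.gr_frame (\<psi> a) (gr_diff a v)"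
proof -
  have "differential (charts G') \<phi> ` gr_class G (E a) w (S.frame a (S.pr w v)) + filtration G' (w - 1) (\<phi> (E a))
      = gr_class G' (E' (\<psi> a)) w (T.frame (\<psi> a) (T.pr w (gr_diff a v)))" if w: "w \<in> {1..r}" for w
  proof -
    have w1: "w - 1 \<le> r" using w by auto
    have "differential (charts G') \<phi> ` filtration G (w - 1) (E a) \<subseteq> filtration G' (w - 1) (E' (\<psi> a))"
    proof (cases "w - 1 \<in> {1..r}")
      case True then show ?thesis using carnot unfolding carnot_map_def E_\<psi> by blast
    next
      case False
      then have "w - 1 = 0" using w by auto
      then show ?thesis by (simp add: filtration_def linear_0[OF linear_differential])
    qed
    then have "differential (charts G') \<phi> ` gr_class G (E a) w (S.frame a (S.pr w v)) + filtration G' (w - 1) (E' (\<psi> a))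
        = gr_class G' (E' (\<psi> a)) w (T.frame (\<psi> a) (tdiff a (S.pr w v)))"
      unfolding gr_class_def differential_frame_tdiff[symmetric]
      by (intro linear_image_coset linear_differential S.filtration_subspace T.filtration_subspace w1)
    also have "\<dots> = gr_class G' (E' (\<psi> a)) w (T.frame (\<psi> a) (T.pr w (gr_diff a v)))"
      unfolding T.gr_class_frame_eq_iff[OF w]
    proof (intro ballI impI)
      fix i assume "w \<le> i"
      then show "T.pr i (tdiff a (S.pr w v)) = T.pr i (T.pr w (gr_diff a v))"
        by (cases "i = w") (auto simp: pr_gr_diff T.X.pr_pr pr_tdiff)
    qed
    finally show ?thesis by (simp only: E_\<psi>)
  qed
  then show ?thesis
    unfolding carnot_differential_def S.gr_frame_eq T.gr_frame_eq
    by (intro restrict_ext) (simp only: restrict_apply')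
qed

lemma pansu_quotient_eq:
  assumes "t \<noteq> 0"
  shows "pansu_quotient r G G' \<phi> (E a) (E x) t
    = E' (T.X.dil (inverse t) (T.cmult (- \<psi> a) (\<psi> (S.cmult a (S.X.dil t x)))))"
proof -
  have inv: "inv\<^bsub>G'\<^esub> (E' y) = E' (- y)" for y
  proof -
    interpret group G' by (rule T.group_G)
    have "E' (- y) \<otimes>\<^bsub>G'\<^esub> E' y = \<one>\<^bsub>G'\<^esub>" by (simp flip: T.E_cmult T.E_cunit)
    then show ?thesis by (intro inv_equality) simp_all
  qed
  have "inv\<^bsub>G'\<^esub> (\<phi> (E a)) \<otimes>\<^bsub>G'\<^esub> \<phi> (E a \<otimes>\<^bsub>G\<^esub> dilation r G t (E x))
      = E' (T.cmult (- \<psi> a) (\<psi> (S.cmult a (S.X.dil t x))))"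
    by (simp add: S.dilation_E T.E_cmult inv flip: E_\<psi> S.E_cmult)
  then show ?thesis by (simp add: pansu_quotient_def T.inv_dilation_E[OF assms])
qed

lemma pansu_quotient_tendsto:
  "(pansu_quotient r G G' \<phi> (E a) (E x) \<longlongrightarrow> E' (gr_diff a x)) (at 0)"
proof -
  have "isCont E' (gr_diff a x)"
    using T.smooth_map_E by (simp add: smooth_map_def continuous_on_eq_continuous_at)
  from isCont_tendsto_compose[OF this pansu_limit]
  show ?thesis
    \<comment> \<open>The filter \<open>at 0\<close> excludes \<open>t = 0\<close>, so the
      coordinate formula for the quotient holds eventually.\<close>
    by (rule Lim_transform_eventually) (simp add: eventually_at_filter pansu_quotient_eq)
qed

lemma pansu_derivative_E: "pansu_derivative r G G' \<phi> (E a) (E x) = E' (gr_diff a x)"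
  unfolding pansu_derivative_def by (rule tendsto_Lim[OF _ pansu_quotient_tendsto]) simp

lemma pansu_derivative_eq_carnot_differential:
  "pansu_differentiable r G G' \<phi> (E a) \<and>
    pansu_derivative r G G' \<phi> (E a) =
      Lambda r G' (\<phi> (E a)) \<circ> carnot_differential r G G' \<phi> (E a) \<circ>
        inv_into (carrier (tangent_group r G (E a))) (Lambda r G (E a)) \<and>
    (\<forall>\<Xi>\<in>carrier (tangent_group r G (E a)).
      pansu_derivative r G G' \<phi> (E a) (Lambda r G (E a) \<Xi>) =
        Lambda r G' (\<phi> (E a)) (carnot_differential r G G' \<phi> (E a) \<Xi>))"
proof (intro conjI ballI)
  show "pansu_differentiable r G G' \<phi> (E a)"
    unfolding pansu_differentiable_def
  proof
    fix x show "\<exists>l. (pansu_quotient r G G' \<phi> (E a) x \<longlongrightarrow> l) (at 0)"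
      using pansu_quotient_tendsto[of a "S.coord x"] by auto
  qed
  have D: "Lambda r G' (\<phi> (E a)) (carnot_differential r G G' \<phi> (E a) (S.gr_frame a v)) = E' (gr_diff a v)" for v
    using T.Lambda_gr_frame[of "\<psi> a" "gr_diff a v"] by (simp add: carnot_differential_gr_frame E_\<psi>)
  show "pansu_derivative r G G' \<phi> (E a) = Lambda r G' (\<phi> (E a)) \<circ> carnot_differential r G G' \<phi> (E a) \<circ>
        inv_into (carrier (tangent_group r G (E a))) (Lambda r G (E a))"
  proof
    fix x
    obtain v where "x = E v" using S.E_coord by metis
    then show "pansu_derivative r G G' \<phi> (E a) x = (Lambda r G' (\<phi> (E a)) \<circ> carnot_differential r G G' \<phi> (E a) \<circ>
        inv_into (carrier (tangent_group r G (E a))) (Lambda r G (E a))) x"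
      by (simp add: pansu_derivative_E S.inv_Lambda D)
  qed
  fix \<Xi> assume "\<Xi> \<in> carrier (tangent_group r G (E a))"
  then obtain v where "\<Xi> = S.gr_frame a v" unfolding S.carrier_tangent_group by blast
  then show "pansu_derivative r G G' \<phi> (E a) (Lambda r G (E a) \<Xi>) =
        Lambda r G' (\<phi> (E a)) (carnot_differential r G G' \<phi> (E a) \<Xi>)"
    by (simp add: S.Lambda_gr_frame pansu_derivative_E D)
qed

end

lemma graded_chart_exists:
  fixes G :: "('a::{t2_space,second_countable_topology}, 'e::euclidean_space) graded_group"
  assumes "graded_nilpotent_lie_group r G"
  shows "\<exists>E. graded_chart G E r"
  using exponential_chart_exists[of G] assms
  by (auto simp: graded_nilpotent_lie_group_def graded_chart_def graded_chart_axioms_def)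

theorem theorem7p2:
  fixes G :: "('a::{t2_space,second_countable_topology}, 'e::euclidean_space) graded_group"
    and G' :: "('b::{t2_space,second_countable_topology}, 'f::euclidean_space) graded_group"
    and \<phi> :: "'a \<Rightarrow> 'b" and r :: nat
  assumes "graded_nilpotent_lie_group r G" and "graded_nilpotent_lie_group r G'"
    and "carnot_map r G G' \<phi>"
  shows "\<forall>a. pansu_differentiable r G G' \<phi> a \<and>
    pansu_derivative r G G' \<phi> a =
      Lambda r G' (\<phi> a) \<circ> carnot_differential r G G' \<phi> a \<circ>
        inv_into (carrier (tangent_group r G a)) (Lambda r G a) \<and>
    (\<forall>\<Xi>\<in>carrier (tangent_group r G a).
      pansu_derivative r G G' \<phi> a (Lambda r G a \<Xi>) =
        Lambda r G' (\<phi> a) (carnot_differential r G G' \<phi> a \<Xi>))"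
proof
  fix a
  obtain E where "graded_chart G E r" using graded_chart_exists[OF assms(1)] by blast
  moreover obtain E' where "graded_chart G' E' r" using graded_chart_exists[OF assms(2)] by blast
  ultimately interpret carnot_map_charts G E r G' E' \<phi>
    using assms(3) by (simp add: carnot_map_charts_def carnot_map_charts_axioms_def)
  show "pansu_differentiable r G G' \<phi> a \<and>
    pansu_derivative r G G' \<phi> a =
      Lambda r G' (\<phi> a) \<circ> carnot_differential r G G' \<phi> a \<circ>
        inv_into (carrier (tangent_group r G a)) (Lambda r G a) \<and>
    (\<forall>\<Xi>\<in>carrier (tangent_group r G a).
      pansu_derivative r G G' \<phi> a (Lambda r G a \<Xi>) =
        Lambda r G' (\<phi> a) (carnot_differential r G G' \<phi> a \<Xi>))"
    using pansu_derivative_eq_carnot_differential[of "S.coord a"] unfolding S.E_coord .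
qed

end
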